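(* Let the boundary conditions be local, i.e. $X=\bigoplus_{v\in V}X_v$, $L=\bigoplus_{v\in V}L_v$, and assume that for all $v\in V_1$ there exists $\xi^v\in X_v$ with $\xi^v(v)=1$; fix such $\xi^v$. Then the operator $H$ associated with $\tau$ is given by $$D(H)=\bigl\{f\in\mathcal H_\Gamma:\ (f_e)_{e\in E_1}\in D(\hat H),\ \operatorname{tr}_v(\iota f)\in X_v,\ Q_{v,0}\operatorname{str}_v(\iota f)'=Q_{v,0}L_v\operatorname{tr}_v(\iota f)\ (v\in V)\bigr\},$$ $$((Hf)_e)_{e\in E_1}=\hat H(f_e)_{e\in E_1},$$ $$(Hf)_v=\frac1{\mu_v}\bigl(L_v\operatorname{tr}_v(\iota f)-\operatorname{str}_v(\iota f)'\mid\xi^v\bigr)\qquad(v\in V_1).$$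
   Context: **Setting.** $\mathbb K\in\{\mathbb R,\mathbb C\}$; all function spaces consist of $\mathbb K$-valued functions. $\Gamma=(V,E,\gamma)$ is a finite directed graph: $V$ (vertices) and $E$ (edges) are finite disjoint sets and $\gamma=(\gamma_0,\gamma_1)\colon E\to V\times V$ assigns to each edge a starting vertex $\gamma_0(e)$ and an end vertex $\gamma_1(e)$. Each $e\in E$ corresponds to an interval $[a_e,b_e]\subseteq\mathbb R$, $a_e<b_e$, and carries a finite Borel measure $\mu_e$ on $[a_e,b_e]$ such that either $\mu_e=0$, or $a_e,b_e\in\operatorname{spt}\mu_e$ and $\mu_e(\{a_e,b_e\})=0$. Put $E_0:=\{e\in E:\mu_e=0\}$, $E_1:=E\setminus E_0$. Each $v\in V$ has a weight $\mu_v\geq0$; put $V_0:=\{v\in V:\mu_v=0\}$, $V_1:=V\setminus V_0$. **Hilbert space.** $\mathcal H_\Gamma:=\mathcal H_E\oplus\mathbb K^{V_1}$ with $\mathcal H_E:=\bigoplus_{e\in E_1}L_2([a_e,b_e],\mu_e)$ and scalar product $(f\mid g)_{\mathcal H_\Gamma}=\sum_{e\in E_1}(f_e\mid g_e)_{L_2([a_e,b_e],\mu_e)}+\sum_{v\in V_1}f_v\overline{g_v}\,\mu_v$ for $f=((f_e)_{e\in E_1},(f_v)_{v\in V_1})$ and $g$ likewise. **The map $\iota$.** For $e\in E_1$ let $C_{\mu_e}[a_e,b_e]$ be the set of $f\in C[a_e,b_e]$ that are affine linear on the components of $[a_e,b_e]\setminus\operatorname{spt}\mu_e$, and $W^1_{2,\mu_e}(a_e,b_e):=W^1_2(a_e,b_e)\cap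 C_{\mu_e}[a_e,b_e]$. Let $D(\iota_e)$ be the set of $f\in L_2([a_e,b_e],\mu_e)$ for which there is $g\in W^1_2(a_e,b_e)\cap C[a_e,b_e]$ with $g=f$ $\mu_e$-a.e. For $f\in D(\iota_e)$, $\iota_ef$ denotes the unique $g\in W^1_{2,\mu_e}(a_e,b_e)$ with $g=f$ $\mu_e$-a.e. (existence and uniqueness are known). Define $D(\iota):=\{f\in\mathcal H_\Gamma: f_e\in D(\iota_e)\ (e\in E_1)\}$, $(\iota f)_e:=\iota_ef_e$ $(e\in E_1)$, $(\iota f)_v:=f_v$ $(v\in V_1)$. Shorthand: $(\iota f)':=((\iota_ef_e)')_{e\in E_1}$. **Trace.** With $E_1':=E_1\times\{0,1\}$, define $\operatorname{tr}\colon\prod_{e\in E_1}C[a_e,b_e]\times\mathbb K^{V_1}\to\mathbb K^{E_1'\cup V_1}$ by $\operatorname{tr}f(e,0):=f_e(a_e)$, $\operatorname{tr}f(e,1):=f_e(b_e)$ $(e\in E_1)$, $\operatorname{tr}f(v):=f_v$ $(v\in V_1)$. The space $\mathbb K^{E_1'\cup V_1}$ has the scalar product $(\xi\mid\eta):=\sum_{(e,j)\in E_1'}\xi(e,j)\overline{\eta(e,j)}+\sum_{v\in V_1}\xi(v)\overline{\eta(v)}\,\mu_v$. **Form.** For a subspace $X$ of $\mathbb K^{E_1'\cup V_1}$ and a self-adjoint operator $L$ in $X$ (with respect to the scalar product $(\xi\mid\eta)=\sum_{(e,j)\in E_1'}\xi(e,j)\overline{\eta(e,j)}+\sum_{v\in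 V_1}\xi(v)\overline{\eta(v)}\,\mu_v$ of $\mathbb K^{E_1'\cup V_1}$, restricted to $X$) define $$D(\tau):=\{f\in D(\iota):\operatorname{tr}(\iota f)\in X\},$$ $$\tau(f,g):=\sum_{e\in E_1}\int_{a_e}^{b_e}(\iota_ef_e)'(x)\overline{(\iota_eg_e)'(x)}\,dx+\bigl(L\operatorname{tr}(\iota f)\mid\operatorname{tr}(\iota g)\bigr)\qquad(f,g\in D(\tau)).$$ The operator $H$ associated with $\tau$ (for $D(\tau)$ dense) is defined by: $f\in D(H)$ and $Hf=h$ if and only if $f\in D(\tau)$, $h\in\mathcal H_\Gamma$ and $\tau(f,g)=(h\mid g)_{\mathcal H_\Gamma}$ for all $g\in D(\tau)$. **Local boundary conditions.** For $v\in V$ let $E_{1,v,j}:=\{e\in E_1:\gamma_j(e)=v\}$ $(j=0,1)$ and $E_{1,v}:=(E_{1,v,0}\times\{0\})\cup(E_{1,v,1}\times\{1\})$, so that $E_1'$ is the disjoint union of the $E_{1,v}$, $v\in V$. Put $S_v:=E_{1,v}$ if $v\in V_0$ and $S_v:=E_{1,v}\cup\{v\}$ if $v\in V_1$; $\mathbb K^{S_v}$ carries the scalar product inherited from $\mathbb K^{E_1'\cup V_1}$ (so $\mathbb K^{E_1'\cup V_1}=\bigoplus_{v\in V}\mathbb K^{S_v}$). The boundary conditions are local if for each $v\in V$ there are a subspace $X_v\subseteq\mathbb K^{S_v}$ and a self-adjoint operator $L_v$ in $X_v$ such that $X=\bigoplus_{v\in V}X_v$ and $L=\bigoplus_{v\in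 V}L_v$. The existence, for all $v\in V_1$, of $\xi^v\in X_v$ with $\xi^v(v)=1$ is equivalent to density of $D(\tau)$ in $\mathcal H_\Gamma$. Put $\operatorname{tr}_vf:=(\operatorname{tr}f)|_{S_v}$; $X_{v,0}:=X_v$ if $v\in V_0$, $X_{v,0}:=\{\xi\in X_v:\xi(v)=0\}$ if $v\in V_1$; $Q_{v,0}$ is the orthogonal projection in $\mathbb K^{S_v}$ onto $X_{v,0}$. **Derivative with respect to $\mu$.** For an interval $[a,b]$ with a finite Borel measure $\mu$ ($a,b\in\operatorname{spt}\mu$, $\mu(\{a,b\})=0$): if $f\in L_{1,\mathrm{loc}}(a,b)$ and $g\in L_1([a,b],\mu)$ satisfy $f'=g\mu$ in the sense of distributions, then $\partial_\mu f:=g$. Equivalently, $f(x)=c+\int_{(a,x)}g\,d\mu$ for a.e. $x$, for some $c\in\mathbb K$; so $f$ has representatives of bounded variation, whose one-sided limits exist and do not depend on the representative. **Maximal operator.** $D(\hat H)$ is the set of $f\in\prod_{e\in E_1}D(\iota_e)$ such that for all $e\in E_1$: $(\iota_ef_e)'\in L_1(a_e,b_e)$, $\partial_{\mu_e}(\iota_ef_e)'$ exists and $\partial_{\mu_e}(\iota_ef_e)'\in L_2([a_e,b_e],\mu_e)$; and $\hat Hf:=(-\partial_{\mu_e}(\iota_ef_e)')_{e\in E_1}$. **Signed trace.** $\operatorname{str}\colon\prod_{e\in E_1}BV(a_e,b_e)\to\mathbb K^{E_1'}$ is defined by $\operatorname{str}f(e,0):=f_e(a_e+)$, $\operatorname{str}f(e,1):=-f_e(b_e-)$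 (one-sided limits), where $BV(a_e,b_e)$ denotes the functions of bounded variation modulo a.e. equality. $\operatorname{str}_vf:=(\operatorname{str}f)|_{E_{1,v}}\in\mathbb K^{E_{1,v}}$, considered as an element of $\mathbb K^{S_v}$ (extended by $0$ at $v$ if $v\in V_1$). For $f$ with $(f_e)_{e\in E_1}\in D(\hat H)$, $\operatorname{str}_v(\iota f)'$ is formed with representatives of bounded variation of $(\iota_ef_e)'$. *)

theory Defs
  imports "HOL-Analysis.Analysis" "HOL-Library.Function_Algebras"
begin

section \<open>The scalar field\<close>

text \<open>
  By the Frobenius theorem the only models of this class are the real numbers (with trivial
  conjugation) and the complex numbers (with \<^const>\<open>cnj\<close>), so that a type variable of
  this sort ranges over exactly these two fields.
\<close>

class real_or_complex = real_normed_field + euclidean_space +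
  fixes conjg :: "'a \<Rightarrow> 'a"
  assumes conjg_add: "conjg (x + y) = conjg x + conjg y"
    and conjg_mult: "conjg (x * y) = conjg x * conjg y"
    and mult_conjg: "x * conjg x = (norm x)\<^sup>2 *\<^sub>R 1"

instantiation real :: real_or_complex
begin
definition conjg_real :: "real \<Rightarrow> real" where "conjg_real x = x"
instance by standard (simp_all add: conjg_real_def power2_eq_square)
end

instantiation complex :: real_or_complex
begin
definition conjg_complex :: "complex \<Rightarrow> complex" where "conjg_complex = cnj"
instance by standard (simp_all add: conjg_complex_def complex_norm_square[symmetric] scaleR_conv_of_real)
end


section \<open>Function spaces on an interval\<close>

text \<open>
  Elements of Lebesgue and Sobolev spaces are represented by functions; all notions below are
  invariant under modification of the representatives on null sets.
\<close>

definition L2 :: "'x measure \<Rightarrow> ('x \<Rightarrow> 'a::real_or_complex) set" where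
  "L2 M = {f \<in> borel_measurable M. integrable M (\<lambda>x. (norm (f x))\<^sup>2)}"

definition L2_inner :: "'x measure \<Rightarrow> ('x \<Rightarrow> 'a::real_or_complex) \<Rightarrow> ('x \<Rightarrow> 'a) \<Rightarrow> 'a" where
  "L2_inner M f g = (\<integral>x. f x * conjg (g x) \<partial>M)"

definition L1_loc :: "real \<Rightarrow> real \<Rightarrow> (real \<Rightarrow> 'a::real_or_complex) set" where
  "L1_loc a b = {f. \<forall>c d. a < c \<longrightarrow> d < b \<longrightarrow> integrable (lebesgue_on {c..d}) f}"

definition smooth :: "(real \<Rightarrow> 'a::real_normed_vector) \<Rightarrow> bool" where
  "smooth \<phi> \<longleftrightarrow> (\<exists>D :: nat \<Rightarrow> real \<Rightarrow> 'a. D 0 = \<phi> \<and>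
     (\<forall>n x. (D n has_vector_derivative D (Suc n) x) (at x)))"

definition test_functions :: "real \<Rightarrow> real \<Rightarrow> (real \<Rightarrow> 'a::real_or_complex) set" where
  "test_functions a b = {\<phi>. smooth \<phi> \<and> (\<exists>c d. a < c \<and> d < b \<and> (\<forall>x. x \<notin> {c..d} \<longrightarrow> \<phi> x = 0))}"

definition weak_deriv ::
    "real \<Rightarrow> real \<Rightarrow> (real \<Rightarrow> 'a::real_or_complex) \<Rightarrow> (real \<Rightarrow> 'a) \<Rightarrow> bool" where
  "weak_deriv a b f g \<longleftrightarrow> f \<in> L1_loc a b \<and> g \<in> L1_loc a b \<and>
     (\<forall>\<phi>\<in>test_functions a b.
        (\<integral>x. f x * vector_derivative \<phi> (at x) \<partial>lebesgue_on {a<..<b})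
          = - (\<integral>x. g x * \<phi> x \<partial>lebesgue_on {a<..<b}))"

definition sobolev_W12 :: "real \<Rightarrow> real \<Rightarrow> (real \<Rightarrow> 'a::real_or_complex) set" where
  "sobolev_W12 a b = {f \<in> L2 (lebesgue_on {a<..<b}).
     \<exists>g\<in>L2 (lebesgue_on {a<..<b}). weak_deriv a b f g}"

text \<open>The weak derivative is unique up to equality almost everywhere.\<close>

definition sobolev_deriv ::
    "real \<Rightarrow> real \<Rightarrow> (real \<Rightarrow> 'a::real_or_complex) \<Rightarrow> real \<Rightarrow> 'a" where
  "sobolev_deriv a b f = (SOME g. weak_deriv a b f g)"

definition mu_weak_deriv ::
    "real \<Rightarrow> real \<Rightarrow> real measure \<Rightarrow> (real \<Rightarrow> 'a::real_or_complex) \<Rightarrow> (real \<Rightarrow> 'a) \<Rightarrow> bool" where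
  "mu_weak_deriv a b M f g \<longleftrightarrow> f \<in> L1_loc a b \<and> integrable M g \<and>
     (\<forall>\<phi>\<in>test_functions a b.
        (\<integral>x. f x * vector_derivative \<phi> (at x) \<partial>lebesgue_on {a<..<b})
          = - (\<integral>x. g x * \<phi> x \<partial>M))"

text \<open>\<open>\<partial>\<^sub>\<mu> f\<close>, which is unique up to equality \<open>\<mu>\<close>-almost everywhere.\<close>

definition mu_deriv ::
    "real \<Rightarrow> real \<Rightarrow> real measure \<Rightarrow> (real \<Rightarrow> 'a::real_or_complex) \<Rightarrow> real \<Rightarrow> 'a" where
  "mu_deriv a b M f = (SOME g. mu_weak_deriv a b M f g)"

definition bounded_variation_on :: "real set \<Rightarrow> (real \<Rightarrow> 'a::real_normed_vector) \<Rightarrow> bool" where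
  "bounded_variation_on I f \<longleftrightarrow> (\<exists>B. \<forall>n (t :: nat \<Rightarrow> real).
     (\<forall>i\<le>n. t i \<in> I) \<and> (\<forall>i<n. t i \<le> t (Suc i)) \<longrightarrow>
     (\<Sum>i<n. norm (f (t (Suc i)) - f (t i))) \<le> B)"

definition bv_rep :: "real \<Rightarrow> real \<Rightarrow> (real \<Rightarrow> 'a::real_or_complex) \<Rightarrow> real \<Rightarrow> 'a" where
  "bv_rep a b f = (SOME g. bounded_variation_on {a<..<b} g \<and>
     (AE x in lebesgue_on {a<..<b}. g x = f x))"


section \<open>The map \<open>\<iota>\<close> on one edge\<close>

definition spt :: "real measure \<Rightarrow> real set" where
  "spt M = {x \<in> space M. \<forall>U. open U \<and> x \<in> U \<longrightarrow> 0 < emeasure M (U \<inter> space M)}"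

definition C_mu :: "real \<Rightarrow> real \<Rightarrow> real measure \<Rightarrow> (real \<Rightarrow> 'a::real_or_complex) set" where
  "C_mu a b M = {f. continuous_on {a..b} f \<and>
     (\<forall>I\<in>components ({a..b} - spt M). \<exists>c d. \<forall>x\<in>I. f x = c + of_real x * d)}"

definition W12_mu :: "real \<Rightarrow> real \<Rightarrow> real measure \<Rightarrow> (real \<Rightarrow> 'a::real_or_complex) set" where
  "W12_mu a b M = sobolev_W12 a b \<inter> C_mu a b M"

definition dom_iota_edge :: "real \<Rightarrow> real \<Rightarrow> real measure \<Rightarrow> (real \<Rightarrow> 'a::real_or_complex) set" where
  "dom_iota_edge a b M = {f \<in> L2 M.
     \<exists>g. g \<in> sobolev_W12 a b \<and> continuous_on {a..b} g \<and> (AE x in M. g x = f x)}"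

text \<open>Any two functions satisfying the following selection agree on \<open>[a, b]\<close>.\<close>

definition iota_edge ::
    "real \<Rightarrow> real \<Rightarrow> real measure \<Rightarrow> (real \<Rightarrow> 'a::real_or_complex) \<Rightarrow> real \<Rightarrow> 'a" where
  "iota_edge a b M f = (SOME g. g \<in> W12_mu a b M \<and> (AE x in M. g x = f x))"


section \<open>Graphs with measures on edges and weights on vertices\<close>

text \<open>
  \<open>endvert G j\<close> is the map \<open>\<gamma>\<^sub>j\<close>, where \<open>j = 0\<close> yields the starting vertex and
  \<open>j = 1\<close> the end vertex; other values of \<open>j\<close> are irrelevant.
\<close>

record ('v, 'e) measure_graph =
  verts :: "'v set"
  edges :: "'e set"
  endvert :: "nat \<Rightarrow> 'e \<Rightarrow> 'v"
  lend :: "'e \<Rightarrow> real"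
  rend :: "'e \<Rightarrow> real"
  emeas :: "'e \<Rightarrow> real measure"
  weight :: "'v \<Rightarrow> real"

definition valid_graph :: "('v, 'e) measure_graph \<Rightarrow> bool" where
  "valid_graph G \<longleftrightarrow> finite (verts G) \<and> finite (edges G) \<and>
     (\<forall>e\<in>edges G. endvert G 0 e \<in> verts G \<and> endvert G 1 e \<in> verts G \<and>
        lend G e < rend G e \<and>
        sets (emeas G e) = sets (restrict_space borel {lend G e..rend G e}) \<and>
        finite_measure (emeas G e) \<and>
        (emeasure (emeas G e) {lend G e..rend G e} = 0 \<or>
          lend G e \<in> spt (emeas G e) \<and> rend G e \<in> spt (emeas G e) \<and>
          emeasure (emeas G e) {lend G e, rend G e} = 0)) \<and>
     (\<forall>v\<in>verts G. 0 \<le> weight G v)"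

definition E1 :: "('v, 'e) measure_graph \<Rightarrow> 'e set" where
  "E1 G = {e \<in> edges G. emeasure (emeas G e) {lend G e..rend G e} \<noteq> 0}"

definition V0 :: "('v, 'e) measure_graph \<Rightarrow> 'v set" where
  "V0 G = {v \<in> verts G. weight G v = 0}"

definition V1 :: "('v, 'e) measure_graph \<Rightarrow> 'v set" where
  "V1 G = verts G - V0 G"

text \<open>
  An element \<open>f\<close> of \<open>\<H>\<^sub>\<Gamma>\<close> is represented by the pair of the families
  \<open>fst f = (f\<^sub>e)\<^sub>e\<close> and \<open>snd f = (f\<^sub>v)\<^sub>v\<close>, of which only the members with
  \<open>e \<in> E\<^sub>1\<close> and \<open>v \<in> V\<^sub>1\<close> are relevant.
\<close>

type_synonym ('v, 'e, 'a) gfun = "('e \<Rightarrow> real \<Rightarrow> 'a) \<times> ('v \<Rightarrow> 'a)"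

definition hilb :: "('v, 'e) measure_graph \<Rightarrow> ('v, 'e, 'a::real_or_complex) gfun set" where
  "hilb G = {f. \<forall>e\<in>E1 G. fst f e \<in> L2 (emeas G e)}"

definition hilb_inner ::
    "('v, 'e) measure_graph \<Rightarrow> ('v, 'e, 'a::real_or_complex) gfun \<Rightarrow> ('v, 'e, 'a) gfun \<Rightarrow> 'a" where
  "hilb_inner G f g = (\<Sum>e\<in>E1 G. L2_inner (emeas G e) (fst f e) (fst g e))
     + (\<Sum>v\<in>V1 G. snd f v * conjg (snd g v) * of_real (weight G v))"

abbreviation iota_e ::
    "('v, 'e) measure_graph \<Rightarrow> 'e \<Rightarrow> (real \<Rightarrow> 'a::real_or_complex) \<Rightarrow> real \<Rightarrow> 'a" where
  "iota_e G e \<equiv> iota_edge (lend G e) (rend G e) (emeas G e)"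

abbreviation dom_iota_e ::
    "('v, 'e) measure_graph \<Rightarrow> 'e \<Rightarrow> (real \<Rightarrow> 'a::real_or_complex) set" where
  "dom_iota_e G e \<equiv> dom_iota_edge (lend G e) (rend G e) (emeas G e)"

definition dom_iota :: "('v, 'e) measure_graph \<Rightarrow> ('v, 'e, 'a::real_or_complex) gfun set" where
  "dom_iota G = {f \<in> hilb G. \<forall>e\<in>E1 G. fst f e \<in> dom_iota_e G e}"

definition iota ::
    "('v, 'e) measure_graph \<Rightarrow> ('v, 'e, 'a::real_or_complex) gfun \<Rightarrow> ('v, 'e, 'a) gfun" where
  "iota G f = ((\<lambda>e. iota_e G e (fst f e)), snd f)"

text \<open>\<open>(\<iota>\<^sub>e f\<^sub>e)'\<close> for each edge \<open>e\<close>.\<close>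

definition iota_deriv ::
    "('v, 'e) measure_graph \<Rightarrow> ('e \<Rightarrow> real \<Rightarrow> 'a::real_or_complex) \<Rightarrow> 'e \<Rightarrow> real \<Rightarrow> 'a" where
  "iota_deriv G f e = sobolev_deriv (lend G e) (rend G e) (iota_e G e (f e))"


section \<open>Boundary values\<close>

text \<open>
  For a subset \<open>S\<close> of the index set \<open>E\<^sub>1' \<union> V\<^sub>1\<close>, the space \<open>\<bbbK>\<^sup>S\<close> consists of the
  functions on the whole index type that vanish outside \<open>S\<close>; thus \<open>\<bbbK>\<^sup>S\<close> is literally a
  subspace of \<open>\<bbbK>\<close> to the power \<open>E\<^sub>1' \<union> V\<^sub>1\<close>.
\<close>

type_synonym ('v, 'e) bidx = "('e \<times> nat) + 'v"

definition coord_scale :: "'a::real_or_complex \<Rightarrow> ('i \<Rightarrow> 'a) \<Rightarrow> 'i \<Rightarrow> 'a" where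
  "coord_scale c \<xi> = (\<lambda>i. c * \<xi> i)"

interpretation coord: vector_space "coord_scale :: 'a::real_or_complex \<Rightarrow> ('i \<Rightarrow> 'a) \<Rightarrow> 'i \<Rightarrow> 'a"
  by unfold_locales (auto simp: coord_scale_def fun_eq_iff algebra_simps)

definition coord_space :: "'i set \<Rightarrow> ('i \<Rightarrow> 'a::real_or_complex) set" where
  "coord_space S = {\<xi>. \<forall>i. i \<notin> S \<longrightarrow> \<xi> i = 0}"

definition coord_restrict :: "'i set \<Rightarrow> ('i \<Rightarrow> 'a::real_or_complex) \<Rightarrow> 'i \<Rightarrow> 'a" where
  "coord_restrict S \<xi> = (\<lambda>i. if i \<in> S then \<xi> i else 0)"

definition E1' :: "('v, 'e) measure_graph \<Rightarrow> ('e \<times> nat) set" where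
  "E1' G = E1 G \<times> {0, 1}"

definition bindex :: "('v, 'e) measure_graph \<Rightarrow> ('v, 'e) bidx set" where
  "bindex G = Inl ` E1' G \<union> Inr ` V1 G"

definition binner ::
    "('v, 'e) measure_graph \<Rightarrow> (('v, 'e) bidx \<Rightarrow> 'a::real_or_complex) \<Rightarrow> (('v, 'e) bidx \<Rightarrow> 'a) \<Rightarrow> 'a" where
  "binner G \<xi> \<eta> = (\<Sum>p\<in>E1' G. \<xi> (Inl p) * conjg (\<eta> (Inl p)))
     + (\<Sum>v\<in>V1 G. \<xi> (Inr v) * conjg (\<eta> (Inr v)) * of_real (weight G v))"

definition btrace ::
    "('v, 'e) measure_graph \<Rightarrow> ('v, 'e, 'a::real_or_complex) gfun \<Rightarrow> ('v, 'e) bidx \<Rightarrow> 'a" where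
  "btrace G f = coord_restrict (bindex G) (\<lambda>i. case i of
       Inl (e, j) \<Rightarrow> if j = 0 then fst f e (lend G e) else fst f e (rend G e)
     | Inr v \<Rightarrow> snd f v)"

definition signed_trace ::
    "('v, 'e) measure_graph \<Rightarrow> ('e \<Rightarrow> real \<Rightarrow> 'a::real_or_complex) \<Rightarrow> ('v, 'e) bidx \<Rightarrow> 'a" where
  "signed_trace G f = coord_restrict (Inl ` E1' G) (\<lambda>i. case i of
       Inl (e, j) \<Rightarrow>
         let g = bv_rep (lend G e) (rend G e) (f e)
         in if j = 0 then Lim (at_right (lend G e)) g else - Lim (at_left (rend G e)) g
     | Inr v \<Rightarrow> 0)"

text \<open>
  As \<open>X\<close> is finite-dimensional, a self-adjoint operator in \<open>X\<close> is an everywhere defined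
  symmetric linear map from \<open>X\<close> to itself.
\<close>

definition selfadjoint_in ::
    "('v, 'e) measure_graph \<Rightarrow> (('v, 'e) bidx \<Rightarrow> 'a::real_or_complex) set \<Rightarrow>
     ((('v, 'e) bidx \<Rightarrow> 'a) \<Rightarrow> (('v, 'e) bidx \<Rightarrow> 'a)) \<Rightarrow> bool" where
  "selfadjoint_in G X L \<longleftrightarrow>
     (\<forall>\<xi>\<in>X. L \<xi> \<in> X) \<and>
     (\<forall>\<xi>\<in>X. \<forall>\<eta>\<in>X. L (\<xi> + \<eta>) = L \<xi> + L \<eta>) \<and>
     (\<forall>c. \<forall>\<xi>\<in>X. L (coord_scale c \<xi>) = coord_scale c (L \<xi>)) \<and>
     (\<forall>\<xi>\<in>X. \<forall>\<eta>\<in>X. binner G (L \<xi>) \<eta> = binner G \<xi> (L \<eta>))"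

definition orth_proj ::
    "('v, 'e) measure_graph \<Rightarrow> (('v, 'e) bidx \<Rightarrow> 'a::real_or_complex) set \<Rightarrow>
     (('v, 'e) bidx \<Rightarrow> 'a) \<Rightarrow> (('v, 'e) bidx \<Rightarrow> 'a)" where
  "orth_proj G Y \<xi> = (THE \<eta>. \<eta> \<in> Y \<and> (\<forall>\<zeta>\<in>Y. binner G (\<xi> - \<eta>) \<zeta> = 0))"


section \<open>The form \<open>\<tau>\<close> and the associated operator\<close>

definition dom_form ::
    "('v, 'e) measure_graph \<Rightarrow> (('v, 'e) bidx \<Rightarrow> 'a::real_or_complex) set \<Rightarrow>
     ('v, 'e, 'a) gfun set" where
  "dom_form G X = {f \<in> dom_iota G. btrace G (iota G f) \<in> X}"

definition form ::
    "('v, 'e) measure_graph \<Rightarrow> ((('v, 'e) bidx \<Rightarrow> 'a::real_or_complex) \<Rightarrow> (('v, 'e) bidx \<Rightarrow> 'a)) \<Rightarrow>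
     ('v, 'e, 'a) gfun \<Rightarrow> ('v, 'e, 'a) gfun \<Rightarrow> 'a" where
  "form G L f g =
     (\<Sum>e\<in>E1 G. \<integral>x. iota_deriv G (fst f) e x * conjg (iota_deriv G (fst g) e x)
        \<partial>lebesgue_on {lend G e<..<rend G e})
     + binner G (L (btrace G (iota G f))) (btrace G (iota G g))"

text \<open>
  \<open>assoc_op G X L f h\<close> means \<open>f \<in> D(H)\<close> and \<open>H f = h\<close>. Since elements of \<open>\<H>\<^sub>\<Gamma>\<close> are given by
  representatives, the operator \<open>H\<close> appears as a relation.
\<close>

definition assoc_op ::
    "('v, 'e) measure_graph \<Rightarrow> (('v, 'e) bidx \<Rightarrow> 'a::real_or_complex) set \<Rightarrow>
     ((('v, 'e) bidx \<Rightarrow> 'a) \<Rightarrow> (('v, 'e) bidx \<Rightarrow> 'a)) \<Rightarrow>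
     ('v, 'e, 'a) gfun \<Rightarrow> ('v, 'e, 'a) gfun \<Rightarrow> bool" where
  "assoc_op G X L f h \<longleftrightarrow> f \<in> dom_form G X \<and> h \<in> hilb G \<and>
     (\<forall>g\<in>dom_form G X. form G L f g = hilb_inner G h g)"

definition dom_op ::
    "('v, 'e) measure_graph \<Rightarrow> (('v, 'e) bidx \<Rightarrow> 'a::real_or_complex) set \<Rightarrow>
     ((('v, 'e) bidx \<Rightarrow> 'a) \<Rightarrow> (('v, 'e) bidx \<Rightarrow> 'a)) \<Rightarrow> ('v, 'e, 'a) gfun set" where
  "dom_op G X L = {f. \<exists>h. assoc_op G X L f h}"


section \<open>The maximal operator\<close>

definition dom_max ::
    "('v, 'e) measure_graph \<Rightarrow> ('e \<Rightarrow> real \<Rightarrow> 'a::real_or_complex) set" where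
  "dom_max G = {f. \<forall>e\<in>E1 G. f e \<in> dom_iota_e G e \<and>
     integrable (lebesgue_on {lend G e<..<rend G e}) (iota_deriv G f e) \<and>
     (\<exists>g. mu_weak_deriv (lend G e) (rend G e) (emeas G e) (iota_deriv G f e) g) \<and>
     mu_deriv (lend G e) (rend G e) (emeas G e) (iota_deriv G f e) \<in> L2 (emeas G e)}"

definition max_op ::
    "('v, 'e) measure_graph \<Rightarrow> ('e \<Rightarrow> real \<Rightarrow> 'a::real_or_complex) \<Rightarrow> 'e \<Rightarrow> real \<Rightarrow> 'a" where
  "max_op G f e = (\<lambda>x. - mu_deriv (lend G e) (rend G e) (emeas G e) (iota_deriv G f e) x)"


section \<open>Local boundary conditions\<close>

definition E1_at :: "('v, 'e) measure_graph \<Rightarrow> 'v \<Rightarrow> ('e \<times> nat) set" where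
  "E1_at G v = {(e, j) \<in> E1' G. endvert G j e = v}"

definition S_at :: "('v, 'e) measure_graph \<Rightarrow> 'v \<Rightarrow> ('v, 'e) bidx set" where
  "S_at G v = (if v \<in> V0 G then Inl ` E1_at G v else insert (Inr v) (Inl ` E1_at G v))"

definition trace_at ::
    "('v, 'e) measure_graph \<Rightarrow> 'v \<Rightarrow> ('v, 'e, 'a::real_or_complex) gfun \<Rightarrow> ('v, 'e) bidx \<Rightarrow> 'a" where
  "trace_at G v f = coord_restrict (S_at G v) (btrace G f)"

definition signed_trace_at ::
    "('v, 'e) measure_graph \<Rightarrow> 'v \<Rightarrow> ('e \<Rightarrow> real \<Rightarrow> 'a::real_or_complex) \<Rightarrow> ('v, 'e) bidx \<Rightarrow> 'a" where
  "signed_trace_at G v f = coord_restrict (Inl ` E1_at G v) (signed_trace G f)"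

definition bc_in ::
    "('v, 'e) measure_graph \<Rightarrow> ('v, 'e) bidx set \<Rightarrow> (('v, 'e) bidx \<Rightarrow> 'a::real_or_complex) set \<Rightarrow>
     ((('v, 'e) bidx \<Rightarrow> 'a) \<Rightarrow> (('v, 'e) bidx \<Rightarrow> 'a)) \<Rightarrow> bool" where
  "bc_in G S X L \<longleftrightarrow> coord.subspace X \<and> X \<subseteq> coord_space S \<and> selfadjoint_in G X L"

text \<open>The sums are direct because the sets \<open>S\<^sub>v\<close> are pairwise disjoint.\<close>

definition local_decomp ::
    "('v, 'e) measure_graph \<Rightarrow> (('v, 'e) bidx \<Rightarrow> 'a::real_or_complex) set \<Rightarrow>
     ((('v, 'e) bidx \<Rightarrow> 'a) \<Rightarrow> (('v, 'e) bidx \<Rightarrow> 'a)) \<Rightarrow>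
     ('v \<Rightarrow> (('v, 'e) bidx \<Rightarrow> 'a) set) \<Rightarrow>
     ('v \<Rightarrow> (('v, 'e) bidx \<Rightarrow> 'a) \<Rightarrow> (('v, 'e) bidx \<Rightarrow> 'a)) \<Rightarrow> bool" where
  "local_decomp G X L Xv Lv \<longleftrightarrow>
     (\<forall>v\<in>verts G. bc_in G (S_at G v) (Xv v) (Lv v)) \<and>
     X = {(\<Sum>v\<in>verts G. x v) | x. \<forall>v\<in>verts G. x v \<in> Xv v} \<and>
     (\<forall>x. (\<forall>v\<in>verts G. x v \<in> Xv v) \<longrightarrow>
        L (\<Sum>v\<in>verts G. x v) = (\<Sum>v\<in>verts G. Lv v (x v)))"

definition X0_at ::
    "('v, 'e) measure_graph \<Rightarrow> ('v \<Rightarrow> (('v, 'e) bidx \<Rightarrow> 'a::real_or_complex) set) \<Rightarrow> 'v \<Rightarrow>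
     (('v, 'e) bidx \<Rightarrow> 'a) set" where
  "X0_at G Xv v = (if v \<in> V0 G then Xv v else {\<xi> \<in> Xv v. \<xi> (Inr v) = 0})"

end

theory Submission
  imports Defs
begin

text \<open>Write \<open>u = \<iota>\<^sub>e f\<^sub>e\<close> on an edge. Two facts make the theorem work. First, if \<open>\<partial>\<^sub>\<mu> u'\<close> exists, then \<open>u'\<close> agrees
almost everywhere with \<open>C + \<integral>\<^bsub>(a, x)\<^esub> \<partial>\<^sub>\<mu> u' d\<mu>\<close>, and Fubini's theorem gives the integration by parts
\<open>\<integral> u' (w')\<^sup>* dx = u'(b-) w(b)\<^sup>* - u'(a+) w(a)\<^sup>* - \<integral> \<partial>\<^sub>\<mu> u' w\<^sup>* d\<mu>\<close>, where the star is conjugation.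
Summed over the edges, this says that the form is the pairing with the maximal operator plus the boundary
term \<open>(L tr(\<iota>f) - str(\<iota>f)' | tr(\<iota>g))\<close> (\<open>form_eq\<close>). Second, the form domain is rich enough to separate
these contributions.

A smooth \<open>\<phi>\<close> with compact support in an edge is an element of \<open>L\<^sub>2(\<mu>)\<close>, and \<open>\<iota>\<phi>\<close> replaces \<open>\<phi>\<close> on every
gap of the support of \<open>\<mu>\<close> by the chord. Its derivative is \<open>\<phi>'\<close> averaged over each gap. As \<open>u'\<close> itself is
constant on every gap, \<open>\<integral> u' (\<iota>\<phi>)'\<close> and \<open>\<integral> u' \<phi>'\<close> coincide (\<open>test_function_iota\<close>), so testing the form with
\<open>\<iota>\<phi>\<close> shows that \<open>Hf = h\<close> forces \<open>\<partial>\<^sub>\<mu> u' = -h\<^sub>e\<close> (\<open>assoc_op_mu_weak_deriv\<close>). The same averaging shows that \<open>\<iota>\<close>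
is well defined on all of its domain (\<open>exists_W12_mu\<close>).

After the edge contributions have cancelled, what remains is
\<open>(L tr(\<iota>f) - str(\<iota>f)' | \<eta>) = \<Sum>\<^sub>v h\<^sub>v \<eta>(v)\<^sup>* \<mu>\<^sub>v\<close> for all \<open>\<eta>\<close> in \<open>X\<close>, with \<open>v\<close> ranging over \<open>V\<^sub>1\<close>, because edgewise affine functions
realize every \<open>\<eta>\<close> in \<open>X\<close> as a trace (\<open>trace_surjective\<close>). This identity splits into one identity on each \<open>X\<^sub>v\<close>
(\<open>boundary_condition_localize\<close>). The space \<open>X\<^sub>v\<close> equals \<open>X\<^sub>v\<^sub>,\<^sub>0\<close> for \<open>v\<close> in \<open>V\<^sub>0\<close> and is spanned by \<open>X\<^sub>v\<^sub>,\<^sub>0\<close> and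
\<open>\<xi>\<^sup>v\<close> for \<open>v\<close> in \<open>V\<^sub>1\<close>: on \<open>X\<^sub>v\<^sub>,\<^sub>0\<close> it is the equation of
projections, on \<open>\<xi>\<^sup>v\<close> it is the formula for \<open>h\<^sub>v\<close> (\<open>vertex_condition_iff\<close>).

The preparatory parts supply the real analysis behind this: smooth functions approximating indicator
functions of intervals, uniqueness of weak derivatives, the lemma of du Bois-Reymond, and boundary limits
of functions of bounded variation.\<close>

section \<open>Conjugation\<close>

lemma conjg_zero [simp]: "conjg (0::'a::real_or_complex) = 0"
  using conjg_add[of "0::'a" 0] by simp

lemma conjg_mult_self: "x * conjg x = of_real ((norm (x::'a::real_or_complex))\<^sup>2)"
  by (simp add: mult_conjg scaleR_conv_of_real)

lemma conjg_of_real [simp]: "conjg (of_real r :: 'a::real_or_complex) = of_real r"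
proof (cases "r = 0")
  case False
  have "of_real r * conjg (of_real r :: 'a) = of_real (\<bar>r\<bar>\<^sup>2)"
    using conjg_mult_self[of "of_real r :: 'a"] by simp
  also have "\<dots> = of_real r * (of_real r :: 'a)"
    by (simp add: power2_eq_square)
  finally show ?thesis using False by simp
qed simp

lemma conjg_one [simp]: "conjg (1::'a::real_or_complex) = 1"
  using conjg_of_real[of 1] by simp

lemma norm_conjg [simp]: "norm (conjg (x::'a::real_or_complex)) = norm x"
proof (cases "x = 0")
  case False
  have "norm x * norm (conjg x) = norm x * norm x"
    using arg_cong[OF conjg_mult_self[of x], of norm]
    by (simp add: norm_mult power2_eq_square)
  then show ?thesis using False by simp
qed simp

lemma conjg_conjg [simp]: "conjg (conjg (x::'a::real_or_complex)) = x"
proof (cases "x = 0")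
  case False
  then have nz: "conjg x \<noteq> 0" by (metis norm_conjg norm_eq_zero)
  have "conjg x * conjg (conjg x) = conjg x * x"
    using conjg_mult_self[of x] conjg_mult_self[of "conjg x"] by (simp add: mult.commute)
  then show ?thesis using nz by simp
qed simp

lemma conjg_scaleR [simp]: "conjg (r *\<^sub>R (x::'a::real_or_complex)) = r *\<^sub>R conjg x"
  by (simp add: scaleR_conv_of_real conjg_mult)

lemma bounded_linear_conjg: "bounded_linear (conjg :: 'a::real_or_complex \<Rightarrow> 'a)"
  by (rule bounded_linear_intro[where K=1]) (auto simp: conjg_add)

lemmas conjg_diff = bounded_linear_conjg[THEN bounded_linear.linear, THEN linear_diff]

lemma borel_measurable_conjg [measurable]:
  "(conjg :: 'a::real_or_complex \<Rightarrow> 'a) \<in> borel_measurable borel"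
  by (intro borel_measurable_continuous_onI linear_continuous_on bounded_linear_conjg)

lemma integrable_conjg:
  fixes f :: "'x \<Rightarrow> 'a::real_or_complex"
  shows "integrable M f \<Longrightarrow> integrable M (\<lambda>x. conjg (f x))"
  by (rule integrable_bounded_linear[OF bounded_linear_conjg])

lemma integral_conjg:
  fixes f :: "'x \<Rightarrow> 'a::real_or_complex"
  shows "integrable M f \<Longrightarrow> (\<integral>x. conjg (f x) \<partial>M) = conjg (\<integral>x. f x \<partial>M)"
  by (rule integral_bounded_linear[OF bounded_linear_conjg])

section \<open>Smooth functions\<close>

text \<open>Iterating a choice of derivatives inside the family produces all higher derivatives at once, which
spares formulas for them.\<close>

lemma smooth_coinduct:
  assumes "\<phi> \<in> S"
    and step: "\<And>f. f \<in> S \<Longrightarrow> \<exists>f'\<in>S. \<forall>x. (f has_vector_derivative f' x) (at x)"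
  shows "smooth \<phi>"
proof -
  define next' where "next' f = (SOME f'. f' \<in> S \<and> (\<forall>x. (f has_vector_derivative f' x) (at x)))" for f
  have next': "next' f \<in> S \<and> (\<forall>x. (f has_vector_derivative next' f x) (at x))" if "f \<in> S" for f
    using someI_ex[of "\<lambda>f'. f' \<in> S \<and> (\<forall>x. (f has_vector_derivative f' x) (at x))"] step[OF that]
    unfolding next'_def by blast
  define D where "D n = (next' ^^ n) \<phi>" for n
  have S: "D n \<in> S" for n
    by (induction n) (auto simp: D_def \<open>\<phi> \<in> S\<close> next')
  have "(D n has_vector_derivative D (Suc n) x) (at x)" for n x
    using next'[OF S[of n]] by (simp add: D_def)
  moreover have "D 0 = \<phi>" by (simp add: D_def)
  ultimately show ?thesis unfolding smooth_def by blast
qed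

lemma smooth_derivative:
  assumes "smooth \<phi>"
  obtains \<phi>' where "smooth \<phi>'" "\<And>x. (\<phi> has_vector_derivative \<phi>' x) (at x)"
proof -
  obtain D where D: "D 0 = \<phi>" "\<And>n x. (D n has_vector_derivative D (Suc n) x) (at x)"
    using assms unfolding smooth_def by blast
  have "smooth (D 1)"
    unfolding smooth_def by (rule exI[of _ "\<lambda>n. D (Suc n)"]) (use D in auto)
  moreover have "(\<phi> has_vector_derivative D 1 x) (at x)" for x
    using D(1) D(2)[of 0 x] by simp
  ultimately show thesis by (rule that)
qed

lemma smooth_vector_derivative:
  assumes "smooth \<phi>"
  shows "(\<phi> has_vector_derivative vector_derivative \<phi> (at x)) (at x)"
    and "smooth (\<lambda>x. vector_derivative \<phi> (at x))"
proof -
  obtain \<phi>' where \<phi>': "smooth \<phi>'" "\<And>x. (\<phi> has_vector_derivative \<phi>' x) (at x)"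
    using smooth_derivative[OF assms] by metis
  then have "(\<lambda>x. vector_derivative \<phi> (at x)) = \<phi>'"
    by (auto intro!: ext vector_derivative_at)
  with \<phi>' show "smooth (\<lambda>x. vector_derivative \<phi> (at x))" by simp
  from \<phi>'(2) show "(\<phi> has_vector_derivative vector_derivative \<phi> (at x)) (at x)"
    using vector_derivative_works differentiableI_vector by blast
qed

lemma smooth_continuous_on: "smooth \<phi> \<Longrightarrow> continuous_on A \<phi>"
  by (meson continuous_at_imp_continuous_on has_vector_derivative_continuous smooth_vector_derivative(1))

lemma smooth_primitive:
  assumes "smooth \<phi>" "\<And>x. (\<Phi> has_vector_derivative \<phi> x) (at x)"
  shows "smooth \<Phi>"
proof (rule smooth_coinduct[of _ "insert \<Phi> (Collect smooth)"])
  show "\<exists>f'\<in>insert \<Phi> (Collect smooth). \<forall>x. (f has_vector_derivative f' x) (at x)"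
    if "f \<in> insert \<Phi> (Collect smooth)" for f
  proof (cases "f = \<Phi>")
    case True
    then show ?thesis using assms by (intro bexI[of _ \<phi>]) auto
  next
    case False
    then show ?thesis using that smooth_derivative[of f] by (metis insert_iff mem_Collect_eq)
  qed
qed simp

text \<open>Closing a family under sums lets a derivative be a sum of members of the family, as
  happens in the product rule.\<close>

inductive_set sum_closure :: "(real \<Rightarrow> 'a::real_normed_vector) set \<Rightarrow> (real \<Rightarrow> 'a) set"
  for S where
    base: "f \<in> S \<Longrightarrow> f \<in> sum_closure S"
  | add: "f \<in> sum_closure S \<Longrightarrow> g \<in> sum_closure S \<Longrightarrow> (\<lambda>x. f x + g x) \<in> sum_closure S"

lemma smooth_sum_closure:
  assumes "\<phi> \<in> sum_closure S"
    and step: "\<And>f. f \<in> S \<Longrightarrow> \<exists>f'\<in>sum_closure S. \<forall>x. (f has_vector_derivative f' x) (at x)"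
  shows "smooth \<phi>"
proof (rule smooth_coinduct[OF assms(1)])
  fix f assume "f \<in> sum_closure S"
  then show "\<exists>f'\<in>sum_closure S. \<forall>x. (f has_vector_derivative f' x) (at x)"
  proof induction
    case (add f g)
    then obtain f' g' where "f' \<in> sum_closure S" "\<forall>x. (f has_vector_derivative f' x) (at x)"
       "g' \<in> sum_closure S" "\<forall>x. (g has_vector_derivative g' x) (at x)" by blast
    then show ?case
      by (intro bexI[of _ "\<lambda>x. f' x + g' x"])
         (auto intro: sum_closure.add has_vector_derivative_add)
  qed (use step in blast)
qed

lemma smooth_mult:
  fixes f g :: "real \<Rightarrow> 'a::real_normed_algebra"
  assumes "smooth f" "smooth g"
  shows "smooth (\<lambda>x. f x * g x)"
proof (rule smooth_sum_closure)
  let ?S = "{\<lambda>x. u x * v x |u v::real \<Rightarrow> 'a. smooth u \<and> smooth v}"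
  show "(\<lambda>x. f x * g x) \<in> sum_closure ?S"
    using assms by (auto intro: sum_closure.base)
  fix w assume "w \<in> ?S"
  then obtain u v where w: "w = (\<lambda>x. u x * v x)" "smooth u" "smooth v" by blast
  obtain u' v' where "smooth u'" "\<And>x. (u has_vector_derivative u' x) (at x)"
     "smooth v'" "\<And>x. (v has_vector_derivative v' x) (at x)"
    using smooth_derivative[OF w(2)] smooth_derivative[OF w(3)] by metis
  then show "\<exists>f'\<in>sum_closure ?S. \<forall>x. (w has_vector_derivative f' x) (at x)"
    using w has_vector_derivative_mult[of u _ _ UNIV v]
    by (intro bexI[of _ "\<lambda>x. u x * v' x + u' x * v x"] sum_closure.add sum_closure.base) blast+
qed

lemma smooth_add:
  assumes "smooth f" "smooth g"
  shows "smooth (\<lambda>x. f x + g x)"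
proof (rule smooth_sum_closure[of _ "Collect smooth"])
  show "(\<lambda>x. f x + g x) \<in> sum_closure (Collect smooth)"
    using assms by (intro sum_closure.intros) auto
  show "\<exists>f'\<in>sum_closure (Collect smooth). \<forall>x. (h has_vector_derivative f' x) (at x)"
    if "h \<in> Collect smooth" for h :: "real \<Rightarrow> 'a"
    using that by (metis mem_Collect_eq smooth_derivative sum_closure.base)
qed

lemma smooth_bounded_linear:
  assumes "bounded_linear T" "smooth f"
  shows "smooth (\<lambda>x. T (f x))"
proof (rule smooth_coinduct[of _ "{\<lambda>x. T (g x) |g. smooth g}"])
  fix h assume "h \<in> {\<lambda>x. T (g x) |g. smooth g}"
  then obtain g where g: "h = (\<lambda>x. T (g x))" "smooth g" by blast
  obtain g' where "smooth g'" "\<And>x. (g has_vector_derivative g' x) (at x)"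
    using smooth_derivative[OF g(2)] by metis
  then show "\<exists>f'\<in>{\<lambda>x. T (g x) |g. smooth g}. \<forall>x. (h has_vector_derivative f' x) (at x)"
    by (intro bexI[of _ "\<lambda>x. T (g' x)"])
       (auto simp: g(1) intro: bounded_linear.has_vector_derivative[OF assms(1)])
qed (use assms in blast)

lemma smooth_compose_affine:
  fixes f :: "real \<Rightarrow> 'a::real_normed_vector"
  assumes "smooth f"
  shows "smooth (\<lambda>x. f (k * x + c))"
proof (rule smooth_coinduct[of _ "{\<lambda>x. g (k * x + c) |g. smooth g}"])
  fix h assume "h \<in> {\<lambda>x. g (k * x + c) |g::real \<Rightarrow> 'a. smooth g}"
  then obtain g where g: "h = (\<lambda>x. g (k * x + c))" "smooth g" by blast
  obtain g' where g': "smooth g'" "\<And>x. (g has_vector_derivative g' x) (at x)"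
    using smooth_derivative[OF g(2)] by metis
  have "(h has_vector_derivative k *\<^sub>R g' (k * x + c)) (at x)" for x
  proof -
    have "((\<lambda>x. k * x + c) has_vector_derivative k) (at x)"
      unfolding has_real_derivative_iff_has_vector_derivative[symmetric]
      by (auto intro!: derivative_eq_intros)
    from vector_diff_chain_at[OF this g'(2)] show ?thesis
      by (simp add: g(1) o_def)
  qed
  then show "\<exists>f'\<in>{\<lambda>x. g (k * x + c) |g. smooth g}. \<forall>x. (h has_vector_derivative f' x) (at x)"
    using smooth_bounded_linear[OF bounded_linear_scaleR_right g'(1)]
    by (intro bexI[of _ "\<lambda>x. k *\<^sub>R g' (k * x + c)"]) auto
qed (use assms in blast)

text \<open>The functions \<open>x\<^sup>-\<^sup>k exp(-1/x)\<close>, extended by zero: the span of this family contains the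
bump profile \<open>exp(-1/x)\<close> and is closed under differentiation.\<close>

definition flat_power :: "nat \<Rightarrow> real \<Rightarrow> real" where
  "flat_power k x = (if x \<le> 0 then 0 else (1 / x) ^ k * exp (- (1 / x)))"

lemma flat_power_tendsto_zero: "(flat_power k \<longlongrightarrow> 0) (at_right 0)"
proof -
  have "((\<lambda>t::real. t ^ k / exp t) \<longlongrightarrow> 0) at_top"
    by (rule tendsto_power_div_exp_0)
  then have "((\<lambda>x::real. inverse x ^ k / exp (inverse x)) \<longlongrightarrow> 0) (at_right 0)"
    by (rule filterlim_compose[OF _ filterlim_inverse_at_top_right])
  then show ?thesis
    by (rule Lim_transform_eventually)
       (auto simp: eventually_at_right_field flat_power_def exp_minus divide_simps intro!: exI[of _ 1])
qed

lemma flat_power_has_derivative: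
  "(flat_power k has_real_derivative (flat_power (k + 2) x - real k * flat_power (k + 1) x)) (at x)"
proof -
  consider "x < 0" | "x > 0" | "x = 0" by linarith
  then show ?thesis
  proof cases
    case 1
    have "((\<lambda>x. 0::real) has_real_derivative 0) (at x)" by simp
    then have "(flat_power k has_real_derivative 0) (at x)"
      by (rule has_field_derivative_transform_within_open[of _ _ _ "{..<0}"])
         (use 1 in \<open>auto simp: flat_power_def\<close>)
    then show ?thesis using 1 by (simp add: flat_power_def)
  next
    case 2
    have "((\<lambda>x. (1 / x) ^ k * exp (- (1 / x))) has_real_derivative
       (flat_power (k + 2) x - real k * flat_power (k + 1) x)) (at x)"
    proof (rule DERIV_cong)
      show "((\<lambda>x. (1 / x) ^ k * exp (- (1 / x))) has_real_derivative
        (real k * (1 / x) ^ (k - 1) * (- (1 / x)\<^sup>2) * exp (- (1 / x))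
          + (1 / x) ^ k * (exp (- (1 / x)) * (1 / x)\<^sup>2))) (at x)"
        using 2 by (auto intro!: derivative_eq_intros simp: power2_eq_square)
    qed (use 2 in \<open>cases k; simp add: flat_power_def power2_eq_square algebra_simps add_divide_distrib\<close>)
    then show ?thesis
      by (rule has_field_derivative_transform_within_open[of _ _ _ "{0<..}"])
         (use 2 in \<open>auto simp: flat_power_def\<close>)
  next
    case 3
    have *: "((\<lambda>h. (flat_power k (0 + h) - flat_power k 0) / h) \<longlongrightarrow> 0) (at 0)"
    proof (rule filterlim_split_at)
      show "((\<lambda>h. (flat_power k (0 + h) - flat_power k 0) / h) \<longlongrightarrow> 0) (at_left 0)"
        by (rule Lim_transform_eventually[OF tendsto_const])
           (auto simp: eventually_at_left_field flat_power_def intro!: exI[of _ "-1"])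
      show "((\<lambda>h. (flat_power k (0 + h) - flat_power k 0) / h) \<longlongrightarrow> 0) (at_right 0)"
        by (rule Lim_transform_eventually[OF flat_power_tendsto_zero[of "k + 1"]])
           (auto simp: eventually_at_right_field flat_power_def intro!: exI[of _ 1])
    qed
    show ?thesis using * 3 by (simp add: DERIV_def flat_power_def)
  qed
qed

lemma smooth_flat_power: "smooth (flat_power k)"
proof (rule smooth_sum_closure)
  let ?S = "{\<lambda>x. c * flat_power k x |c k. True}"
  have S: "(\<lambda>x. c * flat_power k x) \<in> sum_closure ?S" for c k
    by (rule sum_closure.base) blast
  show "flat_power k \<in> sum_closure ?S" using S[of 1 k] by simp
  fix f assume "f \<in> ?S"
  then obtain c k where f: "f = (\<lambda>x. c * flat_power k x)" by blast
  have "(f has_vector_derivative (c * flat_power (k + 2) x + (- c * real k) * flat_power (k + 1) x)) (at x)" for x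
    unfolding f has_real_derivative_iff_has_vector_derivative[symmetric]
    by (rule DERIV_cong[OF DERIV_cmult[OF flat_power_has_derivative]]) (simp add: algebra_simps)
  then show "\<exists>f'\<in>sum_closure ?S. \<forall>x. (f has_vector_derivative f' x) (at x)"
    by (intro bexI[OF _ sum_closure.add[OF S S]]) blast
qed

text \<open>With \<open>h(t) = exp(-1/t)\<close> for \<open>t > 0\<close>, the profile \<open>h(n (x - c) - 1) h(n (d - x) - 1)\<close> tends
to the indicator function because \<open>h(t)\<close> tends to \<open>1\<close> as \<open>t\<close> grows. The shift by \<open>1\<close> moves
the support to \<open>[c + 1/n, d - 1/n]\<close>, away from the end points.\<close>

lemma bump_sequence:
  fixes c d :: real
  obtains \<psi> :: "nat \<Rightarrow> real \<Rightarrow> real" where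
    "\<And>n. smooth (\<psi> n)"
    "\<And>n. \<exists>c' d'. c < c' \<and> d' < d \<and> (\<forall>x. x \<notin> {c'..d'} \<longrightarrow> \<psi> n x = 0)"
    "\<And>n x. 0 \<le> \<psi> n x \<and> \<psi> n x \<le> 1"
    "\<And>x. (\<lambda>n. \<psi> n x) \<longlonglongrightarrow> indicator {c<..<d} x"
proof
  let ?\<psi> = "\<lambda>n x. flat_power 0 (real (Suc n) * x + (- real (Suc n) * c - 1)) *
                  flat_power 0 (- real (Suc n) * x + (real (Suc n) * d - 1))"
  show "smooth (?\<psi> n)" for n
    by (intro smooth_mult smooth_compose_affine smooth_flat_power)
  show "\<exists>c' d'. c < c' \<and> d' < d \<and> (\<forall>x. x \<notin> {c'..d'} \<longrightarrow> ?\<psi> n x = 0)" for n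
    by (rule exI[of _ "c + 1 / real (Suc n)"], rule exI[of _ "d - 1 / real (Suc n)"])
       (auto simp: flat_power_def field_simps simp del: of_nat_Suc)
  have bound: "0 \<le> flat_power 0 x \<and> flat_power 0 x \<le> 1" for x
    by (auto simp: flat_power_def)
  then show "0 \<le> ?\<psi> n x \<and> ?\<psi> n x \<le> 1" for n x
    by (auto intro!: mult_nonneg_nonneg mult_le_one)
  have lim: "(\<lambda>n. flat_power 0 (real (Suc n) * t - 1)) \<longlonglongrightarrow> (if t > 0 then 1 else 0)" for t :: real
  proof (cases "t > 0")
    case True
    have "filterlim (\<lambda>n. real (Suc n)) at_top sequentially"
      using filterlim_real_sequentially filterlim_sequentially_Suc by blast
    then have "filterlim (\<lambda>n. t * real (Suc n)) at_top sequentially"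
      by (rule filterlim_tendsto_pos_mult_at_top[OF tendsto_const True])
    then have "filterlim (\<lambda>n. (-1) + t * real (Suc n)) at_top sequentially"
      by (rule filterlim_tendsto_add_at_top[OF tendsto_const])
    then have f: "filterlim (\<lambda>n. real (Suc n) * t - 1) at_top sequentially"
      by (simp add: mult.commute)
    have "((\<lambda>x::real. exp (- (1 / x))) \<longlongrightarrow> exp (- 0)) at_top"
      by (intro tendsto_intros) (simp add: tendsto_inverse_0_at_top divide_inverse filterlim_ident)
    then have "((\<lambda>x::real. exp (- (1 / x))) \<longlongrightarrow> 1) at_top" by simp
    then have "(flat_power 0 \<longlongrightarrow> 1) at_top"
      by (rule Lim_transform_eventually)
         (auto simp: flat_power_def intro!: eventually_at_top_linorderI[of 1])
    then show ?thesis using True filterlim_compose[OF _ f] by auto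
  next
    case False
    then have "real (Suc n) * t - 1 \<le> 0" for n
      by (smt (verit) mult_nonneg_nonpos of_nat_0_le_iff)
    then show ?thesis using False by (auto simp: flat_power_def)
  qed
  show "(\<lambda>n. ?\<psi> n x) \<longlonglongrightarrow> indicator {c<..<d} x" for x
  proof -
    have "(\<lambda>n. flat_power 0 (real (Suc n) * (x - c) - 1) * flat_power 0 (real (Suc n) * (d - x) - 1))
       \<longlonglongrightarrow> (if x - c > 0 then 1 else 0) * (if d - x > 0 then 1 else 0)"
      by (intro tendsto_mult lim)
    then show ?thesis
      by (auto simp: algebra_simps indicator_def split: if_splits)
  qed
qed

section \<open>Test functions separate densities\<close>

lemma test_functions_smooth: "\<phi> \<in> test_functions a b \<Longrightarrow> smooth \<phi>"
  by (simp add: test_functions_def)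

lemma test_functions_supportE:
  assumes "\<phi> \<in> test_functions a b"
  obtains c d where "a < c" "d < b" "\<And>x. x \<notin> {c..d} \<Longrightarrow> \<phi> x = 0"
  using assms by (auto simp: test_functions_def)

lemma test_functions_zero_outside:
  "\<phi> \<in> test_functions a b \<Longrightarrow> x \<notin> {a<..<b} \<Longrightarrow> \<phi> x = 0"
  by (fastforce elim!: test_functions_supportE)

lemma test_functions_continuous: "\<phi> \<in> test_functions a b \<Longrightarrow> continuous_on A \<phi>"
  by (simp add: smooth_continuous_on test_functions_smooth)

lemma test_functions_measurable [measurable_dest]:
  "\<phi> \<in> test_functions a b \<Longrightarrow> \<phi> \<in> borel_measurable borel"
  by (simp add: borel_measurable_continuous_onI test_functions_continuous)

lemma test_functions_bounded:
  fixes \<phi> :: "real \<Rightarrow> 'a::real_or_complex"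
  assumes "\<phi> \<in> test_functions a b"
  obtains B where "\<And>x. norm (\<phi> x) \<le> B"
proof -
  obtain c d where z: "\<And>x. x \<notin> {c..d} \<Longrightarrow> \<phi> x = 0"
    by (rule test_functions_supportE[OF assms]) blast
  have "bounded (\<phi> ` {c..d})"
    by (intro compact_imp_bounded compact_continuous_image test_functions_continuous[OF assms] compact_Icc)
  then obtain B where B: "\<And>x. x \<in> {c..d} \<Longrightarrow> norm (\<phi> x) \<le> B" "0 < B"
    unfolding bounded_pos by blast
  have "norm (\<phi> x) \<le> B" for x
    using B z[of x] by (cases "x \<in> {c..d}") auto
  then show thesis by (rule that)
qed

lemma test_functions_mono:
  assumes "\<phi> \<in> test_functions c d" "a \<le> c" "d \<le> b"
  shows "\<phi> \<in> test_functions a b"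
proof -
  obtain c' d' where "c < c'" "d' < d" "\<And>x. x \<notin> {c'..d'} \<Longrightarrow> \<phi> x = 0"
    by (rule test_functions_supportE[OF assms(1)]) blast
  moreover from this have "a < c'" "d' < b" using assms(2,3) by auto
  ultimately show ?thesis
    using test_functions_smooth[OF assms(1)] unfolding test_functions_def by blast
qed

lemma test_functions_of_real:
  assumes "smooth (\<psi> :: real \<Rightarrow> real)" "a < c" "d < b" "\<And>x. x \<notin> {c..d} \<Longrightarrow> \<psi> x = 0"
  shows "(\<lambda>x. of_real (\<psi> x) :: 'a::real_or_complex) \<in> test_functions a b"
  using smooth_bounded_linear[OF bounded_linear_of_real assms(1)] assms(2-4)
  unfolding test_functions_def by auto

lemma test_functions_bounded_linear:
  assumes "bounded_linear T" "\<phi> \<in> test_functions a b"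
  shows "(\<lambda>x. T (\<phi> x)) \<in> test_functions a b"
  using assms smooth_bounded_linear[OF assms(1)] linear_0[OF bounded_linear.linear[OF assms(1)]]
  unfolding test_functions_def by force

lemma test_functions_add:
  assumes "\<phi> \<in> test_functions a b" "\<psi> \<in> test_functions a b"
  shows "(\<lambda>x. \<phi> x + \<psi> x) \<in> test_functions a b"
proof -
  obtain c d where 1: "a < c" "d < b" "\<And>x. x \<notin> {c..d} \<Longrightarrow> \<phi> x = 0"
    using assms(1) by (rule test_functions_supportE) blast
  obtain c' d' where 2: "a < c'" "d' < b" "\<And>x. x \<notin> {c'..d'} \<Longrightarrow> \<psi> x = 0"
    using assms(2) by (rule test_functions_supportE) blast
  have "\<phi> x + \<psi> x = 0" if "x \<notin> {min c c'..max d d'}" for x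
    using 1(3)[of x] 2(3)[of x] that by force
  moreover have "a < min c c'" "max d d' < b" using 1 2 by auto
  moreover have "smooth (\<lambda>x. \<phi> x + \<psi> x)"
    using assms by (intro smooth_add test_functions_smooth)
  ultimately show ?thesis
    unfolding test_functions_def by blast
qed

lemma test_functions_derivative:
  assumes "\<phi> \<in> test_functions a b"
  shows "(\<lambda>x. vector_derivative \<phi> (at x)) \<in> test_functions a b"
proof -
  obtain c d where 1: "a < c" "d < b" "\<And>x. x \<notin> {c..d} \<Longrightarrow> \<phi> x = 0"
    using assms by (rule test_functions_supportE) blast
  have "vector_derivative \<phi> (at x) = 0" if "x \<notin> {c..d}" for x
  proof (rule vector_derivative_at)
    show "(\<phi> has_vector_derivative 0) (at x)"
    proof (rule has_vector_derivative_transform_within_open[of "\<lambda>x. 0"])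
      show "open (- {c..d})" by auto
    qed (use that 1(3) in auto)
  qed
  then show ?thesis
    using 1 smooth_vector_derivative(2)[OF test_functions_smooth[OF assms]]
    unfolding test_functions_def by auto
qed

text \<open>The two kinds of measures that occur, Lebesgue measure on an open interval and the measure
  on an edge, have different \<open>\<sigma>\<close>-algebras. The following locale collects what they share:
  functions on the line that are Borel are measurable, and up to null sets there are no other
  measurable sets than Borel sets.\<close>

locale interval_measure = finite_measure M for M :: "real measure" +
  fixes a b :: real
  assumes id_measurable [measurable]: "(\<lambda>x. x) \<in> M \<rightarrow>\<^sub>M borel"
    and AE_interior: "AE x in M. a < x \<and> x < b"
    and AE_borel_set: "A \<in> sets M \<Longrightarrow> \<exists>B\<in>sets borel. AE x in M. x \<in> A \<longleftrightarrow> x \<in> B"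
begin

lemma borel_imp_measurable [measurable (raw)]: "f \<in> borel_measurable borel \<Longrightarrow> f \<in> borel_measurable M"
  using measurable_compose[OF id_measurable] by auto

lemma integrable_mult_bounded:
  fixes f \<phi> :: "real \<Rightarrow> 'a::real_or_complex"
  assumes f: "integrable M f" and [measurable]: "\<phi> \<in> borel_measurable M"
    and B: "\<And>x. x \<in> space M \<Longrightarrow> norm (\<phi> x) \<le> B"
  shows "integrable M (\<lambda>x. f x * \<phi> x)"
proof (rule Bochner_Integration.integrable_bound)
  show "integrable M (\<lambda>x. B *\<^sub>R f x)" using f by simp
  show "(\<lambda>x. f x * \<phi> x) \<in> borel_measurable M" using f by measurable
  have "norm (f x) * norm (\<phi> x) \<le> norm (f x) * \<bar>B\<bar>" if "x \<in> space M" for x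
    using B[OF that] by (intro mult_left_mono) auto
  then show "AE x in M. norm (f x * \<phi> x) \<le> norm (B *\<^sub>R f x)"
    by (intro AE_I2) (simp add: norm_mult mult.commute)
qed

lemma integrable_indicator_scaleR:
  fixes f :: "real \<Rightarrow> 'b::{banach, second_countable_topology}"
  assumes f: "integrable M f" and B: "B \<in> sets borel"
  shows "integrable M (\<lambda>x. indicator B x *\<^sub>R f x)"
proof (rule Bochner_Integration.integrable_bound[OF f])
  show "(\<lambda>x. indicator B x *\<^sub>R f x) \<in> borel_measurable M" using f B by measurable
qed (auto simp: indicator_def)

lemma integrable_mult_test:
  fixes f \<phi> :: "real \<Rightarrow> 'a::real_or_complex"
  assumes f: "integrable M f" and \<phi>: "\<phi> \<in> test_functions a b"
  shows "integrable M (\<lambda>x. f x * \<phi> x)"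
proof -
  obtain B where "\<And>x. norm (\<phi> x) \<le> B" using test_functions_bounded[OF \<phi>] by blast
  then show ?thesis
    using \<phi> by (intro integrable_mult_bounded f borel_imp_measurable) (auto dest: test_functions_measurable)
qed

text \<open>Open intervals form a generator of the Borel sets that is stable under intersections, so the
vanishing of the integrals spreads from intervals to all measurable sets.\<close>

lemma AE_zero_if_interval_integrals_zero:
  fixes f :: "real \<Rightarrow> 'b::{banach, second_countable_topology}"
  assumes f: "integrable M f"
    and zero: "\<And>c d. (\<integral>x. indicator {c<..<d} x *\<^sub>R f x \<partial>M) = 0"
  shows "AE x in M. f x = 0"
proof (rule density_zero[OF f])
  have whole: "(\<integral>x. f x \<partial>M) = 0"
  proof -
    have "(\<lambda>n. \<integral>x. indicator {- real n<..<real n} x *\<^sub>R f x \<partial>M) \<longlonglongrightarrow> (\<integral>x. f x \<partial>M)"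
    proof (rule integral_dominated_convergence[where w="\<lambda>x. norm (f x)"])
      show "AE x in M. (\<lambda>n. indicator {- real n<..<real n} x *\<^sub>R f x) \<longlonglongrightarrow> f x"
      proof (rule AE_I2, rule tendsto_eventually)
        fix x :: real
        obtain N where "\<bar>x\<bar> < real N" using reals_Archimedean2 by blast
        then have "indicator {- real n<..<real n} x *\<^sub>R f x = f x" if "N \<le> n" for n
          using of_nat_mono[OF that, where 'a=real] by (auto simp: indicator_def abs_less_iff)
        then show "\<forall>\<^sub>F n in sequentially. indicator {- real n<..<real n} x *\<^sub>R f x = f x"
          by (rule eventually_sequentiallyI)
      qed
    qed (use f in \<open>auto simp: indicator_def\<close>)
    then show ?thesis by (simp add: zero LIMSEQ_const_iff)
  qed
  have borel: "(\<integral>x. indicator B x *\<^sub>R f x \<partial>M) = 0" if "B \<in> sets borel" for B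
  proof -
    let ?G = "range (\<lambda>(c, d). {c<..<d::real})"
    have eq: "sets borel = sigma_sets UNIV ?G"
      by (subst borel_eq_box) (simp add: sets_measure_of box_real split_def)
    have "Int_stable ?G"
      by (auto simp: Int_stable_def)
    moreover have "?G \<subseteq> Pow UNIV" by simp
    ultimately show ?thesis using that[unfolded eq]
    proof (induction rule: sigma_sets_induct_disjoint)
      case (compl A)
      have A: "A \<in> sets borel" using compl(1) eq by simp
      have "(\<integral>x. indicator (UNIV - A) x *\<^sub>R f x \<partial>M) = (\<integral>x. f x - indicator A x *\<^sub>R f x \<partial>M)"
        by (intro Bochner_Integration.integral_cong) (auto simp: indicator_def)
      also have "\<dots> = 0"
        using compl(2) whole f A by (simp add: integrable_indicator_scaleR)
      finally show ?case .
    next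
      case (union A)
      have A: "A i \<in> sets borel" for i using union(2) eq by auto
      have sA: "A i \<inter> space M \<in> sets M" for i
        using measurable_sets[OF id_measurable A[of i]] by simp
      have to_set: "(\<integral>x. indicator B x *\<^sub>R f x \<partial>M) = (LINT x:B \<inter> space M|M. f x)" for B
        unfolding set_lebesgue_integral_def
        by (intro Bochner_Integration.integral_cong) (auto simp: indicator_def)
      have "(LINT x:(\<Union>i. A i \<inter> space M)|M. f x) = (\<Sum>i. (LINT x:A i \<inter> space M|M. f x))"
      proof (rule lebesgue_integral_countable_add)
        show "set_integrable M (\<Union>i. A i \<inter> space M) f"
          unfolding set_integrable_def using f sA by (intro integrable_mult_indicator sets.countable_UN) auto
      qed (use union(1) sA in \<open>auto simp: disjoint_family_on_def\<close>)
      also have "\<dots> = 0" using union(3) by (simp add: to_set[symmetric])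
      finally show ?case by (simp add: to_set)
    qed (use zero in auto)
  qed
  fix A assume A: "A \<in> sets M"
  then obtain B where B: "B \<in> sets borel" "AE x in M. x \<in> A \<longleftrightarrow> x \<in> B"
    using AE_borel_set by blast
  have "(LINT x:A|M. f x) = (\<integral>x. indicator B x *\<^sub>R f x \<partial>M)"
    unfolding set_lebesgue_integral_def
  proof (rule integral_cong_AE)
    show "(\<lambda>x. indicator A x *\<^sub>R f x) \<in> borel_measurable M" using A f by measurable
    show "(\<lambda>x. indicator B x *\<^sub>R f x) \<in> borel_measurable M"
      using integrable_indicator_scaleR[OF f B(1)] by simp
    show "AE x in M. indicator A x *\<^sub>R f x = indicator B x *\<^sub>R f x"
      using B(2) by eventually_elim (auto simp: indicator_def)
  qed
  then show "(LINT x:A|M. f x) = 0" by (simp add: borel[OF B(1)])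
qed

text \<open>By dominated convergence along bumps, vanishing against test functions implies vanishing
integrals over intervals.\<close>

lemma AE_zero_if_test_integrals_zero:
  fixes f :: "real \<Rightarrow> 'a::real_or_complex"
  assumes f: "integrable M f"
    and zero: "\<And>\<phi>. \<phi> \<in> test_functions a b \<Longrightarrow> (\<integral>x. f x * \<phi> x \<partial>M) = 0"
  shows "AE x in M. f x = 0"
proof (rule AE_zero_if_interval_integrals_zero[OF f])
  fix c d :: real
  \<comment> \<open>The measure lives on \<open>(a, b)\<close>, where the test functions must have their support.\<close>
  let ?c = "max a c" and ?d = "min b d"
  obtain \<psi> :: "nat \<Rightarrow> real \<Rightarrow> real" where \<psi>:
    "\<And>n. smooth (\<psi> n)"
    "\<And>n. \<exists>c' d'. ?c < c' \<and> d' < ?d \<and> (\<forall>x. x \<notin> {c'..d'} \<longrightarrow> \<psi> n x = 0)"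
    "\<And>n x. 0 \<le> \<psi> n x \<and> \<psi> n x \<le> 1"
    "\<And>x. (\<lambda>n. \<psi> n x) \<longlonglongrightarrow> indicator {?c<..<?d} x"
    by (rule bump_sequence[of ?c ?d]) blast
  have \<psi>_test: "(\<lambda>x. of_real (\<psi> n x) :: 'a) \<in> test_functions a b" for n
  proof -
    obtain c' d' where "?c < c'" "d' < ?d" "\<forall>x. x \<notin> {c'..d'} \<longrightarrow> \<psi> n x = 0"
      using \<psi>(2) by blast
    then show ?thesis by (intro test_functions_of_real[OF \<psi>(1), of a c' d' b]) auto
  qed
  have [measurable]: "\<psi> n \<in> borel_measurable borel" for n
    by (intro borel_measurable_continuous_onI smooth_continuous_on \<psi>(1))
  have "(\<lambda>n. \<integral>x. \<psi> n x *\<^sub>R f x \<partial>M) \<longlonglongrightarrow> (\<integral>x. indicator {?c<..<?d} x *\<^sub>R f x \<partial>M)"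
  proof (rule integral_dominated_convergence[where w="\<lambda>x. norm (f x)"])
    show "AE x in M. (\<lambda>n. \<psi> n x *\<^sub>R f x) \<longlonglongrightarrow> indicator {?c<..<?d} x *\<^sub>R f x"
      by (intro AE_I2 tendsto_scaleR \<psi>(4) tendsto_const)
    show "AE x in M. norm (\<psi> n x *\<^sub>R f x) \<le> norm (f x)" for n
      using \<psi>(3)[of n] by (intro AE_I2) (auto intro!: mult_left_le_one_le)
  qed (use f in \<open>auto intro: integrable_indicator_scaleR[OF f, THEN borel_measurable_integrable]\<close>)
  moreover have "(\<integral>x. \<psi> n x *\<^sub>R f x \<partial>M) = 0" for n
    using zero[OF \<psi>_test[of n]] by (simp add: scaleR_conv_of_real mult.commute)
  ultimately have "(\<integral>x. indicator {?c<..<?d} x *\<^sub>R f x \<partial>M) = 0"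
    by (simp add: LIMSEQ_const_iff)
  moreover have "(\<integral>x. indicator {c<..<d} x *\<^sub>R f x \<partial>M) = (\<integral>x. indicator {?c<..<?d} x *\<^sub>R f x \<partial>M)"
  proof (rule integral_cong_AE)
    show "AE x in M. indicator {c<..<d} x *\<^sub>R f x = indicator {?c<..<?d} x *\<^sub>R f x"
      using AE_interior by eventually_elim (auto simp: indicator_def)
  qed (auto intro: integrable_indicator_scaleR[OF f, THEN borel_measurable_integrable])
  ultimately show "(\<integral>x. indicator {c<..<d} x *\<^sub>R f x \<partial>M) = 0" by simp
qed

end

lemma id_measurable_lebesgue_on [measurable]: "(\<lambda>x. x) \<in> lebesgue_on S \<rightarrow>\<^sub>M (borel :: real measure)"
  by (rule measurable_restrict_space1) (simp add: measurable_completion)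

lemma interval_measure_lebesgue_on: "interval_measure (lebesgue_on {a<..<b}) a b"
proof (intro interval_measure.intro interval_measure_axioms.intro)
  show "finite_measure (lebesgue_on {a<..<b})"
    by (rule finite_measure_lebesgue_on) simp
  show "AE x in lebesgue_on {a<..<b}. a < x \<and> x < b"
    by (intro AE_I2) auto
  fix A assume "A \<in> sets (lebesgue_on {a<..<b})"
  then have A: "A \<in> sets lebesgue" by (simp add: sets_restrict_space_iff)
  obtain C T where CT: "fsigma C" "T \<in> null_sets lebesgue" "C \<union> T = A" "disjnt C T"
    using lebesgue_set_almost_fsigma[OF A] .
  have "AE x in lebesgue. x \<notin> T" by (rule AE_not_in) (rule CT)
  then have "AE x in lebesgue_on {a<..<b}. x \<in> A \<longleftrightarrow> x \<in> C"
    using CT(3) by (auto simp: AE_restrict_space_iff)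
  moreover have "C \<in> sets borel" using CT(1) by (induction rule: fsigma.induct) auto
  ultimately show "\<exists>B\<in>sets borel. AE x in lebesgue_on {a<..<b}. (x \<in> A) = (x \<in> B)" by blast
qed auto

section \<open>Weak derivatives on an interval\<close>

lemma integral_lebesgue_on_superset:
  fixes f :: "real \<Rightarrow> 'b::{banach, second_countable_topology}"
  assumes "S \<subseteq> T" "S \<in> sets lebesgue" "T \<in> sets lebesgue" "\<And>x. x \<in> T - S \<Longrightarrow> f x = 0"
  shows "integral\<^sup>L (lebesgue_on S) f = integral\<^sup>L (lebesgue_on T) f"
    and "integrable (lebesgue_on S) f \<longleftrightarrow> integrable (lebesgue_on T) f"
proof -
  have eq: "(\<lambda>x. indicator S x *\<^sub>R f x) = (\<lambda>x. indicator T x *\<^sub>R f x)"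
    using assms by (auto simp: indicator_def fun_eq_iff)
  show "integral\<^sup>L (lebesgue_on S) f = integral\<^sup>L (lebesgue_on T) f"
    using assms eq by (simp add: integral_restrict_space)
  show "integrable (lebesgue_on S) f \<longleftrightarrow> integrable (lebesgue_on T) f"
    using assms eq by (simp add: integrable_restrict_space)
qed

lemma L1_loc_mult_test:
  fixes f \<phi> :: "real \<Rightarrow> 'a::real_or_complex"
  assumes f: "f \<in> L1_loc a b" and \<phi>: "\<phi> \<in> test_functions a b"
  shows "integrable (lebesgue_on {a<..<b}) (\<lambda>x. f x * \<phi> x)"
proof -
  obtain c d where cd: "a < c" "d < b" "\<And>x. x \<notin> {c..d} \<Longrightarrow> \<phi> x = 0"
    by (rule test_functions_supportE[OF \<phi>]) blast
  obtain B where B: "\<And>x. norm (\<phi> x) \<le> B" using test_functions_bounded[OF \<phi>] by blast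
  have f': "integrable (lebesgue_on {c..d}) f" using f cd by (simp add: L1_loc_def)
  have "integrable (lebesgue_on {c..d}) (\<lambda>x. f x * \<phi> x)"
  proof (rule Bochner_Integration.integrable_bound)
    show "integrable (lebesgue_on {c..d}) (\<lambda>x. B *\<^sub>R f x)" using f' by simp
    have "\<phi> \<in> borel_measurable (lebesgue_on {c..d})"
      using measurable_compose[OF id_measurable_lebesgue_on test_functions_measurable[OF \<phi>]] by simp
    then show "(\<lambda>x. f x * \<phi> x) \<in> borel_measurable (lebesgue_on {c..d})" using f' by measurable
    have "norm (f x) * norm (\<phi> x) \<le> norm (f x) * \<bar>B\<bar>" for x
      using B[of x] by (intro mult_left_mono) auto
    then show "AE x in lebesgue_on {c..d}. norm (f x * \<phi> x) \<le> norm (B *\<^sub>R f x)"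
      by (intro AE_I2) (simp add: norm_mult mult.commute)
  qed
  then show ?thesis
    using cd by (subst (asm) integral_lebesgue_on_superset(2)[of _ "{a<..<b}"]) auto
qed

lemma L1_loc_diff:
  assumes "f \<in> L1_loc a b" "g \<in> L1_loc a b"
  shows "(\<lambda>x. f x - g x) \<in> L1_loc a b"
  using assms by (auto simp: L1_loc_def)

lemma integrable_imp_L1_loc:
  assumes "integrable (lebesgue_on {a<..<b}) f"
  shows "f \<in> L1_loc a b"
  unfolding L1_loc_def
proof safe
  fix c d :: real assume cd: "a < c" "d < b"
  have "integrable (lebesgue_on {a<..<b}) (\<lambda>x. indicator {c..d} x *\<^sub>R f x)"
    by (rule interval_measure.integrable_indicator_scaleR[OF interval_measure_lebesgue_on assms]) simp
  moreover have "(\<lambda>x. indicator {a<..<b} x *\<^sub>R indicator {c..d} x *\<^sub>R f x) = (\<lambda>x. indicator {c..d} x *\<^sub>R f x)"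
    using cd by (auto simp: indicator_def fun_eq_iff)
  ultimately show "integrable (lebesgue_on {c..d}) f"
    by (simp add: integrable_restrict_space)
qed

lemma L1_loc_const: "(\<lambda>x. C) \<in> L1_loc a b"
  by (intro integrable_imp_L1_loc finite_measure.integrable_const
      interval_measure.axioms(1)[OF interval_measure_lebesgue_on])

text \<open>A locally integrable function need not be integrable up to the end points; the interval is exhausted
by compact subintervals, on which the integrable case applies.\<close>

lemma L1_loc_AE_zero:
  fixes f :: "real \<Rightarrow> 'a::real_or_complex"
  assumes f: "f \<in> L1_loc a b"
    and zero: "\<And>\<phi>. \<phi> \<in> test_functions a b \<Longrightarrow> (\<integral>x. f x * \<phi> x \<partial>lebesgue_on {a<..<b}) = 0"
  shows "AE x in lebesgue_on {a<..<b}. f x = 0"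
proof -
  have "AE x in lebesgue. x \<in> {a + 1 / real (Suc n)<..<b - 1 / real (Suc n)} \<longrightarrow> f x = 0" for n
  proof -
    define c where "c = a + 1 / real (Suc n)"
    define d where "d = b - 1 / real (Suc n)"
    have cd: "a < c" "d < b" by (auto simp: c_def d_def)
    have sub: "{c<..<d} \<subseteq> {c..d}" "{c<..<d} \<subseteq> {a<..<b}" using cd by auto
    have "integrable (lebesgue_on {c..d}) f" using f cd by (simp add: L1_loc_def)
    then have f_cd: "integrable (lebesgue_on {c<..<d}) f"
      using set_integrable_subset[of lebesgue "{c..d}" f "{c<..<d}"] sub(1)
      by (simp add: integrable_restrict_space set_integrable_def)
    have "AE x in lebesgue_on {c<..<d}. f x = 0"
    proof (rule interval_measure.AE_zero_if_test_integrals_zero[OF interval_measure_lebesgue_on f_cd])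
      fix \<phi> :: "real \<Rightarrow> 'a" assume \<phi>: "\<phi> \<in> test_functions c d"
      have "(\<integral>x. f x * \<phi> x \<partial>lebesgue_on {c<..<d}) = (\<integral>x. f x * \<phi> x \<partial>lebesgue_on {a<..<b})"
        using test_functions_zero_outside[OF \<phi>] sub(2)
        by (intro integral_lebesgue_on_superset) auto
      also have "\<dots> = 0"
        using cd by (intro zero test_functions_mono[OF \<phi>]) auto
      finally show "(\<integral>x. f x * \<phi> x \<partial>lebesgue_on {c<..<d}) = 0" .
    qed
    then show ?thesis by (simp add: AE_restrict_space_iff c_def d_def)
  qed
  then have "AE x in lebesgue. \<forall>n. x \<in> {a + 1 / real (Suc n)<..<b - 1 / real (Suc n)} \<longrightarrow> f x = 0"
    by (subst AE_all_countable) blast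
  then have "AE x in lebesgue. x \<in> {a<..<b} \<longrightarrow> f x = 0"
  proof eventually_elim
    case (elim x)
    show ?case
    proof
      assume "x \<in> {a<..<b}"
      then have "0 < min (x - a) (b - x)" by auto
      then obtain n where "1 / real (Suc n) < min (x - a) (b - x)"
        using nat_approx_posE by blast
      then show "f x = 0" using elim by (auto dest!: spec[of _ n])
    qed
  qed
  then show ?thesis by (simp add: AE_restrict_space_iff)
qed

lemma weak_deriv_unique:
  fixes f :: "real \<Rightarrow> 'a::real_or_complex"
  assumes "weak_deriv a b f g" "weak_deriv a b f h"
  shows "AE x in lebesgue_on {a<..<b}. g x = h x"
proof -
  have g: "g \<in> L1_loc a b" and h: "h \<in> L1_loc a b"
    using assms by (auto simp: weak_deriv_def)
  have "AE x in lebesgue_on {a<..<b}. g x - h x = 0"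
  proof (rule L1_loc_AE_zero[OF L1_loc_diff[OF g h]])
    fix \<phi> :: "real \<Rightarrow> 'a" assume \<phi>: "\<phi> \<in> test_functions a b"
    have "(\<integral>x. g x * \<phi> x \<partial>lebesgue_on {a<..<b}) = (\<integral>x. h x * \<phi> x \<partial>lebesgue_on {a<..<b})"
      using assms \<phi> by (simp add: weak_deriv_def)
    then show "(\<integral>x. (g x - h x) * \<phi> x \<partial>lebesgue_on {a<..<b}) = 0"
      using L1_loc_mult_test[OF g \<phi>] L1_loc_mult_test[OF h \<phi>]
      by (simp add: left_diff_distrib)
  qed
  then show ?thesis by simp
qed

lemma (in interval_measure) mu_weak_deriv_unique:
  fixes f :: "real \<Rightarrow> 'a::real_or_complex"
  assumes "mu_weak_deriv a b M f g" "mu_weak_deriv a b M f h"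
  shows "AE x in M. g x = h x"
proof -
  have g: "integrable M g" and h: "integrable M h"
    using assms by (auto simp: mu_weak_deriv_def)
  have "AE x in M. g x - h x = 0"
  proof (rule AE_zero_if_test_integrals_zero[OF Bochner_Integration.integrable_diff[OF g h]])
    fix \<phi> :: "real \<Rightarrow> 'a" assume \<phi>: "\<phi> \<in> test_functions a b"
    have "(\<integral>x. g x * \<phi> x \<partial>M) = (\<integral>x. h x * \<phi> x \<partial>M)"
      using assms \<phi> by (simp add: mu_weak_deriv_def)
    then show "(\<integral>x. (g x - h x) * \<phi> x \<partial>M) = 0"
      using integrable_mult_test[OF g \<phi>] integrable_mult_test[OF h \<phi>]
      by (simp add: left_diff_distrib)
  qed
  then show ?thesis by simp
qed

lemma integral_derivative_lebesgue_on:
  fixes F f :: "real \<Rightarrow> 'b::euclidean_space"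
  assumes F: "\<And>x. (F has_vector_derivative f x) (at x)" and f: "continuous_on UNIV f"
    and cd: "a \<le> c" "c \<le> d" "d \<le> b"
  shows "(\<integral>x. indicator {c..<d} x *\<^sub>R f x \<partial>lebesgue_on {a<..<b}) = F d - F c"
proof -
  have [measurable]: "f \<in> borel_measurable borel" by (rule borel_measurable_continuous_onI[OF f])
  have "has_bochner_integral lborel (\<lambda>x. indicator {c..d} x *\<^sub>R f x) (F d - F c)"
    using cd F continuous_on_subset[OF f]
    by (intro has_bochner_integral_FTC_Icc) (auto intro: has_vector_derivative_at_within)
  then have "F d - F c = (\<integral>x. indicator {c..d} x *\<^sub>R f x \<partial>lborel)"
    by (simp add: has_bochner_integral_iff)
  also have "\<dots> = (\<integral>x. indicator {c..d} x *\<^sub>R f x \<partial>lebesgue)"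
    by (subst integral_completion) auto
  also have "\<dots> = (\<integral>x. indicator {a<..<b} x *\<^sub>R indicator {c..<d} x *\<^sub>R f x \<partial>lebesgue)"
  proof (rule integral_cong_AE)
    have "AE x in lebesgue. x \<notin> {a, c, d, b}"
      by (rule AE_not_in) (simp add: null_sets_completion_iff finite_imp_null_set_lborel)
    then show "AE x in lebesgue. indicator {c..d} x *\<^sub>R f x = indicator {a<..<b} x *\<^sub>R indicator {c..<d} x *\<^sub>R f x"
      by eventually_elim (use cd in \<open>auto simp: indicator_def\<close>)
  qed (auto intro!: measurable_completion)
  finally show ?thesis by (simp add: integral_restrict_space)
qed

lemma continuous_antiderivative:
  fixes f :: "real \<Rightarrow> 'b::euclidean_space"
  assumes f: "continuous_on UNIV f"
  obtains F where "\<And>x. (F has_vector_derivative f x) (at x)" "F c = 0"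
proof
  let ?F = "\<lambda>u. LBINT y=c..u. f y"
  show "(?F has_vector_derivative f x) (at x)" for x
  proof -
    let ?l = "min c x - 1" and ?u = "max c x + 1"
    have "(?F has_vector_derivative f x) (at x within {?l..?u})"
      using continuous_on_subset[OF f] by (intro interval_integral_FTC2) auto
    then show ?thesis
      by (subst (asm) at_within_interior) (auto simp: interior_atLeastAtMost_real)
  qed
  show "?F c = 0" by simp
qed

text \<open>To the left of the support an antiderivative is constant, and vanishing of the integral makes
the constant to the right the same one.\<close>

lemma test_function_antiderivative:
  fixes \<psi> :: "real \<Rightarrow> 'a::real_or_complex"
  assumes \<psi>: "\<psi> \<in> test_functions a b" and zero: "(\<integral>x. \<psi> x \<partial>lebesgue_on {a<..<b}) = 0"
  obtains \<Phi> where "\<Phi> \<in> test_functions a b" "\<And>x. (\<Phi> has_vector_derivative \<psi> x) (at x)"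
proof -
  obtain c0 d0 where cd0: "a < c0" "d0 < b" "\<And>x. x \<notin> {c0..d0} \<Longrightarrow> \<psi> x = 0"
    by (rule test_functions_supportE[OF \<psi>]) blast
  show thesis
  proof (cases "a < b")
    case False
    then have "\<psi> x = 0" for x using test_functions_zero_outside[OF \<psi>, of x] by auto
    then have "\<psi> = (\<lambda>x. 0)" by auto
    with \<psi> show thesis by (intro that[of "\<lambda>x. 0"]) auto
  next
    case True
    define c where "c = min c0 ((a + b) / 2)"
    define d where "d = max d0 ((a + b) / 2)"
    have "x \<notin> {c..d} \<Longrightarrow> x \<notin> {c0..d0}" for x
      by (auto simp: c_def d_def)
    then have cd: "a < c" "c \<le> d" "d < b" "\<And>x. x \<notin> {c..d} \<Longrightarrow> \<psi> x = 0"
      using cd0 True by (auto simp: c_def d_def)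
    obtain \<Phi> where \<Phi>: "\<And>x. (\<Phi> has_vector_derivative \<psi> x) (at x)" "\<Phi> c = 0"
      using continuous_antiderivative[OF test_functions_continuous[OF \<psi>]] by metis
    have "\<Phi> x = 0" if "x < c" for x
    proof -
      have "\<Phi> c - \<Phi> x = (\<integral>t. indicator {x..<c} t *\<^sub>R \<psi> t \<partial>lebesgue_on {x<..<c})"
        using that by (intro integral_derivative_lebesgue_on[symmetric] \<Phi> test_functions_continuous[OF \<psi>]) auto
      also have "\<dots> = (\<integral>t. 0 \<partial>lebesgue_on {x<..<c})"
        using cd by (intro Bochner_Integration.integral_cong) auto
      finally show ?thesis using \<Phi> by simp
    qed
    moreover have "\<Phi> x = 0" if "x > d" for x
    proof -
      have "\<Phi> x - \<Phi> c = (\<integral>t. indicator {c..<x} t *\<^sub>R \<psi> t \<partial>lebesgue_on {a<..<max x b})"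
        using that cd by (intro integral_derivative_lebesgue_on[symmetric] \<Phi> test_functions_continuous[OF \<psi>]) auto
      also have "\<dots> = (\<integral>t. \<psi> t \<partial>lebesgue_on {a<..<max x b})"
        using cd that by (intro Bochner_Integration.integral_cong) (auto simp: indicator_def)
      also have "\<dots> = (\<integral>t. \<psi> t \<partial>lebesgue_on {a<..<b})"
        using cd by (intro integral_lebesgue_on_superset(1)[symmetric]) auto
      finally show ?thesis using \<Phi> zero by simp
    qed
    ultimately have "\<forall>x. x \<notin> {c..d} \<longrightarrow> \<Phi> x = 0" by force
    moreover have "smooth \<Phi>" by (rule smooth_primitive[OF test_functions_smooth[OF \<psi>] \<Phi>(1)])
    ultimately have "\<Phi> \<in> test_functions a b"
      using cd(1,3) unfolding test_functions_def by blast
    then show thesis using \<Phi>(1) by (rule that)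
  qed
qed

lemma test_function_integral_one:
  fixes a b :: real
  assumes "a < b"
  obtains \<psi> :: "real \<Rightarrow> 'a::real_or_complex"
  where "\<psi> \<in> test_functions a b" "(\<integral>x. \<psi> x \<partial>lebesgue_on {a<..<b}) = 1"
proof -
  interpret interval_measure "lebesgue_on {a<..<b}" a b by (rule interval_measure_lebesgue_on)
  have "\<exists>\<psi>::real \<Rightarrow> 'a. \<psi> \<in> test_functions a b \<and> (\<integral>x. \<psi> x \<partial>lebesgue_on {a<..<b}) \<noteq> 0"
  proof (rule ccontr)
    assume "\<not> ?thesis"
    then have "AE x in lebesgue_on {a<..<b}. (1::'a) = 0"
      by (intro AE_zero_if_test_integrals_zero) auto
    then have "emeasure (lebesgue_on {a<..<b}) (space (lebesgue_on {a<..<b})) = 0"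
      by (simp add: eventually_False ae_filter_eq_bot_iff)
    then show False using assms by (simp add: emeasure_restrict_space)
  qed
  then obtain \<psi> :: "real \<Rightarrow> 'a" where \<psi>: "\<psi> \<in> test_functions a b" "(\<integral>x. \<psi> x \<partial>lebesgue_on {a<..<b}) \<noteq> 0"
    by blast
  show thesis
  proof (rule that)
    let ?m = "\<integral>x. \<psi> x \<partial>lebesgue_on {a<..<b}"
    show "(\<lambda>x. inverse ?m * \<psi> x) \<in> test_functions a b"
      by (rule test_functions_bounded_linear[OF bounded_linear_mult_right \<psi>(1)])
    show "(\<integral>x. inverse ?m * \<psi> x \<partial>lebesgue_on {a<..<b}) = 1"
      using \<psi>(2) by simp
  qed
qed

text \<open>The lemma of du Bois-Reymond: every test function is a derivative of a test function plus a
  multiple of a fixed test function of integral one.\<close>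

lemma du_Bois_Reymond:
  fixes f :: "real \<Rightarrow> 'a::real_or_complex"
  assumes f: "f \<in> L1_loc a b"
    and zero: "\<And>\<phi>. \<phi> \<in> test_functions a b \<Longrightarrow>
       (\<integral>x. f x * vector_derivative \<phi> (at x) \<partial>lebesgue_on {a<..<b}) = 0"
  obtains C where "AE x in lebesgue_on {a<..<b}. f x = C"
proof (cases "a < b")
  case True
  let ?\<Lambda> = "lebesgue_on {a<..<b}"
  obtain \<psi> :: "real \<Rightarrow> 'a" where \<psi>: "\<psi> \<in> test_functions a b" "(\<integral>x. \<psi> x \<partial>?\<Lambda>) = 1"
    using test_function_integral_one[OF True] by blast
  define C where "C = (\<integral>x. f x * \<psi> x \<partial>?\<Lambda>)"
  have test_int: "integrable ?\<Lambda> \<theta>" if "\<theta> \<in> test_functions a b" for \<theta> :: "real \<Rightarrow> 'a"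
    using L1_loc_mult_test[OF L1_loc_const[of 1] that] by simp
  have "AE x in ?\<Lambda>. f x - C = 0"
  proof (rule L1_loc_AE_zero[OF L1_loc_diff[OF f L1_loc_const]])
    fix \<phi> :: "real \<Rightarrow> 'a" assume \<phi>: "\<phi> \<in> test_functions a b"
    define m where "m = (\<integral>x. \<phi> x \<partial>?\<Lambda>)"
    define \<theta> where "\<theta> = (\<lambda>x. \<phi> x + (- m) * \<psi> x)"
    have \<theta>: "\<theta> \<in> test_functions a b"
      unfolding \<theta>_def by (intro test_functions_add \<phi> test_functions_bounded_linear[OF bounded_linear_mult_right \<psi>(1)])
    have "(\<integral>x. \<theta> x \<partial>?\<Lambda>) = 0"
      using test_int[OF \<phi>] test_int[OF \<psi>(1)] \<psi>(2) by (simp add: \<theta>_def m_def)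
    then obtain \<Phi> where \<Phi>: "\<Phi> \<in> test_functions a b" "\<And>x. (\<Phi> has_vector_derivative \<theta> x) (at x)"
      using test_function_antiderivative[OF \<theta>] by blast
    have "0 = (\<integral>x. f x * vector_derivative \<Phi> (at x) \<partial>?\<Lambda>)" using zero[OF \<Phi>(1)] by simp
    also have "\<dots> = (\<integral>x. f x * \<phi> x - m * (f x * \<psi> x) \<partial>?\<Lambda>)"
      unfolding vector_derivative_at[OF \<Phi>(2)] by (simp add: \<theta>_def algebra_simps)
    also have "\<dots> = (\<integral>x. f x * \<phi> x \<partial>?\<Lambda>) - m * C"
      using L1_loc_mult_test[OF f \<phi>] L1_loc_mult_test[OF f \<psi>(1)] by (simp add: C_def)
    also have "\<dots> = (\<integral>x. (f x - C) * \<phi> x \<partial>?\<Lambda>)"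
      using L1_loc_mult_test[OF f \<phi>] test_int[OF \<phi>] by (simp add: left_diff_distrib m_def)
    finally show "(\<integral>x. (f x - C) * \<phi> x \<partial>?\<Lambda>) = 0" by simp
  qed
  then show thesis by (intro that[of C]) auto
next
  case False
  then show thesis by (intro that[of 0] AE_I2) auto
qed

section \<open>Primitives with respect to a measure\<close>

lemma L2_measurable: "f \<in> L2 M \<Longrightarrow> f \<in> borel_measurable M"
  by (simp add: L2_def)

lemma L2_mult_conjg_integrable:
  fixes f g :: "'x \<Rightarrow> 'a::real_or_complex"
  assumes "f \<in> L2 M" "g \<in> L2 M"
  shows "integrable M (\<lambda>x. f x * conjg (g x))"
proof (rule Bochner_Integration.integrable_bound)
  have [measurable]: "f \<in> borel_measurable M" "g \<in> borel_measurable M"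
    using assms by (auto simp: L2_def)
  show "integrable M (\<lambda>x. (norm (f x))\<^sup>2 + (norm (g x))\<^sup>2)"
    using assms by (auto simp: L2_def)
  show "(\<lambda>x. f x * conjg (g x)) \<in> borel_measurable M" by measurable
  have "norm (f x) * norm (g x) \<le> (norm (f x))\<^sup>2 + (norm (g x))\<^sup>2" for x
    using sum_squares_bound[of "norm (f x)" "norm (g x)"]
      mult_nonneg_nonneg[OF norm_ge_zero[of "f x"] norm_ge_zero[of "g x"]] by linarith
  then show "AE x in M. norm (f x * conjg (g x)) \<le> norm ((norm (f x))\<^sup>2 + (norm (g x))\<^sup>2)"
    by (intro AE_I2) (simp add: norm_mult)
qed

lemma L2_AE_cong:
  fixes f g :: "'x \<Rightarrow> 'a::real_or_complex"
  assumes f: "f \<in> L2 M" and g: "g \<in> borel_measurable M" and eq: "AE x in M. f x = g x"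
  shows "g \<in> L2 M"
proof -
  have [measurable]: "f \<in> borel_measurable M" "g \<in> borel_measurable M"
    using f g by (auto simp: L2_def)
  have "integrable M (\<lambda>x. (norm (f x))\<^sup>2)" using f by (simp add: L2_def)
  moreover have "AE x in M. (norm (f x))\<^sup>2 = (norm (g x))\<^sup>2" using eq by eventually_elim simp
  ultimately have "integrable M (\<lambda>x. (norm (g x))\<^sup>2)"
    by (subst (asm) integrable_cong_AE) auto
  then show ?thesis by (simp add: L2_def)
qed

lemma (in finite_measure) L2_integrable:
  fixes f :: "'a \<Rightarrow> 'b::real_or_complex"
  assumes f: "f \<in> L2 M"
  shows "integrable M f"
proof (rule Bochner_Integration.integrable_bound)
  show "integrable M (\<lambda>x. 1 + (norm (f x))\<^sup>2)" using f by (auto simp: L2_def)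
  have "norm (f x) \<le> 1 + (norm (f x))\<^sup>2" for x
    using sum_squares_bound[of 1 "norm (f x)"] norm_ge_zero[of "f x"] by (simp del: norm_ge_zero)
  then show "AE x in M. norm (f x) \<le> norm (1 + (norm (f x))\<^sup>2)" by (intro AE_I2) simp
qed (use f in \<open>simp add: L2_def\<close>)

text \<open>Integration extends over \<open>y < x\<close>, with strict inequality, which makes primitives continuous
from the left; for measures on \<open>(a, b)\<close> this is the integral over \<open>(a, x)\<close>.\<close>

definition primitive :: "real measure \<Rightarrow> (real \<Rightarrow> 'b) \<Rightarrow> real \<Rightarrow> 'b::{banach, second_countable_topology}"
  where "primitive M g x = (\<integral>y. indicator {..<x} y *\<^sub>R g y \<partial>M)"

context interval_measure
begin

lemma primitive_left:
  assumes "integrable M g" "x \<le> a"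
  shows "primitive M g x = 0"
  unfolding primitive_def
proof (rule integral_eq_zero_AE)
  show "AE y in M. indicator {..<x} y *\<^sub>R g y = 0"
    using AE_interior by eventually_elim (use assms in auto)
qed

lemma primitive_right:
  fixes g :: "real \<Rightarrow> 'b::{banach, second_countable_topology}"
  assumes g: "integrable M g" and "b \<le> x"
  shows "primitive M g x = (\<integral>y. g y \<partial>M)"
  unfolding primitive_def
proof (rule integral_cong_AE)
  show "AE y in M. indicator {..<x} y *\<^sub>R g y = g y"
    using AE_interior by eventually_elim (use assms in auto)
qed (use g integrable_indicator_scaleR[OF g, of "{..<x}"] in auto)

lemma primitive_diff:
  fixes g :: "real \<Rightarrow> 'b::{banach, second_countable_topology}"
  assumes g: "integrable M g" and "x \<le> y"
  shows "primitive M g y - primitive M g x = (\<integral>t. indicator {x..<y} t *\<^sub>R g t \<partial>M)"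
proof -
  have "primitive M g y - primitive M g x
      = (\<integral>t. indicator {..<y} t *\<^sub>R g t - indicator {..<x} t *\<^sub>R g t \<partial>M)"
    unfolding primitive_def
    by (rule Bochner_Integration.integral_diff[symmetric]) (auto intro: integrable_indicator_scaleR[OF g])
  also have "\<dots> = (\<integral>t. indicator {x..<y} t *\<^sub>R g t \<partial>M)"
    using assms by (intro Bochner_Integration.integral_cong) (auto simp: indicator_def)
  finally show ?thesis .
qed

lemma norm_primitive_diff_le:
  fixes g :: "real \<Rightarrow> 'b::{banach, second_countable_topology}"
  assumes g: "integrable M g" and "x \<le> y"
  shows "norm (primitive M g y - primitive M g x)
    \<le> primitive M (\<lambda>t. norm (g t)) y - primitive M (\<lambda>t. norm (g t)) x"
proof -
  have "norm (\<integral>t. indicator {x..<y} t *\<^sub>R g t \<partial>M) \<le> (\<integral>t. norm (indicator {x..<y} t *\<^sub>R g t) \<partial>M)"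
    by (rule integral_norm_bound)
  then show ?thesis using assms by (simp add: primitive_diff)
qed

lemma norm_primitive_le:
  fixes g :: "real \<Rightarrow> 'b::{banach, second_countable_topology}"
  assumes g: "integrable M g"
  shows "norm (primitive M g x) \<le> (\<integral>t. norm (g t) \<partial>M)"
proof -
  have "norm (primitive M g x) \<le> (\<integral>t. norm (indicator {..<x} t *\<^sub>R g t) \<partial>M)"
    unfolding primitive_def by (rule integral_norm_bound)
  also have "\<dots> \<le> (\<integral>t. norm (g t) \<partial>M)"
    using integrable_norm[OF integrable_indicator_scaleR[OF g, of "{..<x}"]] integrable_norm[OF g]
    by (intro integral_mono) (auto simp: indicator_def)
  finally show ?thesis .
qed

lemma primitive_measurable:
  fixes g :: "real \<Rightarrow> 'b::{banach, second_countable_topology}"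
  assumes g: "integrable M g"
  shows "primitive M g \<in> borel_measurable borel"
proof -
  have [measurable]: "g \<in> borel_measurable M" using g by simp
  have "(\<lambda>x. \<integral>y. indicator {p \<in> space (borel \<Otimes>\<^sub>M M). snd p < fst p} (x, y) *\<^sub>R g y \<partial>M) \<in> borel_measurable borel"
    by measurable
  then have "(\<lambda>x. \<integral>y. indicator {..<x} y *\<^sub>R g y \<partial>M) \<in> borel_measurable borel"
    by (rule measurable_cong[THEN iffD1, rotated])
       (auto intro!: Bochner_Integration.integral_cong simp: indicator_def space_pair_measure)
  then show ?thesis unfolding primitive_def[abs_def] .
qed

lemma primitive_sequential_limit:
  fixes g :: "real \<Rightarrow> 'b::{banach, second_countable_topology}"
  assumes g: "integrable M g"
    and lim: "AE y in M. \<forall>\<^sub>F n in sequentially. y < X n \<longleftrightarrow> y < x"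
  shows "(\<lambda>n. primitive M g (X n)) \<longlonglongrightarrow> primitive M g x"
  unfolding primitive_def
proof (rule integral_dominated_convergence[where w="\<lambda>x. norm (g x)"])
  show "AE y in M. (\<lambda>n. indicator {..<X n} y *\<^sub>R g y) \<longlonglongrightarrow> indicator {..<x} y *\<^sub>R g y"
    using lim by eventually_elim (rule tendsto_eventually, auto simp: indicator_def elim!: eventually_mono)
qed (use g integrable_indicator_scaleR[OF g] in \<open>auto simp: indicator_def\<close>)

lemma primitive_at_left:
  fixes g :: "real \<Rightarrow> 'b::{banach, second_countable_topology}"
  assumes g: "integrable M g"
  shows "(primitive M g \<longlongrightarrow> primitive M g x) (at_left x)"
proof (rule tendsto_at_left_sequentially[of "x - 1"])
  fix S :: "nat \<Rightarrow> real" assume S: "\<And>n. S n < x" "S \<longlonglongrightarrow> x"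
  have "\<forall>\<^sub>F n in sequentially. y < S n \<longleftrightarrow> y < x" for y
  proof (cases "y < x")
    case True
    from order_tendstoD(1)[OF S(2) True] show ?thesis using True by simp
  next
    case False
    then show ?thesis using S(1) by (intro always_eventually) (meson less_trans)
  qed
  then show "(\<lambda>n. primitive M g (S n)) \<longlonglongrightarrow> primitive M g x"
    by (intro primitive_sequential_limit g AE_I2)
qed simp

lemma primitive_at_right_start:
  fixes g :: "real \<Rightarrow> 'b::{banach, second_countable_topology}"
  assumes g: "integrable M g"
  shows "(primitive M g \<longlongrightarrow> 0) (at_right a)"
proof (rule tendsto_at_right_sequentially[of _ "a + 1"])
  fix S :: "nat \<Rightarrow> real" assume S: "\<And>n. a < S n" "S \<longlonglongrightarrow> a"
  have "AE y in M. \<forall>\<^sub>F n in sequentially. y < S n \<longleftrightarrow> y < a"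
    using AE_interior
  proof eventually_elim
    case (elim y)
    then have "\<forall>\<^sub>F n in sequentially. S n < y" using order_tendstoD(2)[OF S(2)] by blast
    then show ?case using elim by (auto elim!: eventually_mono)
  qed
  from primitive_sequential_limit[OF g this]
  show "(\<lambda>n. primitive M g (S n)) \<longlonglongrightarrow> 0" by (simp add: primitive_left[OF g])
qed simp

lemma primitive_at_left_end:
  fixes g :: "real \<Rightarrow> 'b::{banach, second_countable_topology}"
  assumes g: "integrable M g"
  shows "(primitive M g \<longlongrightarrow> (\<integral>y. g y \<partial>M)) (at_left b)"
  using primitive_at_left[OF g, of b] by (simp add: primitive_right[OF g])

lemma continuous_on_primitive:
  fixes g :: "real \<Rightarrow> 'b::{banach, second_countable_topology}"
  assumes g: "integrable M g" and diffuse: "\<And>x. AE y in M. y \<noteq> x"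
  shows "continuous_on A (primitive M g)"
proof (rule continuous_on_sequentiallyI)
  fix X :: "nat \<Rightarrow> real" and x assume X: "X \<longlonglongrightarrow> x"
  have "AE y in M. \<forall>\<^sub>F n in sequentially. y < X n \<longleftrightarrow> y < x"
    using diffuse[of x]
  proof eventually_elim
    case (elim y)
    then consider "y < x" | "x < y" by linarith
    then show ?case
    proof cases
      case 1
      then show ?thesis using order_tendstoD(1)[OF X 1] by simp
    next
      case 2
      then show ?thesis using order_tendstoD(2)[OF X 2] by (auto elim!: eventually_mono)
    qed
  qed
  from primitive_sequential_limit[OF g this]
  show "(\<lambda>n. primitive M g (X n)) \<longlonglongrightarrow> primitive M g x" .
qed

lemma bounded_variation_primitive:
  fixes g :: "real \<Rightarrow> 'b::{banach, second_countable_topology}"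
  assumes g: "integrable M g"
  shows "bounded_variation_on I (\<lambda>x. C + primitive M g x)"
  unfolding bounded_variation_on_def
proof (intro exI allI impI)
  let ?V = "primitive M (\<lambda>t. norm (g t))"
  fix n and t :: "nat \<Rightarrow> real"
  assume t: "(\<forall>i\<le>n. t i \<in> I) \<and> (\<forall>i<n. t i \<le> t (Suc i))"
  have "(\<Sum>i<n. norm (C + primitive M g (t (Suc i)) - (C + primitive M g (t i))))
      \<le> (\<Sum>i<n. ?V (t (Suc i)) - ?V (t i))"
    using t by (intro sum_mono) (simp add: norm_primitive_diff_le[OF g])
  also have "\<dots> = ?V (t n) - ?V (t 0)" by (rule sum_lessThan_telescope)
  also have "\<dots> \<le> norm (?V (t n)) + norm (?V (t 0))" by simp
  also have "\<dots> \<le> (\<integral>t. norm (g t) \<partial>M) + (\<integral>t. norm (g t) \<partial>M)"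
    using norm_primitive_le[OF integrable_norm[OF g]] by (intro add_mono) auto
  finally show "(\<Sum>i<n. norm (C + primitive M g (t (Suc i)) - (C + primitive M g (t i))))
      \<le> (\<integral>t. norm (g t) \<partial>M) + (\<integral>t. norm (g t) \<partial>M)" .
qed

lemma primitive_integrable:
  fixes g :: "real \<Rightarrow> 'a::real_or_complex"
  assumes g: "integrable M g"
  shows "integrable (lebesgue_on {a<..<b}) (\<lambda>x. C + primitive M g x)"
proof -
  interpret \<Lambda>: interval_measure "lebesgue_on {a<..<b}" a b by (rule interval_measure_lebesgue_on)
  have "norm (C + primitive M g x) \<le> norm C + (\<integral>t. norm (g t) \<partial>M)" for x
    using norm_triangle_ineq[of C "primitive M g x"] norm_primitive_le[OF g, of x] by linarith
  moreover have "(\<lambda>x. C + primitive M g x) \<in> borel_measurable borel"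
    using primitive_measurable[OF g] by measurable
  ultimately show ?thesis
    using \<Lambda>.integrable_mult_bounded[of "\<lambda>x. 1" "\<lambda>x. C + primitive M g x"] by auto
qed

lemma primitive_Fubini:
  fixes g K :: "real \<Rightarrow> 'a::real_or_complex"
  assumes g: "integrable M g" and K: "integrable (lebesgue_on {a<..<b}) K"
  shows "(\<integral>x. primitive M g x * K x \<partial>lebesgue_on {a<..<b})
    = (\<integral>y. g y * (\<integral>x. indicator {y<..} x *\<^sub>R K x \<partial>lebesgue_on {a<..<b}) \<partial>M)"
proof -
  let ?\<Lambda> = "lebesgue_on {a<..<b}"
  interpret \<Lambda>: interval_measure ?\<Lambda> a b by (rule interval_measure_lebesgue_on)
  interpret P: pair_sigma_finite ?\<Lambda> M ..
  have [measurable]: "g \<in> borel_measurable M" "K \<in> borel_measurable ?\<Lambda>" using g K by auto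
  note \<Lambda>.id_measurable[measurable]
  have prod: "integrable (?\<Lambda> \<Otimes>\<^sub>M M) (\<lambda>(x, y). g y * K x)"
  proof (rule P.Fubini_integrable)
    show "integrable ?\<Lambda> (\<lambda>x. \<integral>y. norm (case (x, y) of (x, y) \<Rightarrow> g y * K x) \<partial>M)"
      using g K by (simp add: norm_mult)
    show "AE x in ?\<Lambda>. integrable M (\<lambda>y. case (x, y) of (x, y) \<Rightarrow> g y * K x)"
      using g by simp
  qed measurable
  have int: "integrable (?\<Lambda> \<Otimes>\<^sub>M M) (\<lambda>(x, y). indicator {..<x} y *\<^sub>R (g y * K x))"
  proof (rule Bochner_Integration.integrable_bound[OF prod])
    have "(\<lambda>p. indicator {p \<in> space (?\<Lambda> \<Otimes>\<^sub>M M). snd p < fst p} p *\<^sub>R (g (snd p) * K (fst p)))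
        \<in> borel_measurable (?\<Lambda> \<Otimes>\<^sub>M M)"
      by measurable
    then show "(\<lambda>(x, y). indicator {..<x} y *\<^sub>R (g y * K x)) \<in> borel_measurable (?\<Lambda> \<Otimes>\<^sub>M M)"
      by (rule measurable_cong[THEN iffD1, rotated]) (auto simp: indicator_def split: prod.splits)
  qed (auto simp: indicator_def)
  have "(\<integral>x. primitive M g x * K x \<partial>?\<Lambda>) = (\<integral>x. \<integral>y. indicator {..<x} y *\<^sub>R (g y * K x) \<partial>M \<partial>?\<Lambda>)"
  proof (rule Bochner_Integration.integral_cong[OF refl])
    fix x
    have "(\<integral>y. indicator {..<x} y *\<^sub>R (g y * K x) \<partial>M) = (\<integral>y. (indicator {..<x} y *\<^sub>R g y) * K x \<partial>M)"
      by simp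
    then show "primitive M g x * K x = (\<integral>y. indicator {..<x} y *\<^sub>R (g y * K x) \<partial>M)"
      using integrable_indicator_scaleR[OF g, of "{..<x}"] by (simp add: primitive_def del: mult_scaleR_left)
  qed
  also have "\<dots> = (\<integral>y. \<integral>x. indicator {..<x} y *\<^sub>R (g y * K x) \<partial>?\<Lambda> \<partial>M)"
    by (rule P.Fubini_integral[OF int, symmetric])
  also have "\<dots> = (\<integral>y. g y * (\<integral>x. indicator {y<..} x *\<^sub>R K x \<partial>?\<Lambda>) \<partial>M)"
  proof (rule Bochner_Integration.integral_cong[OF refl])
    fix y
    have "(\<integral>x. indicator {..<x} y *\<^sub>R (g y * K x) \<partial>?\<Lambda>) = (\<integral>x. g y * (indicator {y<..} x *\<^sub>R K x) \<partial>?\<Lambda>)"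
      by (intro Bochner_Integration.integral_cong) (auto simp: indicator_def)
    then show "(\<integral>x. indicator {..<x} y *\<^sub>R (g y * K x) \<partial>?\<Lambda>)
        = g y * (\<integral>x. indicator {y<..} x *\<^sub>R K x \<partial>?\<Lambda>)"
      using \<Lambda>.integrable_indicator_scaleR[OF K, of "{y<..}"] by (simp del: mult_scaleR_right)
  qed
  finally show ?thesis .
qed

text \<open>The measure of the primitive is arbitrary while \<open>w\<close> is absolutely continuous, so that
interchanging the two integrations leaves \<open>\<integral> K\<close> over \<open>(y, b)\<close>, which is \<open>w b - w y\<close>.\<close>

lemma integration_by_parts:
  fixes g K w :: "real \<Rightarrow> 'a::real_or_complex"
  assumes ab: "a \<le> b"
    and g: "integrable M g" and K: "integrable (lebesgue_on {a<..<b}) K"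
    and w: "\<And>x. x \<in> {a..b} \<Longrightarrow> w x = w a + primitive (lebesgue_on {a<..<b}) K x"
    and gw: "integrable M (\<lambda>y. g y * w y)"
  shows "(\<integral>x. (C + primitive M g x) * K x \<partial>lebesgue_on {a<..<b})
    = (C + (\<integral>y. g y \<partial>M)) * w b - C * w a - (\<integral>y. g y * w y \<partial>M)"
proof -
  let ?\<Lambda> = "lebesgue_on {a<..<b}"
  interpret \<Lambda>: interval_measure ?\<Lambda> a b by (rule interval_measure_lebesgue_on)
  have total: "(\<integral>x. K x \<partial>?\<Lambda>) = w b - w a"
    using w[of b] ab by (simp add: \<Lambda>.primitive_right[OF K])
  have tail: "(\<integral>x. indicator {y<..} x *\<^sub>R K x \<partial>?\<Lambda>) = w b - w y" if "a < y" "y < b" for y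
  proof -
    have "(\<integral>x. indicator {y<..} x *\<^sub>R K x \<partial>?\<Lambda>) = (\<integral>x. K x - indicator {..<y} x *\<^sub>R K x \<partial>?\<Lambda>)"
    proof (rule integral_cong_AE)
      have "AE x in ?\<Lambda>. x \<noteq> y"
        by (simp add: AE_restrict_space_iff) (rule AE_mp[OF AE_completion[OF AE_lborel_singleton[of y]]], simp)
      then show "AE x in ?\<Lambda>. indicator {y<..} x *\<^sub>R K x = K x - indicator {..<y} x *\<^sub>R K x"
        by eventually_elim (auto simp: indicator_def)
    qed (use K \<Lambda>.integrable_indicator_scaleR[OF K] in \<open>auto intro!: borel_measurable_diff\<close>)
    also have "\<dots> = w b - w a - primitive ?\<Lambda> K y"
      using K \<Lambda>.integrable_indicator_scaleR[OF K, of "{..<y}"] by (simp add: total primitive_def)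
    also have "\<dots> = w b - w y" using w[of y] that by simp
    finally show ?thesis .
  qed
  have "(\<integral>x. (C + primitive M g x) * K x \<partial>?\<Lambda>) = (\<integral>x. C * K x \<partial>?\<Lambda>) + (\<integral>x. primitive M g x * K x \<partial>?\<Lambda>)"
  proof -
    have "integrable ?\<Lambda> (\<lambda>x. K x * primitive M g x)"
      using norm_primitive_le[OF g] primitive_measurable[OF g] \<Lambda>.borel_imp_measurable
      by (intro \<Lambda>.integrable_mult_bounded[OF K]) auto
    then show ?thesis using K by (simp add: distrib_right mult.commute[of "K _"])
  qed
  also have "(\<integral>x. primitive M g x * K x \<partial>?\<Lambda>) = (\<integral>y. g y * (w b - w y) \<partial>M)"
    unfolding primitive_Fubini[OF g K]
  proof (rule integral_cong_AE)
    have [measurable]: "g \<in> borel_measurable M" "K \<in> borel_measurable ?\<Lambda>" using g K by auto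
    have "(\<lambda>y. \<integral>x. indicator {p \<in> space (M \<Otimes>\<^sub>M ?\<Lambda>). fst p < snd p} (y, x) *\<^sub>R K x \<partial>?\<Lambda>) \<in> borel_measurable M"
      using \<Lambda>.id_measurable by measurable
    then have "(\<lambda>y. \<integral>x. indicator {y<..} x *\<^sub>R K x \<partial>?\<Lambda>) \<in> borel_measurable M"
      by (rule measurable_cong[THEN iffD1, rotated])
         (auto intro!: Bochner_Integration.integral_cong simp: indicator_def space_pair_measure)
    then show "(\<lambda>y. g y * (\<integral>x. indicator {y<..} x *\<^sub>R K x \<partial>?\<Lambda>)) \<in> borel_measurable M"
      by measurable
    show "AE y in M. g y * (\<integral>x. indicator {y<..} x *\<^sub>R K x \<partial>?\<Lambda>) = g y * (w b - w y)"
      using AE_interior by eventually_elim (simp add: tail)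
    show "(\<lambda>y. g y * (w b - w y)) \<in> borel_measurable M"
      using g gw by (simp add: right_diff_distrib)
  qed
  also have "\<dots> = (\<integral>y. g y \<partial>M) * w b - (\<integral>y. g y * w y \<partial>M)"
    using g gw by (simp add: right_diff_distrib)
  finally show ?thesis using K by (simp add: total algebra_simps)
qed

lemma test_function_eq_primitive:
  fixes \<phi> :: "real \<Rightarrow> 'a::real_or_complex"
  assumes \<phi>: "\<phi> \<in> test_functions a b" and x: "x \<in> {a..b}"
  shows "\<phi> x = primitive (lebesgue_on {a<..<b}) (\<lambda>x. vector_derivative \<phi> (at x)) x"
proof -
  have "primitive (lebesgue_on {a<..<b}) (\<lambda>x. vector_derivative \<phi> (at x)) x
     = (\<integral>t. indicator {a..<x} t *\<^sub>R vector_derivative \<phi> (at t) \<partial>lebesgue_on {a<..<b})"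
    unfolding primitive_def by (intro Bochner_Integration.integral_cong) (auto simp: indicator_def)
  also have "\<dots> = \<phi> x - \<phi> a"
    using x \<phi> by (intro integral_derivative_lebesgue_on smooth_vector_derivative(1)
      test_functions_continuous[OF test_functions_derivative[OF \<phi>]] test_functions_smooth) auto
  finally show ?thesis using test_functions_zero_outside[OF \<phi>] by simp
qed

lemma primitive_mult_test_derivative:
  fixes g \<phi> :: "real \<Rightarrow> 'a::real_or_complex"
  assumes g: "integrable M g" and \<phi>: "\<phi> \<in> test_functions a b"
  shows "(\<integral>x. (C + primitive M g x) * vector_derivative \<phi> (at x) \<partial>lebesgue_on {a<..<b})
    = - (\<integral>x. g x * \<phi> x \<partial>M)"
proof (cases "a \<le> b")
  case True
  have "integrable (lebesgue_on {a<..<b}) (\<lambda>x. vector_derivative \<phi> (at x))"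
    using L1_loc_mult_test[OF L1_loc_const[of 1] test_functions_derivative[OF \<phi>]] by simp
  moreover have "\<phi> a = 0" "\<phi> b = 0" using test_functions_zero_outside[OF \<phi>] by auto
  ultimately show ?thesis
    using integration_by_parts[OF True g, of _ \<phi> C] test_function_eq_primitive[OF \<phi>]
      integrable_mult_test[OF g \<phi>] by simp
next
  case False
  then have "\<phi> x = 0" for x using test_functions_zero_outside[OF \<phi>] by auto
  moreover have "{a<..<b} = {}" using False by auto
  ultimately show ?thesis by (simp add: integral_restrict_space)
qed

lemma mu_weak_deriv_primitive:
  fixes f g :: "real \<Rightarrow> 'a::real_or_complex"
  assumes g: "integrable M g" and f: "f \<in> borel_measurable (lebesgue_on {a<..<b})"
    and eq: "AE x in lebesgue_on {a<..<b}. f x = C + primitive M g x"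
  shows "mu_weak_deriv a b M f g"
  unfolding mu_weak_deriv_def
proof (intro conjI ballI)
  have p: "integrable (lebesgue_on {a<..<b}) (\<lambda>x. C + primitive M g x)"
    by (rule primitive_integrable[OF g])
  then have "integrable (lebesgue_on {a<..<b}) f"
    using eq f by (subst integrable_cong_AE[where g="\<lambda>x. C + primitive M g x"]) auto
  then show fL: "f \<in> L1_loc a b" by (rule integrable_imp_L1_loc)
  fix \<phi> :: "real \<Rightarrow> 'a" assume \<phi>: "\<phi> \<in> test_functions a b"
  have "(\<integral>x. f x * vector_derivative \<phi> (at x) \<partial>lebesgue_on {a<..<b})
      = (\<integral>x. (C + primitive M g x) * vector_derivative \<phi> (at x) \<partial>lebesgue_on {a<..<b})"
  proof (rule integral_cong_AE)
    show "AE x in lebesgue_on {a<..<b}. f x * vector_derivative \<phi> (at x)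
        = (C + primitive M g x) * vector_derivative \<phi> (at x)"
      using eq by eventually_elim simp
  qed (use L1_loc_mult_test[OF fL test_functions_derivative[OF \<phi>]]
      L1_loc_mult_test[OF integrable_imp_L1_loc[OF p] test_functions_derivative[OF \<phi>]] in auto)
  also have "\<dots> = - (\<integral>x. g x * \<phi> x \<partial>M)" by (rule primitive_mult_test_derivative[OF g \<phi>])
  finally show "(\<integral>x. f x * vector_derivative \<phi> (at x) \<partial>lebesgue_on {a<..<b}) = - (\<integral>x. g x * \<phi> x \<partial>M)" .
qed (rule g)

text \<open>The difference of \<open>f\<close> and the primitive of its derivative has vanishing distributional
derivative.\<close>

lemma mu_weak_deriv_imp_primitive:
  fixes f g :: "real \<Rightarrow> 'a::real_or_complex"
  assumes "mu_weak_deriv a b M f g"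
  obtains C where "AE x in lebesgue_on {a<..<b}. f x = C + primitive M g x"
proof -
  have f: "f \<in> L1_loc a b" and g: "integrable M g"
    and fg: "\<And>\<phi>. \<phi> \<in> test_functions a b \<Longrightarrow>
      (\<integral>x. f x * vector_derivative \<phi> (at x) \<partial>lebesgue_on {a<..<b}) = - (\<integral>x. g x * \<phi> x \<partial>M)"
    using assms by (auto simp: mu_weak_deriv_def)
  have p: "primitive M g \<in> L1_loc a b"
    using integrable_imp_L1_loc[OF primitive_integrable[OF g, of 0]] by simp
  obtain C where "AE x in lebesgue_on {a<..<b}. f x - primitive M g x = C"
  proof (rule du_Bois_Reymond[OF L1_loc_diff[OF f p]])
    fix \<phi> :: "real \<Rightarrow> 'a" assume \<phi>: "\<phi> \<in> test_functions a b"
    show "(\<integral>x. (f x - primitive M g x) * vector_derivative \<phi> (at x) \<partial>lebesgue_on {a<..<b}) = 0"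
      using L1_loc_mult_test[OF f test_functions_derivative[OF \<phi>]]
        L1_loc_mult_test[OF p test_functions_derivative[OF \<phi>]]
        primitive_mult_test_derivative[OF g \<phi>, of 0] fg[OF \<phi>]
      by (simp add: left_diff_distrib)
  qed blast
  then have "AE x in lebesgue_on {a<..<b}. f x = C + primitive M g x"
    by eventually_elim (simp add: algebra_simps)
  then show thesis by (rule that)
qed

end

section \<open>Boundary limits of functions of bounded variation\<close>

lemma AE_interval_point:
  fixes x y :: real
  assumes "AE t in lebesgue_on {a<..<b}. P t" "a \<le> x" "x < y" "y \<le> b"
  obtains t where "x < t" "t < y" "P t"
proof -
  have "\<exists>t. x < t \<and> t < y \<and> P t"
  proof (rule ccontr)
    assume none: "\<not> ?thesis"
    have "AE t in lebesgue. t \<in> {a<..<b} \<longrightarrow> P t"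
      using assms(1) by (simp add: AE_restrict_space_iff)
    then have "AE t in lebesgue. t \<notin> {x<..<y}"
      by eventually_elim (use none assms in force)
    then have "{x<..<y} \<in> null_sets lebesgue"
      by (subst (asm) AE_iff_null_sets[symmetric]) auto
    then show False using assms by (auto simp: null_sets_def)
  qed
  then show thesis using that by blast
qed

text \<open>A partition that nearly exhausts the variation leaves little variation beyond its first and
  its last point, and this bounds the function there as zeros are dense.\<close>

lemma bounded_variation_AE_zero_limits:
  fixes u :: "real \<Rightarrow> 'a::real_normed_vector"
  assumes ab: "a < b" and bv: "bounded_variation_on {a<..<b} u"
    and zero: "AE x in lebesgue_on {a<..<b}. u x = 0"
  shows "(u \<longlongrightarrow> 0) (at_right a)" and "(u \<longlongrightarrow> 0) (at_left b)"
proof -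
  define var where "var n t = (\<Sum>i<n. norm (u (t (Suc i)) - u (t i)))" for n and t :: "nat \<Rightarrow> real"
  define part where "part n t \<longleftrightarrow> (\<forall>i\<le>n. t i \<in> {a<..<b}) \<and> (\<forall>i<n. t i \<le> t (Suc i))" for n t
  obtain B where B: "\<And>n t. part n t \<Longrightarrow> var n t \<le> B"
    using bv unfolding bounded_variation_on_def part_def var_def by blast
  define V where "V = {var n t |n t. part n t}"
  have bdd: "bdd_above V" unfolding V_def using B by (auto intro!: bdd_aboveI)
  have "part 0 (\<lambda>_. (a + b) / 2)" using ab by (simp add: part_def)
  then have ne: "V \<noteq> {}" unfolding V_def by blast
  have le_Sup: "var n t \<le> Sup V" if "part n t" for n t
    using that by (intro cSup_upper bdd) (auto simp: V_def)
  have near_end: "\<exists>c d. c \<in> {a<..<b} \<and> d \<in> {a<..<b} \<and>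
      (\<forall>x\<in>{a<..<c}. norm (u x) < e) \<and> (\<forall>x\<in>{d<..<b}. norm (u x) < e)" if "e > 0" for e
  proof -
    have "Sup V - e < Sup V" using that by simp
    then obtain v where "v \<in> V" "Sup V - e < v" using less_cSup_iff[OF ne bdd] by blast
    then obtain n t where t: "part n t" "Sup V - e < var n t" unfolding V_def by blast
    have "norm (u x) < e" if x: "x \<in> {a<..<t 0}" for x
    proof -
      have t0: "t 0 < b" using t(1) by (simp add: part_def)
      obtain y where y: "x < y" "y < t 0" "u y = 0"
        using AE_interval_point[OF zero, of x "t 0"] x t0 by auto
      \<comment> \<open>Prepending \<open>x\<close> and \<open>y\<close> to the partition adds at least \<open>norm (u x)\<close> to its variation.\<close>
      define s where "s i = (case i of 0 \<Rightarrow> x | Suc 0 \<Rightarrow> y | Suc (Suc i) \<Rightarrow> t i)" for i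
      have "part (Suc (Suc n)) s"
        using t(1) x y t0 unfolding part_def s_def by (auto split: nat.splits simp: less_Suc_eq_le)
      then have "var (Suc (Suc n)) s \<le> Sup V" by (rule le_Sup)
      moreover have "var (Suc (Suc n)) s = norm (u y - u x) + (norm (u (t 0) - u y) + var n t)"
        unfolding var_def by (subst sum.lessThan_Suc_shift, subst sum.lessThan_Suc_shift) (simp add: s_def)
      moreover have "norm (u y - u x) = norm (u x)" using y(3) by simp
      ultimately show ?thesis using t(2) norm_ge_zero[of "u (t 0) - u y"] by linarith
    qed
    moreover have "norm (u x) < e" if x: "x \<in> {t n<..<b}" for x
    proof -
      have tn: "a < t n" using t(1) by (simp add: part_def)
      obtain y where y: "t n < y" "y < x" "u y = 0"
        using AE_interval_point[OF zero, of "t n" x] x tn by auto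
      define s where "s i = (if i \<le> n then t i else if i = Suc n then y else x)" for i
      have "part (Suc (Suc n)) s"
        using t(1) x y tn unfolding part_def s_def
        by (auto simp: less_Suc_eq le_Suc_eq)
      then have "var (Suc (Suc n)) s \<le> Sup V" by (rule le_Sup)
      moreover have "var (Suc (Suc n)) s = var n t + norm (u y - u (t n)) + norm (u x - u y)"
        unfolding var_def by (simp add: s_def)
      moreover have "norm (u x - u y) = norm (u x)" using y(3) by simp
      ultimately show ?thesis using t(2) norm_ge_zero[of "u y - u (t n)"] by linarith
    qed
    moreover have "t 0 \<in> {a<..<b}" "t n \<in> {a<..<b}" using t(1) by (auto simp: part_def)
    ultimately show ?thesis by blast
  qed
  show "(u \<longlongrightarrow> 0) (at_right a)"
  proof (rule tendstoI)
    fix e :: real assume "e > 0"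
    then obtain c where "c \<in> {a<..<b}" "\<forall>x\<in>{a<..<c}. norm (u x) < e" using near_end by blast
    then show "\<forall>\<^sub>F x in at_right a. dist (u x) 0 < e"
      by (auto simp: eventually_at_right_field intro!: exI[of _ c])
  qed
  show "(u \<longlongrightarrow> 0) (at_left b)"
  proof (rule tendstoI)
    fix e :: real assume "e > 0"
    then obtain d where "d \<in> {a<..<b}" "\<forall>x\<in>{d<..<b}. norm (u x) < e" using near_end by blast
    then show "\<forall>\<^sub>F x in at_left b. dist (u x) 0 < e"
      by (auto simp: eventually_at_left_field intro!: exI[of _ d])
  qed
qed

lemma bounded_variation_diff:
  assumes "bounded_variation_on I f" "bounded_variation_on I g"
  shows "bounded_variation_on I (\<lambda>x. f x - g x)"
proof -
  obtain B where B: "\<And>n t. (\<forall>i\<le>n. t i \<in> I) \<and> (\<forall>i<n. t i \<le> t (Suc i)) \<Longrightarrow>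
      (\<Sum>i<n. norm (f (t (Suc i)) - f (t i))) \<le> B"
    using assms(1) unfolding bounded_variation_on_def by blast
  obtain C where C: "\<And>n t. (\<forall>i\<le>n. t i \<in> I) \<and> (\<forall>i<n. t i \<le> t (Suc i)) \<Longrightarrow>
      (\<Sum>i<n. norm (g (t (Suc i)) - g (t i))) \<le> C"
    using assms(2) unfolding bounded_variation_on_def by blast
  show ?thesis
    unfolding bounded_variation_on_def
  proof (intro exI allI impI)
    fix n and t :: "nat \<Rightarrow> real" assume t: "(\<forall>i\<le>n. t i \<in> I) \<and> (\<forall>i<n. t i \<le> t (Suc i))"
    have "norm (f x - g x - (f y - g y)) \<le> norm (f x - f y) + norm (g x - g y)" for x y
      using norm_triangle_ineq4[of "f x - f y" "g x - g y"] by (simp add: algebra_simps)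
    then have "(\<Sum>i<n. norm (f (t (Suc i)) - g (t (Suc i)) - (f (t i) - g (t i))))
        \<le> (\<Sum>i<n. norm (f (t (Suc i)) - f (t i)) + norm (g (t (Suc i)) - g (t i)))"
      by (intro sum_mono)
    also have "\<dots> \<le> B + C"
      unfolding sum.distrib by (intro add_mono B C t)
    finally show "(\<Sum>i<n. norm (f (t (Suc i)) - g (t (Suc i)) - (f (t i) - g (t i)))) \<le> B + C" .
  qed
qed

text \<open>Two representatives of bounded variation differ by a function of bounded variation that vanishes
almost everywhere, so the boundary limits can be read off from the primitive.\<close>

lemma (in interval_measure) bv_rep_Lim:
  fixes f g :: "real \<Rightarrow> 'a::real_or_complex"
  assumes ab: "a < b" and g: "integrable M g"
    and eq: "AE x in lebesgue_on {a<..<b}. f x = C + primitive M g x"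
  shows "Lim (at_right a) (bv_rep a b f) = C"
    and "Lim (at_left b) (bv_rep a b f) = C + (\<integral>x. g x \<partial>M)"
proof -
  let ?p = "\<lambda>x. C + primitive M g x"
  have "AE x in lebesgue_on {a<..<b}. ?p x = f x" using eq by eventually_elim simp
  then have "\<exists>h. bounded_variation_on {a<..<b} h \<and> (AE x in lebesgue_on {a<..<b}. h x = f x)"
    using bounded_variation_primitive[OF g] by blast
  from someI_ex[OF this]
  have bv: "bounded_variation_on {a<..<b} (bv_rep a b f)"
    and ae: "AE x in lebesgue_on {a<..<b}. bv_rep a b f x = f x"
    by (auto simp: bv_rep_def)
  define u where "u x = bv_rep a b f x - ?p x" for x
  have "bounded_variation_on {a<..<b} u"
    unfolding u_def by (intro bounded_variation_diff bv bounded_variation_primitive g)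
  moreover have "AE x in lebesgue_on {a<..<b}. u x = 0"
    using ae eq by eventually_elim (simp add: u_def)
  ultimately have u: "(u \<longlongrightarrow> 0) (at_right a)" "(u \<longlongrightarrow> 0) (at_left b)"
    using bounded_variation_AE_zero_limits[OF ab] by auto
  have "((\<lambda>x. u x + ?p x) \<longlongrightarrow> 0 + (C + 0)) (at_right a)"
    by (intro tendsto_intros u primitive_at_right_start g)
  then show "Lim (at_right a) (bv_rep a b f) = C"
    by (intro tendsto_Lim) (auto simp: u_def)
  have "((\<lambda>x. u x + ?p x) \<longlongrightarrow> 0 + (C + (\<integral>x. g x \<partial>M))) (at_left b)"
    by (intro tendsto_intros u primitive_at_left_end g)
  then show "Lim (at_left b) (bv_rep a b f) = C + (\<integral>x. g x \<partial>M)"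
    by (intro tendsto_Lim) (auto simp: u_def)
qed

section \<open>Sobolev functions as primitives\<close>

lemma weak_deriv_iff_mu_weak_deriv:
  assumes "integrable (lebesgue_on {a<..<b}) g"
  shows "weak_deriv a b f g \<longleftrightarrow> mu_weak_deriv a b (lebesgue_on {a<..<b}) f g"
  using assms integrable_imp_L1_loc[OF assms] by (auto simp: weak_deriv_def mu_weak_deriv_def)

lemma L1_loc_measurable:
  fixes f :: "real \<Rightarrow> 'a::real_or_complex"
  assumes f: "f \<in> L1_loc a b"
  shows "f \<in> borel_measurable (lebesgue_on {a<..<b})"
proof -
  let ?I = "\<lambda>n. {a + 1 / real (Suc n)..b - 1 / real (Suc n)}"
  show ?thesis
  proof (rule measurable_piecewise_restrict[of "range ?I"])
    show "space (lebesgue_on {a<..<b}) \<subseteq> \<Union> (range ?I)"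
    proof
      fix x assume "x \<in> space (lebesgue_on {a<..<b})"
      then have "0 < min (x - a) (b - x)" by auto
      then obtain n where "1 / real (Suc n) < min (x - a) (b - x)" using nat_approx_posE by blast
      then show "x \<in> \<Union> (range ?I)" by (auto intro!: exI[of _ n])
    qed
    fix \<Omega> assume "\<Omega> \<in> range ?I"
    then obtain n where \<Omega>: "\<Omega> = ?I n" by blast
    have cd: "a < a + 1 / real (Suc n)" "b - 1 / real (Suc n) < b" by auto
    have sub: "\<Omega> \<subseteq> {a<..<b}"
    proof
      fix x assume "x \<in> \<Omega>"
      then have "a + 1 / real (Suc n) \<le> x" "x \<le> b - 1 / real (Suc n)" by (simp_all add: \<Omega>)
      with cd show "x \<in> {a<..<b}"
        unfolding greaterThanLessThan_iff by (intro conjI; linarith)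
    qed
    then show "\<Omega> \<inter> space (lebesgue_on {a<..<b}) \<in> sets (lebesgue_on {a<..<b})"
      unfolding \<Omega> by (auto simp: sets_restrict_space_iff Int_absorb2)
    have "integrable (lebesgue_on \<Omega>) f"
      using f cd unfolding L1_loc_def \<Omega> by blast
    moreover have "restrict_space (lebesgue_on {a<..<b}) \<Omega> = lebesgue_on \<Omega>"
      using sub by (subst restrict_restrict_space) (auto simp: \<Omega> Int_absorb1 Int_absorb2)
    ultimately show "f \<in> borel_measurable (restrict_space (lebesgue_on {a<..<b}) \<Omega>)"
      by simp
  qed auto
qed

lemma sobolev_deriv_props:
  fixes f :: "real \<Rightarrow> 'a::real_or_complex"
  assumes f: "f \<in> sobolev_W12 a b"
  shows "weak_deriv a b f (sobolev_deriv a b f)"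
    and "sobolev_deriv a b f \<in> L2 (lebesgue_on {a<..<b})"
proof -
  obtain g where g: "g \<in> L2 (lebesgue_on {a<..<b})" "weak_deriv a b f g"
    using f by (auto simp: sobolev_W12_def)
  show w: "weak_deriv a b f (sobolev_deriv a b f)"
    using someI[of "weak_deriv a b f" g, OF g(2)] by (simp add: sobolev_deriv_def)
  show "sobolev_deriv a b f \<in> L2 (lebesgue_on {a<..<b})"
    using w by (intro L2_AE_cong[OF g(1)] weak_deriv_unique[OF g(2) w] L1_loc_measurable)
      (simp add: weak_deriv_def)
qed

lemma sobolev_deriv_integrable:
  fixes f :: "real \<Rightarrow> 'a::real_or_complex"
  assumes f: "f \<in> sobolev_W12 a b"
  shows "integrable (lebesgue_on {a<..<b}) (sobolev_deriv a b f)"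
  using interval_measure.axioms(1)[OF interval_measure_lebesgue_on] sobolev_deriv_props(2)[OF f]
  by (rule finite_measure.L2_integrable)

lemma AE_lebesgue_on_neq: "AE y in lebesgue_on {a<..<b}. y \<noteq> (x::real)"
  by (simp add: AE_restrict_space_iff) (rule AE_mp[OF AE_completion[OF AE_lborel_singleton[of x]]], simp)

lemma continuous_on_primitive_lebesgue:
  fixes g :: "real \<Rightarrow> 'b::{banach, second_countable_topology}"
  assumes "integrable (lebesgue_on {a<..<b}) g"
  shows "continuous_on A (primitive (lebesgue_on {a<..<b}) g)"
  by (rule interval_measure.continuous_on_primitive[OF interval_measure_lebesgue_on assms AE_lebesgue_on_neq])

text \<open>The set where both functions agree is closed and dense in the interval.\<close>

lemma continuous_AE_eq:
  fixes f g :: "real \<Rightarrow> 'a::real_normed_vector"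
  assumes ab: "a < b" and cont: "continuous_on {a..b} f" "continuous_on {a..b} g"
    and eq: "AE x in lebesgue_on {a<..<b}. f x = g x" and x: "x \<in> {a..b}"
  shows "f x = g x"
proof -
  define Z where "Z = {x \<in> {a..b}. f x - g x = 0}"
  have "{a..b} \<subseteq> Z"
  proof -
    have cl: "closed Z"
      unfolding Z_def by (intro continuous_closed_preimage_constant continuous_on_diff cont closed_atLeastAtMost)
    have "t \<in> closure Z" if t: "t \<in> {a..b}" for t
      unfolding closure_approachable
    proof (intro allI impI)
      fix e :: real assume "e > 0"
      let ?x = "max a (t - e)" and ?y = "min b (t + e)"
      have "a \<le> ?x" "?x < ?y" "?y \<le> b" using t ab \<open>e > 0\<close> by auto
      from AE_interval_point[OF eq this] obtain s where "?x < s" "s < ?y" "f s = g s" by blast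
      then show "\<exists>y\<in>Z. dist y t < e"
        using t by (intro bexI[of _ s]) (auto simp: dist_real_def Z_def)
    qed
    then show ?thesis unfolding closure_closed[OF cl] by blast
  qed
  then show ?thesis using x by (auto simp: Z_def)
qed

lemma sobolev_eq_primitive:
  fixes f :: "real \<Rightarrow> 'a::real_or_complex"
  assumes ab: "a < b" and f: "f \<in> sobolev_W12 a b" and cont: "continuous_on {a..b} f"
    and x: "x \<in> {a..b}"
  shows "f x = f a + primitive (lebesgue_on {a<..<b}) (sobolev_deriv a b f) x"
proof -
  let ?\<Lambda> = "lebesgue_on {a<..<b}" and ?p = "sobolev_deriv a b f"
  interpret interval_measure ?\<Lambda> a b by (rule interval_measure_lebesgue_on)
  note p = sobolev_deriv_integrable[OF f]
  obtain C where C: "AE x in ?\<Lambda>. f x = C + primitive ?\<Lambda> ?p x"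
    using mu_weak_deriv_imp_primitive sobolev_deriv_props(1)[OF f] weak_deriv_iff_mu_weak_deriv[OF p]
    by blast
  have "f x = C + primitive ?\<Lambda> ?p x" if "x \<in> {a..b}" for x
    using continuous_AE_eq[OF ab cont _ C that]
    by (simp add: continuous_on_add continuous_on_primitive_lebesgue[OF p])
  from this[OF x] this[of a] show ?thesis using ab by (simp add: primitive_left[OF p])
qed

lemma primitive_sobolev:
  fixes p w :: "real \<Rightarrow> 'a::real_or_complex"
  assumes p: "p \<in> L2 (lebesgue_on {a<..<b})"
    and w: "\<And>x. x \<in> {a<..<b} \<Longrightarrow> w x = C + primitive (lebesgue_on {a<..<b}) p x"
  shows "w \<in> sobolev_W12 a b"
    and "AE x in lebesgue_on {a<..<b}. sobolev_deriv a b w x = p x"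
proof -
  let ?\<Lambda> = "lebesgue_on {a<..<b}"
  interpret interval_measure ?\<Lambda> a b by (rule interval_measure_lebesgue_on)
  have ip: "integrable ?\<Lambda> p" by (rule L2_integrable[OF p])
  let ?W = "\<lambda>x. C + primitive ?\<Lambda> p x"
  have [measurable]: "?W \<in> borel_measurable ?\<Lambda>"
    using primitive_measurable[OF ip] by (intro borel_imp_measurable) measurable
  then have [measurable]: "w \<in> borel_measurable ?\<Lambda>"
    by (rule measurable_cong[THEN iffD1, rotated]) (simp add: w)
  have W2: "?W \<in> L2 ?\<Lambda>"
    unfolding L2_def
  proof (intro CollectI conjI)
    show "integrable ?\<Lambda> (\<lambda>x. (norm (?W x))\<^sup>2)"
    proof (rule integrable_const_bound[where B="(norm C + (\<integral>x. norm (p x) \<partial>?\<Lambda>))\<^sup>2"])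
      have "norm (?W x) \<le> norm C + (\<integral>x. norm (p x) \<partial>?\<Lambda>)" for x
        using norm_triangle_ineq[of C "primitive ?\<Lambda> p x"] norm_primitive_le[OF ip, of x] by linarith
      then show "AE x in ?\<Lambda>. norm ((norm (?W x))\<^sup>2) \<le> (norm C + (\<integral>x. norm (p x) \<partial>?\<Lambda>))\<^sup>2"
        by (intro AE_I2) (simp add: power_mono)
    qed measurable
  qed measurable
  have eq: "AE x in ?\<Lambda>. w x = ?W x" by (intro AE_I2) (simp add: w)
  have wd: "weak_deriv a b w p"
    unfolding weak_deriv_iff_mu_weak_deriv[OF ip] by (rule mu_weak_deriv_primitive[OF ip _ eq]) measurable
  have "w \<in> L2 ?\<Lambda>" by (rule L2_AE_cong[OF W2]) (auto simp: w)
  with wd p show W: "w \<in> sobolev_W12 a b" unfolding sobolev_W12_def by blast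
  show "AE x in ?\<Lambda>. sobolev_deriv a b w x = p x"
    by (rule weak_deriv_unique[OF sobolev_deriv_props(1)[OF W] wd])
qed

section \<open>Averaging over the gaps of a closed set\<close>

locale closed_gaps =
  fixes a b :: real and S :: "real set"
  assumes ab: "a < b" and closed_S: "closed S" and S_sub: "S \<subseteq> {a..b}"
    and a_S: "a \<in> S" and b_S: "b \<in> S"
begin

abbreviation "gaps \<equiv> components ({a..b} - S)"
abbreviation "\<Lambda> \<equiv> lebesgue_on {a<..<b}"

sublocale \<Lambda>: interval_measure \<Lambda> a b by (rule interval_measure_lebesgue_on)

lemma open_complement: "open ({a..b} - S)"
proof -
  have "{a..b} - S = {a<..<b} - S" using a_S b_S by (auto simp: order.strict_iff_order)
  then show ?thesis using closed_S by (simp add: open_Diff)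
qed

text \<open>A component is open because the complement of \<open>S\<close> is open, and an end point outside \<open>S\<close>
could be added to it, against maximality.\<close>

lemma gap_interval:
  assumes I: "I \<in> gaps"
  obtains c d where "I = {c<..<d}" "a \<le> c" "c < d" "d \<le> b" "c \<in> S" "d \<in> S"
proof -
  have op: "open I" by (rule open_components[OF open_complement I])
  have ne: "I \<noteq> {}" and sub: "I \<subseteq> {a..b} - S" and conn: "connected I"
    using in_components_nonempty[OF I] in_components_subset[OF I] in_components_connected[OF I] by auto
  have bdd: "bdd_below I" "bdd_above I"
    using sub by (auto intro!: bdd_belowI[of _ a] bdd_aboveI[of _ b])
  define c d where "c = Inf I" and "d = Sup I"
  have le: "c \<le> x" "x \<le> d" if "x \<in> I" for x
    using that bdd by (auto simp: c_def d_def intro: cInf_lower cSup_upper)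
  have c_notin: "c \<notin> I"
  proof
    assume "c \<in> I"
    then obtain e where "e > 0" "ball c e \<subseteq> I" using op by (auto simp: open_contains_ball)
    then have "c - e / 2 \<in> I" by (auto simp: dist_real_def subset_iff)
    then show False using le(1)[of "c - e / 2"] \<open>e > 0\<close> by simp
  qed
  have d_notin: "d \<notin> I"
  proof
    assume "d \<in> I"
    then obtain e where "e > 0" "ball d e \<subseteq> I" using op by (auto simp: open_contains_ball)
    then have "d + e / 2 \<in> I" by (auto simp: dist_real_def subset_iff)
    then show False using le(2)[of "d + e / 2"] \<open>e > 0\<close> by simp
  qed
  have I_eq: "I = {c<..<d}"
  proof (intro equalityI subsetI)
    fix x assume "x \<in> I"
    then have "c \<le> x" "x \<le> d" "x \<noteq> c" "x \<noteq> d" using le c_notin d_notin by auto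
    then show "x \<in> {c<..<d}" by simp
  next
    fix x assume "x \<in> {c<..<d}"
    then have "Inf I < x" "x < Sup I" by (auto simp: c_def d_def)
    then obtain y z where "y \<in> I" "y < x" "z \<in> I" "x < z"
      using cInf_less_iff[OF ne bdd(1)] less_cSup_iff[OF ne bdd(2)] by blast
    then show "x \<in> I" using conn unfolding connected_iff_interval by (meson less_imp_le)
  qed
  have cd: "c < d" using ne I_eq by auto
  have range: "a \<le> c" "d \<le> b"
    using sub ne by (auto simp: c_def d_def intro!: cInf_greatest cSup_least)
  have "c \<in> S"
  proof (rule ccontr)
    assume "c \<notin> S"
    then have "insert c I \<subseteq> {a..b} - S" using sub range cd by auto
    then have "{c..<d} \<subseteq> {a..b} - S" using I_eq by force
    moreover have "(c + d) / 2 \<in> I \<inter> {c..<d}" using I_eq cd by auto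
    then have "I \<inter> {c..<d} \<noteq> {}" by blast
    ultimately have "{c..<d} \<subseteq> I" by (intro components_maximal[OF I] connected_Ico)
    then show False using c_notin cd by auto
  qed
  moreover have "d \<in> S"
  proof (rule ccontr)
    assume "d \<notin> S"
    then have "insert d I \<subseteq> {a..b} - S" using sub range cd by auto
    then have "{c<..d} \<subseteq> {a..b} - S" using I_eq by force
    moreover have "(c + d) / 2 \<in> I \<inter> {c<..d}" using I_eq cd by auto
    then have "I \<inter> {c<..d} \<noteq> {}" by blast
    ultimately have "{c<..d} \<subseteq> I" by (intro components_maximal[OF I] connected_Ioc)
    then show False using d_notin cd by auto
  qed
  ultimately show thesis using that I_eq cd range by blast
qed

lemma countable_gaps: "countable gaps"
proof (rule countable_disjoint_open_subsets)
  show "pairwise disjnt gaps"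
    using pairwise_disjoint_components by (simp add: pairwise_def disjnt_def)
qed (use open_components[OF open_complement] in blast)

lemma gap_borel: "I \<in> gaps \<Longrightarrow> I \<in> sets borel"
  using open_components[OF open_complement] by auto

lemma gap_subset_interior: "I \<in> gaps \<Longrightarrow> I \<subseteq> {a<..<b}"
  by (elim gap_interval) auto

lemma gap_sets: "I \<in> gaps \<Longrightarrow> I \<in> sets \<Lambda>"
  using gap_borel[of I] gap_subset_interior[of I] by (auto simp: sets_restrict_space_iff)

lemma gap_of_point: "I \<in> gaps \<Longrightarrow> x \<in> I \<Longrightarrow> connected_component_set ({a..b} - S) x = I"
  by (metis components_iff connected_component_eq)

text \<open>Countable additivity over the gaps. The enumeration is padded with empty sets, as there may be only
finitely many gaps.\<close>

lemma integral_gaps_zero: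
  fixes K :: "real \<Rightarrow> 'b::{banach, second_countable_topology}"
  assumes K: "integrable \<Lambda> K"
    and zero: "\<And>I. I \<in> gaps \<Longrightarrow> (\<integral>x. indicator I x *\<^sub>R K x \<partial>\<Lambda>) = 0"
  shows "(\<integral>x. indicator ({a..b} - S) x *\<^sub>R K x \<partial>\<Lambda>) = 0"
proof -
  define A where "A i = (if i \<in> to_nat_on gaps ` gaps then from_nat_into gaps i else {})" for i
  have A: "A i = {} \<or> A i \<in> gaps" for i
    using countable_gaps by (auto simp: A_def)
  have "\<Union>gaps \<subseteq> (\<Union>i. A i)"
  proof
    fix x assume "x \<in> \<Union>gaps"
    then obtain I where I: "I \<in> gaps" "x \<in> I" by blast
    then have "A (to_nat_on gaps I) = I" using countable_gaps by (simp add: A_def)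
    then show "x \<in> (\<Union>i. A i)" using I(2) by blast
  qed
  moreover have "A i \<subseteq> \<Union>gaps" for i using A[of i] by blast
  ultimately have UA: "(\<Union>i. A i) = {a..b} - S"
    unfolding Union_components by blast
  have sets_A: "A i \<in> sets \<Lambda>" for i using A[of i] gap_sets by auto
  have "(LINT x:(\<Union>i. A i)|\<Lambda>. K x) = (\<Sum>i. (LINT x:A i|\<Lambda>. K x))"
  proof (rule lebesgue_integral_countable_add[OF sets_A])
    show "A i \<inter> A j = {}" if "i \<noteq> j" for i j
    proof (cases "i \<in> to_nat_on gaps ` gaps \<and> j \<in> to_nat_on gaps ` gaps")
      case True
      then have "A i \<noteq> A j" "A i \<in> gaps" "A j \<in> gaps"
        using that countable_gaps by (auto simp: A_def)
      then show ?thesis using components_nonoverlap by blast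
    qed (auto simp: A_def)
    show "set_integrable \<Lambda> (\<Union>i. A i) K"
      unfolding set_integrable_def using K sets_A by (intro integrable_mult_indicator) auto
  qed
  moreover have "(LINT x:A i|\<Lambda>. K x) = 0" for i
    using A[of i] zero by (auto simp: set_lebesgue_integral_def)
  ultimately show ?thesis by (simp add: UA set_lebesgue_integral_def)
qed

lemma integral_const_Ico:
  fixes m :: "'b::euclidean_space"
  assumes "a \<le> x" "x \<le> y" "y \<le> b"
  shows "(\<integral>t. indicator {x..<y} t *\<^sub>R m \<partial>\<Lambda>) = (y - x) *\<^sub>R m"
proof -
  have "((\<lambda>t. t *\<^sub>R m) has_vector_derivative m) (at t)" for t
    by (auto intro!: derivative_eq_intros)
  then have "(\<integral>t. indicator {x..<y} t *\<^sub>R m \<partial>\<Lambda>) = y *\<^sub>R m - x *\<^sub>R m"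
    using assms by (intro integral_derivative_lebesgue_on) auto
  then show ?thesis by (simp add: scaleR_diff_left)
qed

lemma integral_gap_eq_Ico:
  fixes K :: "real \<Rightarrow> 'b::{banach, second_countable_topology}"
  assumes "K \<in> borel_measurable \<Lambda>"
  shows "(\<integral>t. indicator {c<..<d} t *\<^sub>R K t \<partial>\<Lambda>) = (\<integral>t. indicator {c..<d} t *\<^sub>R K t \<partial>\<Lambda>)"
proof (rule integral_cong_AE)
  show "AE t in \<Lambda>. indicator {c<..<d} t *\<^sub>R K t = indicator {c..<d} t *\<^sub>R K t"
    using AE_lebesgue_on_neq[of c a b] by eventually_elim (auto simp: indicator_def)
qed (use assms \<Lambda>.id_measurable in measurable)

text \<open>The conditional expectation of \<open>p\<close> that keeps \<open>p\<close> on \<open>S\<close> and replaces it by its mean value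
on each gap. If \<open>p\<close> is the derivative of a function, the result is the derivative of its
interpolation by chords over the gaps.\<close>

definition gap_average :: "(real \<Rightarrow> 'a::real_or_complex) \<Rightarrow> real \<Rightarrow> 'a" where
  "gap_average p x = (if x \<in> S then p x else
     let I = connected_component_set ({a..b} - S) x
     in (1 / measure lebesgue I) *\<^sub>R (\<integral>t. indicator I t *\<^sub>R p t \<partial>\<Lambda>))"

lemma gap_average_on_gap:
  assumes I: "I \<in> gaps" and x: "x \<in> I"
  shows "gap_average p x = (1 / measure lebesgue I) *\<^sub>R (\<integral>t. indicator I t *\<^sub>R p t \<partial>\<Lambda>)"
proof -
  have "x \<notin> S" using x in_components_subset[OF I] by blast
  then show ?thesis using gap_of_point[OF I x] by (simp add: gap_average_def Let_def)
qed

lemma gap_average_on_S: "x \<in> S \<Longrightarrow> gap_average p x = p x"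
  by (simp add: gap_average_def)

lemma gap_average_measurable:
  fixes p :: "real \<Rightarrow> 'a::real_or_complex"
  assumes p: "p \<in> borel_measurable \<Lambda>"
  shows "gap_average p \<in> borel_measurable \<Lambda>"
proof (rule measurable_piecewise_restrict[of "insert S gaps"])
  show "countable (insert S gaps)" using countable_gaps by simp
  show "space \<Lambda> \<subseteq> \<Union> (insert S gaps)" by auto
  fix \<Omega> assume \<Omega>: "\<Omega> \<in> insert S gaps"
  have "S \<in> sets borel" using closed_S by simp
  then have "{a<..<b} \<inter> S \<in> sets \<Lambda>" by (auto simp: sets_restrict_space_iff)
  then show "\<Omega> \<inter> space \<Lambda> \<in> sets \<Lambda>"
    using \<Omega> gap_sets[of \<Omega>] by (auto simp: Int_commute)
  show "gap_average p \<in> borel_measurable (restrict_space \<Lambda> \<Omega>)"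
  proof (cases "\<Omega> = S")
    case True
    have "p \<in> borel_measurable (restrict_space \<Lambda> \<Omega>)" by (rule measurable_restrict_space1[OF p])
    then show ?thesis
      by (rule measurable_cong[THEN iffD1, rotated]) (simp add: space_restrict_space True gap_average_on_S)
  next
    case False
    then have I: "\<Omega> \<in> gaps" using \<Omega> by auto
    have "(\<lambda>x. (1 / measure lebesgue \<Omega>) *\<^sub>R (\<integral>t. indicator \<Omega> t *\<^sub>R p t \<partial>\<Lambda>)) \<in> borel_measurable (restrict_space \<Lambda> \<Omega>)"
      by simp
    then show ?thesis
      by (rule measurable_cong[THEN iffD1, rotated]) (simp add: space_restrict_space gap_average_on_gap[OF I])
  qed
qed

text \<open>Averaging does not increase the mean square over a gap (Jensen's inequality).\<close>

lemma gap_average_square_le: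
  fixes p :: "real \<Rightarrow> 'a::real_or_complex"
  assumes p: "p \<in> L2 \<Lambda>" and I: "I \<in> gaps"
  shows "(\<integral>\<^sup>+x. ennreal ((norm (gap_average p x))\<^sup>2) * indicator I x \<partial>\<Lambda>)
    \<le> (\<integral>\<^sup>+x. ennreal ((norm (p x))\<^sup>2) * indicator I x \<partial>\<Lambda>)"
proof -
  obtain c d where cd: "I = {c<..<d}" "a \<le> c" "c < d" "d \<le> b" using gap_interval[OF I] by blast
  have ip: "integrable \<Lambda> p" by (rule \<Lambda>.L2_integrable[OF p])
  have ip2: "integrable \<Lambda> (\<lambda>x. (norm (p x))\<^sup>2)" using p by (simp add: L2_def)
  have int_I: "integrable \<Lambda> (\<lambda>x. indicator I x *\<^sub>R f x)" if "integrable \<Lambda> f"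
    for f :: "real \<Rightarrow> 'b::{banach, second_countable_topology}"
    by (rule \<Lambda>.integrable_indicator_scaleR[OF that gap_borel[OF I]])
  have const_I: "(\<integral>x. indicator I x *\<^sub>R r \<partial>\<Lambda>) = (d - c) * r" for r :: real
    unfolding cd(1) by (subst integral_gap_eq_Ico, simp, subst integral_const_Ico) (use cd in auto)
  define m where "m = (1 / (d - c)) *\<^sub>R (\<integral>t. indicator I t *\<^sub>R p t \<partial>\<Lambda>)"
  have avg: "gap_average p x = m" if "x \<in> I" for x
    using gap_average_on_gap[OF I that, of p] cd by (simp add: m_def)
  have "norm m * (d - c) = norm (\<integral>t. indicator I t *\<^sub>R p t \<partial>\<Lambda>)"
    using cd(3) by (simp add: m_def)
  also have "\<dots> \<le> (\<integral>t. norm (indicator I t *\<^sub>R p t) \<partial>\<Lambda>)" by (rule integral_norm_bound)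
  finally have mean_le: "norm m * (d - c) \<le> (\<integral>t. indicator I t *\<^sub>R norm (p t) \<partial>\<Lambda>)" by simp
  \<comment> \<open>Integrate \<open>2 \<bar>m\<bar> \<bar>p\<bar> - \<bar>m\<bar>\<^sup>2 \<le> \<bar>p\<bar>\<^sup>2\<close> over the gap and use that \<open>\<bar>m\<bar>\<close> is at most the mean of \<open>\<bar>p\<bar>\<close>.\<close>
  have "(\<integral>t. indicator I t *\<^sub>R (2 * norm m * norm (p t) - (norm m)\<^sup>2) \<partial>\<Lambda>)
      \<le> (\<integral>t. indicator I t *\<^sub>R (norm (p t))\<^sup>2 \<partial>\<Lambda>)"
  proof (rule integral_mono)
    show "integrable \<Lambda> (\<lambda>t. indicator I t *\<^sub>R (2 * norm m * norm (p t) - (norm m)\<^sup>2))"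
      using ip by (intro int_I) auto
    show "integrable \<Lambda> (\<lambda>t. indicator I t *\<^sub>R (norm (p t))\<^sup>2)" by (intro int_I ip2)
    have "2 * norm m * norm (p t) - (norm m)\<^sup>2 \<le> (norm (p t))\<^sup>2" for t
      using sum_squares_bound[of "norm m" "norm (p t)"] by simp
    then show "indicator I t *\<^sub>R (2 * norm m * norm (p t) - (norm m)\<^sup>2) \<le> indicator I t *\<^sub>R (norm (p t))\<^sup>2" for t
      by (intro scaleR_left_mono) auto
  qed
  moreover have "(\<integral>t. indicator I t *\<^sub>R (2 * norm m * norm (p t) - (norm m)\<^sup>2) \<partial>\<Lambda>)
      = 2 * norm m * (\<integral>t. indicator I t *\<^sub>R norm (p t) \<partial>\<Lambda>) - (d - c) * (norm m)\<^sup>2"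
  proof -
    have "(\<integral>t. indicator I t *\<^sub>R (2 * norm m * norm (p t) - (norm m)\<^sup>2) \<partial>\<Lambda>)
       = (\<integral>t. 2 * norm m * (indicator I t *\<^sub>R norm (p t)) - indicator I t *\<^sub>R (norm m)\<^sup>2 \<partial>\<Lambda>)"
      by (intro Bochner_Integration.integral_cong) (auto simp: algebra_simps)
    also have "\<dots> = (\<integral>t. 2 * norm m * (indicator I t *\<^sub>R norm (p t)) \<partial>\<Lambda>) - (\<integral>t. indicator I t *\<^sub>R (norm m)\<^sup>2 \<partial>\<Lambda>)"
      using int_I[OF integrable_norm[OF ip]] int_I[of "\<lambda>_. (norm m)\<^sup>2"]
      by (intro Bochner_Integration.integral_diff) auto
    also have "\<dots> = 2 * norm m * (\<integral>t. indicator I t *\<^sub>R norm (p t) \<partial>\<Lambda>) - (d - c) * (norm m)\<^sup>2"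
      by (simp only: const_I integral_mult_right_zero)
    finally show ?thesis .
  qed
  moreover have "2 * norm m * (norm m * (d - c)) \<le> 2 * norm m * (\<integral>t. indicator I t *\<^sub>R norm (p t) \<partial>\<Lambda>)"
    using mean_le by (intro mult_left_mono) auto
  ultimately have main: "(d - c) * (norm m)\<^sup>2 \<le> (\<integral>t. indicator I t *\<^sub>R (norm (p t))\<^sup>2 \<partial>\<Lambda>)"
    by (simp add: power2_eq_square algebra_simps)
  have "(\<integral>\<^sup>+x. ennreal ((norm (gap_average p x))\<^sup>2) * indicator I x \<partial>\<Lambda>)
      = (\<integral>\<^sup>+x. ennreal (indicator I x *\<^sub>R (norm m)\<^sup>2) \<partial>\<Lambda>)"
    by (intro nn_integral_cong) (auto simp: indicator_def avg)
  also have "\<dots> = ennreal ((d - c) * (norm m)\<^sup>2)"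
    by (subst nn_integral_eq_integral) (auto simp only: const_I intro!: int_I AE_I2 scaleR_nonneg_nonneg \<Lambda>.integrable_const indicator_pos_le zero_le_power2)
  also have "\<dots> \<le> ennreal (\<integral>t. indicator I t *\<^sub>R (norm (p t))\<^sup>2 \<partial>\<Lambda>)"
    by (intro ennreal_leI main)
  also have "\<dots> = (\<integral>\<^sup>+x. ennreal (indicator I x *\<^sub>R (norm (p x))\<^sup>2) \<partial>\<Lambda>)"
    using int_I[OF ip2] by (subst nn_integral_eq_integral) auto
  also have "\<dots> = (\<integral>\<^sup>+x. ennreal ((norm (p x))\<^sup>2) * indicator I x \<partial>\<Lambda>)"
    by (intro nn_integral_cong) (auto simp: indicator_def)
  finally show ?thesis .
qed

lemma gap_average_L2:
  fixes p :: "real \<Rightarrow> 'a::real_or_complex"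
  assumes p: "p \<in> L2 \<Lambda>"
  shows "gap_average p \<in> L2 \<Lambda>"
proof -
  have [measurable]: "p \<in> borel_measurable \<Lambda>" by (rule L2_measurable[OF p])
  have [measurable]: "gap_average p \<in> borel_measurable \<Lambda>" by (rule gap_average_measurable) measurable
  define \<nu> where "\<nu> q = density \<Lambda> (\<lambda>x. ennreal ((norm (q x))\<^sup>2))" for q :: "real \<Rightarrow> 'a"
  let ?U = "{a..b} - S" and ?T = "{a<..<b} \<inter> S"
  have em: "emeasure (\<nu> q) A = (\<integral>\<^sup>+x. ennreal ((norm (q x))\<^sup>2) * indicator A x \<partial>\<Lambda>)"
    if "q \<in> borel_measurable \<Lambda>" "A \<in> sets \<Lambda>" for q A
    unfolding \<nu>_def using that by (subst emeasure_density) auto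
  have T: "?T \<in> sets \<Lambda>" using closed_S by (auto simp: sets_restrict_space_iff)
  have gU: "\<Union> (id ` gaps) = ?U" by simp
  have U: "?U \<in> sets \<Lambda>"
    using sets.countable_UN'[OF countable_gaps, of id \<Lambda>] gap_sets gU by auto
  have U_sum: "emeasure (\<nu> q) ?U = (\<integral>\<^sup>+I. emeasure (\<nu> q) I \<partial>count_space gaps)" for q
  proof -
    have "emeasure (\<nu> q) (\<Union> (id ` gaps)) = (\<integral>\<^sup>+I. emeasure (\<nu> q) (id I) \<partial>count_space gaps)"
    proof (rule emeasure_UN_countable[OF _ countable_gaps])
      show "disjoint_family_on id gaps"
        using components_nonoverlap by (auto simp: disjoint_family_on_def)
    qed (use gap_sets in \<open>auto simp: \<nu>_def\<close>)
    then show ?thesis by (simp only: gU id_apply)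
  qed
  have total: "emeasure (\<nu> q) {a<..<b} = emeasure (\<nu> q) ?T + emeasure (\<nu> q) ?U" for q
  proof -
    have "{a<..<b} = ?T \<union> ?U" using a_S b_S by (auto simp: order.strict_iff_order)
    moreover have "emeasure (\<nu> q) (?T \<union> ?U) = emeasure (\<nu> q) ?T + emeasure (\<nu> q) ?U"
      using T U by (intro plus_emeasure[symmetric]) (auto simp: \<nu>_def)
    ultimately show ?thesis by simp
  qed
  have "emeasure (\<nu> (gap_average p)) ?U \<le> emeasure (\<nu> p) ?U"
    unfolding U_sum by (intro nn_integral_mono) (simp add: em gap_sets gap_average_square_le[OF p])
  moreover have "emeasure (\<nu> (gap_average p)) ?T = emeasure (\<nu> p) ?T"
    using T by (auto simp: em gap_average_on_S indicator_def intro!: nn_integral_cong)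
  ultimately have "emeasure (\<nu> (gap_average p)) {a<..<b} \<le> emeasure (\<nu> p) {a<..<b}"
    unfolding total by (intro add_mono) auto
  moreover have space: "emeasure (\<nu> q) {a<..<b} = (\<integral>\<^sup>+x. ennreal ((norm (q x))\<^sup>2) \<partial>\<Lambda>)"
    if "q \<in> borel_measurable \<Lambda>" for q
    using that sets.top[of \<Lambda>] by (subst em) (auto intro!: nn_integral_cong)
  moreover have "(\<integral>\<^sup>+x. ennreal ((norm (p x))\<^sup>2) \<partial>\<Lambda>) < \<infinity>"
    using p by (simp add: L2_def integrable_iff_bounded)
  ultimately have "(\<integral>\<^sup>+x. ennreal ((norm (gap_average p x))\<^sup>2) \<partial>\<Lambda>) < \<infinity>"
    by simp
  then show ?thesis by (simp add: L2_def integrable_iff_bounded)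
qed

text \<open>The averaging property of conditional expectations: a factor that is constant on the gaps does not
notice the averaging.\<close>

lemma gap_average_pairing:
  fixes k p :: "real \<Rightarrow> 'a::real_or_complex"
  assumes p: "p \<in> L2 \<Lambda>"
    and kp: "integrable \<Lambda> (\<lambda>x. k x * p x)" "integrable \<Lambda> (\<lambda>x. k x * gap_average p x)"
    and const: "\<And>I. I \<in> gaps \<Longrightarrow> \<exists>c. AE x in \<Lambda>. x \<in> I \<longrightarrow> k x = c"
  shows "(\<integral>x. k x * gap_average p x \<partial>\<Lambda>) = (\<integral>x. k x * p x \<partial>\<Lambda>)"
proof -
  note ip = \<Lambda>.L2_integrable[OF p] and iq = \<Lambda>.L2_integrable[OF gap_average_L2[OF p]]
  let ?K = "\<lambda>x. k x * gap_average p x - k x * p x"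
  have K: "integrable \<Lambda> ?K" using kp by simp
  have "(\<integral>x. ?K x \<partial>\<Lambda>) = (\<integral>x. indicator ({a..b} - S) x *\<^sub>R ?K x \<partial>\<Lambda>)"
    by (intro Bochner_Integration.integral_cong) (auto simp: indicator_def gap_average_on_S)
  also have "\<dots> = 0"
  proof (rule integral_gaps_zero[OF K])
    fix I assume I: "I \<in> gaps"
    obtain c d where cd: "I = {c<..<d}" "a \<le> c" "c < d" "d \<le> b" using gap_interval[OF I] by blast
    obtain r where r: "AE x in \<Lambda>. x \<in> I \<longrightarrow> k x = r" using const[OF I] by blast
    define m where "m = (1 / (d - c)) *\<^sub>R (\<integral>t. indicator I t *\<^sub>R p t \<partial>\<Lambda>)"
    have avg: "gap_average p x = m" if "x \<in> I" for x
      using gap_average_on_gap[OF I that, of p] cd by (simp add: m_def)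
    note ind = \<Lambda>.integrable_indicator_scaleR[OF _ gap_borel[OF I]]
    have "(\<integral>x. indicator I x *\<^sub>R ?K x \<partial>\<Lambda>)
        = (\<integral>x. r * (indicator I x *\<^sub>R m) - r * (indicator I x *\<^sub>R p x) \<partial>\<Lambda>)"
    proof (rule integral_cong_AE)
      show "(\<lambda>x. indicator I x *\<^sub>R ?K x) \<in> borel_measurable \<Lambda>" using ind[OF K] by simp
      have "integrable \<Lambda> (\<lambda>x. r * (indicator I x *\<^sub>R m) - r * (indicator I x *\<^sub>R p x))"
        by (intro Bochner_Integration.integrable_diff integrable_mult_right ind ip \<Lambda>.integrable_const)
      then show "(\<lambda>x. r * (indicator I x *\<^sub>R m) - r * (indicator I x *\<^sub>R p x)) \<in> borel_measurable \<Lambda>"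
        by simp
      show "AE x in \<Lambda>. indicator I x *\<^sub>R ?K x = r * (indicator I x *\<^sub>R m) - r * (indicator I x *\<^sub>R p x)"
        using r by eventually_elim (auto simp: indicator_def avg)
    qed
    also have "\<dots> = r * (\<integral>x. indicator I x *\<^sub>R m \<partial>\<Lambda>) - r * (\<integral>x. indicator I x *\<^sub>R p x \<partial>\<Lambda>)"
      using ind[OF ip] ind[of "\<lambda>_. m"]
      by (subst Bochner_Integration.integral_diff)
         (auto simp del: mult_scaleR_right intro!: integrable_mult_right)
    also have "(\<integral>x. indicator I x *\<^sub>R m \<partial>\<Lambda>) = (d - c) *\<^sub>R m"
      unfolding cd(1) by (subst integral_gap_eq_Ico, simp, subst integral_const_Ico) (use cd in auto)
    also have "\<dots> = (\<integral>x. indicator I x *\<^sub>R p x \<partial>\<Lambda>)" using cd(3) by (simp add: m_def)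
    finally show "(\<integral>x. indicator I x *\<^sub>R ?K x \<partial>\<Lambda>) = 0" by simp
  qed
  finally show ?thesis using kp by simp
qed

text \<open>The indicator function of \<open>(-\<infinity>, x)\<close> with \<open>x\<close> in \<open>S\<close> is constant on every gap.\<close>

lemma primitive_gap_average:
  fixes p :: "real \<Rightarrow> 'a::real_or_complex"
  assumes p: "p \<in> L2 \<Lambda>" and x: "x \<in> S"
  shows "primitive \<Lambda> (gap_average p) x = primitive \<Lambda> p x"
proof -
  note ip = \<Lambda>.L2_integrable[OF p] and iq = \<Lambda>.L2_integrable[OF gap_average_L2[OF p]]
  have scale: "of_real r * z = r *\<^sub>R z" for r and z :: 'a by (simp add: scaleR_conv_of_real)
  have "(\<integral>t. of_real (indicator {..<x} t) * gap_average p t \<partial>\<Lambda>)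
      = (\<integral>t. of_real (indicator {..<x} t) * p t \<partial>\<Lambda>)"
  proof (rule gap_average_pairing[OF p])
    show "integrable \<Lambda> (\<lambda>t. of_real (indicator {..<x} t) * p t)"
      unfolding scale by (intro \<Lambda>.integrable_indicator_scaleR ip) simp
    show "integrable \<Lambda> (\<lambda>t. of_real (indicator {..<x} t) * gap_average p t)"
      unfolding scale by (intro \<Lambda>.integrable_indicator_scaleR iq) simp
    fix I assume I: "I \<in> gaps"
    obtain c d where cd: "I = {c<..<d}" using gap_interval[OF I] by blast
    have "x \<notin> I" using x in_components_subset[OF I] by blast
    then have "d \<le> x \<or> x \<le> c" using cd by auto
    then have "\<exists>r::'a. \<forall>t\<in>I. of_real (indicator {..<x} t) = r"
      using cd by (intro exI[of _ "if d \<le> x then 1 else 0"]) (auto simp: indicator_def)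
    then show "\<exists>r::'a. AE t in \<Lambda>. t \<in> I \<longrightarrow> of_real (indicator {..<x} t) = r" by auto
  qed
  then show ?thesis by (simp add: primitive_def scale)
qed

lemma primitive_gap_average_affine:
  fixes p :: "real \<Rightarrow> 'a::real_or_complex"
  assumes p: "p \<in> L2 \<Lambda>" and I: "I \<in> gaps"
  shows "\<exists>r s. \<forall>x\<in>I. C + primitive \<Lambda> (gap_average p) x = r + of_real x * s"
proof -
  note iq = \<Lambda>.L2_integrable[OF gap_average_L2[OF p]]
  obtain c d where cd: "I = {c<..<d}" "a \<le> c" "c < d" "d \<le> b" using gap_interval[OF I] by blast
  define m where "m = (1 / measure lebesgue I) *\<^sub>R (\<integral>t. indicator I t *\<^sub>R p t \<partial>\<Lambda>)"
  have avg: "gap_average p x = m" if "x \<in> I" for x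
    using gap_average_on_gap[OF I that, of p] by (simp add: m_def)
  show ?thesis
  proof (intro exI ballI)
    fix x assume x: "x \<in> I"
    have "primitive \<Lambda> (gap_average p) x - primitive \<Lambda> (gap_average p) c
        = (\<integral>t. indicator {c..<x} t *\<^sub>R gap_average p t \<partial>\<Lambda>)"
      using x cd by (intro \<Lambda>.primitive_diff iq) auto
    also have "\<dots> = (\<integral>t. indicator {c..<x} t *\<^sub>R m \<partial>\<Lambda>)"
    proof (rule integral_cong_AE)
      show "AE t in \<Lambda>. indicator {c..<x} t *\<^sub>R gap_average p t = indicator {c..<x} t *\<^sub>R m"
        using AE_lebesgue_on_neq[of c a b]
        by eventually_elim (use x cd(1) in \<open>auto simp: indicator_def avg\<close>)
    qed (use \<Lambda>.integrable_indicator_scaleR[OF iq, of "{c..<x}"]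
        \<Lambda>.integrable_indicator_scaleR[OF \<Lambda>.integrable_const, of "{c..<x}" m] in auto)
    also have "\<dots> = (x - c) *\<^sub>R m" using x cd by (intro integral_const_Ico) auto
    finally show "C + primitive \<Lambda> (gap_average p) x
        = (C + primitive \<Lambda> (gap_average p) c - c *\<^sub>R m) + of_real x * m"
      by (simp add: algebra_simps scaleR_conv_of_real)
  qed
qed

text \<open>A function that is affine on a gap has equal increments there with its constant slope, so the
difference of its derivative and this slope integrates to zero over all subintervals.\<close>

lemma derivative_const_on_gap:
  fixes u q :: "real \<Rightarrow> 'a::real_or_complex"
  assumes q: "integrable \<Lambda> q" and u: "\<And>x. x \<in> {a..b} \<Longrightarrow> u x = C + primitive \<Lambda> q x"
    and I: "I \<in> gaps" and affine: "\<And>x. x \<in> I \<Longrightarrow> u x = r + of_real x * s"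
  shows "AE x in \<Lambda>. x \<in> I \<longrightarrow> q x = s"
proof -
  obtain c d where cd: "I = {c<..<d}" "a \<le> c" "c < d" "d \<le> b" using gap_interval[OF I] by blast
  have cont: "continuous_on {c..d} u"
  proof (rule continuous_on_eq)
    show "continuous_on {c..d} (\<lambda>x. C + primitive \<Lambda> q x)"
      by (intro continuous_intros continuous_on_primitive_lebesgue q)
  qed (use u cd in auto)
  have u_cd: "u x = r + of_real x * s" if "x \<in> {c..d}" for x
  proof (rule continuous_AE_eq[OF cd(3) cont _ _ that])
    show "continuous_on {c..d} (\<lambda>x. r + of_real x * s)" by (intro continuous_intros)
    show "AE x in lebesgue_on {c<..<d}. u x = r + of_real x * s"
      using affine cd(1) by (intro AE_I2) auto
  qed
  let ?f = "\<lambda>x. indicator I x *\<^sub>R (q x - s)"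
  have qs: "integrable \<Lambda> (\<lambda>x. q x - s)" using q by simp
  have f: "integrable \<Lambda> ?f" by (rule \<Lambda>.integrable_indicator_scaleR[OF qs gap_borel[OF I]])
  have "AE x in \<Lambda>. ?f x = 0"
  proof (rule \<Lambda>.AE_zero_if_interval_integrals_zero[OF f])
    fix c' d' :: real
    let ?c = "max c c'" and ?d = "min d d'"
    have eq: "(\<integral>x. indicator {c'<..<d'} x *\<^sub>R ?f x \<partial>\<Lambda>) = (\<integral>x. indicator {?c<..<?d} x *\<^sub>R (q x - s) \<partial>\<Lambda>)"
      using cd(1) by (intro Bochner_Integration.integral_cong) (auto simp: indicator_def)
    show "(\<integral>x. indicator {c'<..<d'} x *\<^sub>R ?f x \<partial>\<Lambda>) = 0"
    proof (cases "?c \<le> ?d")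
      case True
      have "(\<integral>x. indicator {?c<..<?d} x *\<^sub>R (q x - s) \<partial>\<Lambda>) = (\<integral>x. indicator {?c..<?d} x *\<^sub>R q x - indicator {?c..<?d} x *\<^sub>R s \<partial>\<Lambda>)"
        unfolding integral_gap_eq_Ico[OF borel_measurable_integrable[OF qs]] by (simp add: scaleR_diff_right)
      also have "\<dots> = (\<integral>x. indicator {?c..<?d} x *\<^sub>R q x \<partial>\<Lambda>) - (\<integral>x. indicator {?c..<?d} x *\<^sub>R s \<partial>\<Lambda>)"
        by (intro Bochner_Integration.integral_diff \<Lambda>.integrable_indicator_scaleR q \<Lambda>.integrable_const) simp_all
      also have "\<dots> = (u ?d - u ?c) - (?d - ?c) *\<^sub>R s"
      proof -
        have mem: "?c \<in> {a..b}" "?d \<in> {a..b}" using True cd by auto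
        have "(\<integral>x. indicator {?c..<?d} x *\<^sub>R q x \<partial>\<Lambda>) = u ?d - u ?c"
          using \<Lambda>.primitive_diff[OF q True] u[OF mem(1)] u[OF mem(2)] by simp
        then show ?thesis using integral_const_Ico[of ?c ?d s] mem True by simp
      qed
      also have "\<dots> = 0"
      proof -
        have "?c \<in> {c..d}" "?d \<in> {c..d}" using True cd by auto
        then show ?thesis
          using u_cd[of ?c] u_cd[of ?d] by (simp only:) (simp add: scaleR_conv_of_real algebra_simps)
      qed
      finally show ?thesis using eq by simp
    next
      case False
      then have "{?c<..<?d} = {}" by auto
      then show ?thesis using eq by simp
    qed
  qed
  then show ?thesis by eventually_elim (auto simp: indicator_def)
qed

end

section \<open>The map \<open>\<iota>\<close> on an edge\<close>

locale edge_measure = finite_measure M for M :: "real measure" +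
  fixes a b :: real
  assumes ab: "a < b" and sets_M: "sets M = sets (restrict_space borel {a..b})"
    and a_spt: "a \<in> spt M" and b_spt: "b \<in> spt M" and null_ends: "emeasure M {a, b} = 0"
begin

lemma space_M: "space M = {a..b}"
  using sets_eq_imp_space_eq[OF sets_M] by (simp add: space_restrict_space)

lemma borel_inter_sets: "A \<in> sets borel \<Longrightarrow> A \<inter> {a..b} \<in> sets M"
  by (auto simp: sets_M sets_restrict_space)

sublocale interval_measure M a b
proof
  show "(\<lambda>x. x) \<in> M \<rightarrow>\<^sub>M borel"
    by (subst measurable_cong_sets[OF sets_M refl]) (intro measurable_restrict_space1, simp)
  show "AE x in M. a < x \<and> x < b"
  proof -
    have "{a, b} \<in> sets M" using borel_inter_sets[of "{a, b}"] ab by (auto simp: Int_absorb2)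
    then have "AE x in M. x \<notin> {a, b}" using null_ends by (intro AE_not_in) (auto simp: null_sets_def)
    with AE_space show ?thesis by eventually_elim (auto simp: space_M)
  qed
  show "\<exists>B\<in>sets borel. AE x in M. x \<in> A \<longleftrightarrow> x \<in> B" if "A \<in> sets M" for A
    using that by (intro bexI[of _ A]) (auto simp: sets_M sets_restrict_space)
qed

lemma spt_subset: "spt M \<subseteq> {a..b}"
  by (auto simp: spt_def space_M)

lemma closed_spt: "closed (spt M)"
  unfolding closed_def
proof (rule Topological_Spaces.openI)
  fix x assume x: "x \<in> - spt M"
  show "\<exists>T. open T \<and> x \<in> T \<and> T \<subseteq> - spt M"
  proof (cases "x \<in> {a..b}")
    case True
    then obtain U where "open U" "x \<in> U" "\<not> 0 < emeasure M (U \<inter> space M)"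
      using x by (auto simp: spt_def space_M)
    then show ?thesis by (intro exI[of _ U]) (auto simp: spt_def)
  next
    case False
    then show ?thesis using spt_subset by (intro exI[of _ "- {a..b}"]) auto
  qed
qed

text \<open>The complement of the support is a union of open null sets, and countably many of these suffice by the
Lindelof property.\<close>

lemma AE_in_spt: "AE x in M. x \<in> spt M"
proof -
  define \<U> where "\<U> = {U. open U \<and> emeasure M (U \<inter> space M) = 0}"
  have "\<And>U. U \<in> \<U> \<Longrightarrow> open U" by (simp add: \<U>_def)
  then obtain \<V> where \<V>: "\<V> \<subseteq> \<U>" "countable \<V>" "\<Union>\<V> = \<Union>\<U>" by (rule Lindelof)
  have "AE x in M. \<forall>U\<in>\<V>. x \<notin> U \<inter> space M"
  proof (subst AE_ball_countable[OF \<V>(2)], intro ballI AE_not_in)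
    fix U assume "U \<in> \<V>"
    then have "open U" "emeasure M (U \<inter> space M) = 0" using \<V>(1) by (auto simp: \<U>_def)
    then show "U \<inter> space M \<in> null_sets M"
      using borel_inter_sets[of U] by (auto simp: null_sets_def space_M)
  qed
  with AE_space show ?thesis
  proof eventually_elim
    case (elim x)
    then have "x \<notin> \<Union>\<U>" using \<V>(3) by auto
    then show ?case using elim by (auto simp: spt_def \<U>_def zero_less_iff_neq_zero)
  qed
qed

lemma continuous_eq_on_spt:
  fixes f g :: "real \<Rightarrow> 'b::real_normed_vector"
  assumes cont: "continuous_on {a..b} f" "continuous_on {a..b} g"
    and eq: "AE x in M. f x = g x" and x: "x \<in> spt M"
  shows "f x = g x"
proof (rule ccontr)
  assume ne: "f x \<noteq> g x"
  have "continuous_on {a..b} (\<lambda>x. f x - g x)" by (intro continuous_on_diff cont)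
  moreover have "open (- {0::'b})" by (intro open_Compl closed_singleton)
  ultimately obtain U where U: "open U" "U \<inter> {a..b} = (\<lambda>x. f x - g x) -` (- {0}) \<inter> {a..b}"
    unfolding continuous_on_open_invariant by metis
  have "x \<in> U" using ne x spt_subset U(2) by auto
  then have "emeasure M (U \<inter> {a..b}) > 0" using x U(1) by (auto simp: spt_def space_M)
  moreover have "AE x in M. x \<notin> U \<inter> {a..b}"
    using eq by eventually_elim (use U(2) in auto)
  then have "emeasure M (U \<inter> {a..b}) = 0"
    using borel_inter_sets[of U] U(1) by (subst (asm) AE_iff_null_sets[symmetric]) auto
  ultimately show False by simp
qed

sublocale closed_gaps a b "spt M"
  by unfold_locales (use ab closed_spt spt_subset a_spt b_spt in auto)

lemma continuous_L2:
  fixes f :: "real \<Rightarrow> 'a::real_or_complex"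
  assumes "continuous_on {a..b} f"
  shows "f \<in> L2 M"
proof -
  have [measurable]: "f \<in> borel_measurable M"
    by (subst measurable_cong_sets[OF sets_M refl]) (rule borel_measurable_continuous_on_restrict[OF assms])
  have "bounded (f ` {a..b})"
    by (intro compact_imp_bounded compact_continuous_image assms compact_Icc)
  then obtain B where B: "\<And>x. x \<in> {a..b} \<Longrightarrow> norm (f x) \<le> B" unfolding bounded_pos by blast
  have "integrable M (\<lambda>x. (norm (f x))\<^sup>2)"
    by (rule integrable_const_bound[where B="B\<^sup>2"]) (auto intro!: AE_I2 power_mono B simp: space_M)
  then show ?thesis by (simp add: L2_def)
qed

lemma C_mu_continuous: "f \<in> C_mu a b M \<Longrightarrow> continuous_on {a..b} f"
  by (simp add: C_mu_def)

text \<open>On a gap both functions are affine, and they agree at its end points, which belong to the support.\<close>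

lemma C_mu_eqI:
  fixes f g :: "real \<Rightarrow> 'a::real_or_complex"
  assumes f: "f \<in> C_mu a b M" and g: "g \<in> C_mu a b M"
    and eq: "\<And>x. x \<in> spt M \<Longrightarrow> f x = g x" and x: "x \<in> {a..b}"
  shows "f x = g x"
proof (cases "x \<in> spt M")
  case False
  then have "x \<in> \<Union>gaps" using x by simp
  then obtain I where I: "I \<in> gaps" "x \<in> I" by blast
  obtain c d where cd: "I = {c<..<d}" "a \<le> c" "c < d" "d \<le> b" "c \<in> spt M" "d \<in> spt M"
    using gap_interval[OF I(1)] by blast
  obtain r s r' s' where rs: "\<forall>x\<in>I. f x = r + of_real x * s" "\<forall>x\<in>I. g x = r' + of_real x * s'"
    using f g I(1) unfolding C_mu_def by blast
  have sub: "{c..d} \<subseteq> {a..b}" using cd by auto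
  have affine: "h y = r + of_real y * s"
    if "continuous_on {a..b} h" "\<forall>x\<in>I. h x = r + of_real x * s" "y \<in> {c..d}"
    for h :: "real \<Rightarrow> 'a" and r s y
  proof (rule continuous_AE_eq[OF cd(3) continuous_on_subset[OF that(1) sub] _ _ that(3)])
    show "continuous_on {c..d} (\<lambda>x. r + of_real x * s)" by (intro continuous_intros)
    show "AE x in lebesgue_on {c<..<d}. h x = r + of_real x * s"
      using that(2) cd(1) by (intro AE_I2) auto
  qed
  have "r + of_real y * s = r' + of_real y * s'" if "y \<in> {c, d}" for y
    using that eq cd(3,5,6) affine[OF C_mu_continuous[OF f] rs(1), of y] affine[OF C_mu_continuous[OF g] rs(2), of y]
    by auto
  then have e: "r + of_real c * s = r' + of_real c * s'" "r + of_real d * s = r' + of_real d * s'" by auto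
  have "(r + of_real d * s) - (r + of_real c * s) = (r' + of_real d * s') - (r' + of_real c * s')"
    by (simp only: e)
  then have "of_real (d - c) * s = of_real (d - c) * s'" by (simp add: algebra_simps)
  then have "s = s'" using cd(3) by simp
  then show ?thesis using e rs I(2) by simp
qed (use eq in simp)

text \<open>Integrating the averaged derivative replaces \<open>f\<close> by its chords over the gaps of the support
without changing it on the support. This yields the existence of \<open>\<iota>\<close>.\<close>

lemma exists_W12_mu:
  fixes f :: "real \<Rightarrow> 'a::real_or_complex"
  assumes f: "f \<in> sobolev_W12 a b" "continuous_on {a..b} f"
  defines "g \<equiv> \<lambda>x. f a + primitive \<Lambda> (gap_average (sobolev_deriv a b f)) x"
  shows "g \<in> W12_mu a b M" and "\<And>x. x \<in> spt M \<Longrightarrow> g x = f x"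
    and "AE x in \<Lambda>. sobolev_deriv a b g x = gap_average (sobolev_deriv a b f) x"
proof -
  note p = sobolev_deriv_props(2)[OF f(1)]
  note q = gap_average_L2[OF p]
  show sp: "g x = f x" if "x \<in> spt M" for x
    using that spt_subset sobolev_eq_primitive[OF ab f, of x] primitive_gap_average[OF p that]
    by (auto simp: g_def)
  show "AE x in \<Lambda>. sobolev_deriv a b g x = gap_average (sobolev_deriv a b f) x"
    by (rule primitive_sobolev(2)[OF q]) (auto simp: g_def)
  have "g \<in> sobolev_W12 a b" by (rule primitive_sobolev(1)[OF q]) (auto simp: g_def)
  moreover have "g \<in> C_mu a b M"
    unfolding C_mu_def g_def using \<Lambda>.L2_integrable[OF q]
    by (auto intro!: continuous_intros continuous_on_primitive_lebesgue primitive_gap_average_affine[OF p])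
  ultimately show "g \<in> W12_mu a b M" by (simp add: W12_mu_def)
qed

lemma iota_edge_props:
  fixes f :: "real \<Rightarrow> 'a::real_or_complex"
  assumes f: "f \<in> dom_iota_edge a b M"
  shows "iota_edge a b M f \<in> W12_mu a b M" and "AE x in M. iota_edge a b M f x = f x"
proof -
  obtain g where g: "g \<in> sobolev_W12 a b" "continuous_on {a..b} g" "AE x in M. g x = f x"
    using f by (auto simp: dom_iota_edge_def)
  obtain h where h: "h \<in> W12_mu a b M" "\<And>x. x \<in> spt M \<Longrightarrow> h x = g x"
    using exists_W12_mu[OF g(1,2)] by blast
  have "AE x in M. h x = f x"
    using AE_in_spt g(3) by eventually_elim (simp add: h(2))
  with h(1) have "\<exists>h. h \<in> W12_mu a b M \<and> (AE x in M. h x = f x)" by blast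
  from someI_ex[OF this]
  show "iota_edge a b M f \<in> W12_mu a b M" "AE x in M. iota_edge a b M f x = f x"
    by (auto simp: iota_edge_def)
qed

lemma W12_mu_imp_dom_iota:
  fixes g :: "real \<Rightarrow> 'a::real_or_complex"
  assumes "g \<in> W12_mu a b M"
  shows "g \<in> dom_iota_edge a b M"
  using assms continuous_L2[OF C_mu_continuous] unfolding dom_iota_edge_def W12_mu_def
  by (auto intro!: exI[of _ g] C_mu_continuous)

lemma iota_edge_W12_mu:
  fixes g :: "real \<Rightarrow> 'a::real_or_complex"
  assumes g: "g \<in> W12_mu a b M" and x: "x \<in> {a..b}"
  shows "iota_edge a b M g x = g x"
proof -
  note i = iota_edge_props[OF W12_mu_imp_dom_iota[OF g]]
  have C: "iota_edge a b M g \<in> C_mu a b M" "g \<in> C_mu a b M" using i(1) g by (auto simp: W12_mu_def)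
  show ?thesis
    by (rule C_mu_eqI[OF C _ x]) (intro continuous_eq_on_spt[OF _ _ i(2)] C_mu_continuous C)
qed

lemma sobolev_deriv_cong:
  fixes f g :: "real \<Rightarrow> 'a::real_or_complex"
  assumes f: "f \<in> sobolev_W12 a b" and g: "g \<in> sobolev_W12 a b"
    and cont: "continuous_on {a..b} f" and eq: "\<And>x. x \<in> {a..b} \<Longrightarrow> f x = g x"
  shows "AE x in \<Lambda>. sobolev_deriv a b f x = sobolev_deriv a b g x"
proof -
  have cont_g: "continuous_on {a..b} g" using cont eq by (rule continuous_on_eq)
  have "AE x in \<Lambda>. sobolev_deriv a b f x = sobolev_deriv a b g x"
  proof (rule primitive_sobolev(2)[OF sobolev_deriv_props(2)[OF g]])
    fix x assume "x \<in> {a<..<b}"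
    then show "f x = g a + primitive \<Lambda> (sobolev_deriv a b g) x"
      using sobolev_eq_primitive[OF ab g cont_g, of x] eq by auto
  qed
  then show ?thesis .
qed

text \<open>The function \<open>\<iota>\<phi>\<close> has slope equal to the gap average of \<open>\<phi>'\<close>. As the derivative of
  a function in the range of \<open>\<iota>\<close> is constant on the gaps, averaging is invisible here.\<close>

lemma test_function_iota:
  fixes \<phi> u :: "real \<Rightarrow> 'a::real_or_complex"
  assumes \<phi>: "\<phi> \<in> test_functions a b" and u: "u \<in> W12_mu a b M"
  obtains w where "w \<in> W12_mu a b M" "w a = 0" "w b = 0" "AE x in M. w x = \<phi> x"
    "\<forall>w'\<in>sobolev_W12 a b. (\<forall>x\<in>{a..b}. w' x = w x) \<longrightarrow>
      (\<integral>x. sobolev_deriv a b u x * conjg (sobolev_deriv a b w' x) \<partial>\<Lambda>)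
      = (\<integral>x. sobolev_deriv a b u x * conjg (vector_derivative \<phi> (at x)) \<partial>\<Lambda>)"
proof -
  let ?D = "\<lambda>x. vector_derivative \<phi> (at x)" and ?u' = "sobolev_deriv a b u"
  have D_cont: "continuous_on A ?D" for A by (rule test_functions_continuous[OF test_functions_derivative[OF \<phi>]])
  have D: "?D \<in> L2 \<Lambda>"
  proof -
    obtain B where B: "\<And>x. norm (?D x) \<le> B" using test_functions_bounded[OF test_functions_derivative[OF \<phi>]] by blast
    have [measurable]: "?D \<in> borel_measurable \<Lambda>"
      by (intro \<Lambda>.borel_imp_measurable borel_measurable_continuous_onI D_cont)
    have "integrable \<Lambda> (\<lambda>x. (norm (?D x))\<^sup>2)"
      by (rule \<Lambda>.integrable_const_bound[where B="B\<^sup>2"]) (auto intro!: AE_I2 power_mono B)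
    then show ?thesis by (simp add: L2_def)
  qed
  have \<phi>_prim: "\<phi> x = 0 + primitive \<Lambda> ?D x" if "x \<in> {a..b}" for x
    using test_function_eq_primitive[OF \<phi> that] by simp
  have \<phi>W: "\<phi> \<in> sobolev_W12 a b" and \<phi>D: "AE x in \<Lambda>. sobolev_deriv a b \<phi> x = ?D x"
    using primitive_sobolev[OF D, of \<phi> 0] \<phi>_prim by auto
  define w where "w x = \<phi> a + primitive \<Lambda> (gap_average (sobolev_deriv a b \<phi>)) x" for x
  note ex = exists_W12_mu[OF \<phi>W test_functions_continuous[OF \<phi>], folded w_def]
  have uW: "u \<in> sobolev_W12 a b" and uC: "u \<in> C_mu a b M" using u by (auto simp: W12_mu_def)
  note u' = sobolev_deriv_props(2)[OF uW] and \<phi>' = sobolev_deriv_props(2)[OF \<phi>W]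
  have u'_const: "\<exists>c. AE x in \<Lambda>. x \<in> I \<longrightarrow> conjg (?u' x) = c" if I: "I \<in> gaps" for I
  proof -
    obtain r s where rs: "\<forall>x\<in>I. u x = r + of_real x * s" using uC I unfolding C_mu_def by blast
    have "AE x in \<Lambda>. x \<in> I \<longrightarrow> ?u' x = s"
      by (rule derivative_const_on_gap[OF sobolev_deriv_integrable[OF uW]
          sobolev_eq_primitive[OF ab uW C_mu_continuous[OF uC]] I]) (use rs in auto)
    then have "AE x in \<Lambda>. x \<in> I \<longrightarrow> conjg (?u' x) = conjg s" by eventually_elim auto
    then show ?thesis by blast
  qed
  have pair: "(\<integral>x. ?u' x * conjg (gap_average (sobolev_deriv a b \<phi>) x) \<partial>\<Lambda>)
      = (\<integral>x. ?u' x * conjg (sobolev_deriv a b \<phi> x) \<partial>\<Lambda>)"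
  proof -
    have int: "integrable \<Lambda> (\<lambda>x. conjg (?u' x) * p x)" if p: "p \<in> L2 \<Lambda>" for p
      using L2_mult_conjg_integrable[OF p u'] by (simp add: mult.commute)
    have conj: "(\<integral>x. ?u' x * conjg (p x) \<partial>\<Lambda>) = conjg (\<integral>x. conjg (?u' x) * p x \<partial>\<Lambda>)"
      if p: "p \<in> L2 \<Lambda>" for p
      using integral_conjg[OF int[OF p]] by (simp add: conjg_mult)
    show ?thesis
      unfolding conj[OF gap_average_L2[OF \<phi>']] conj[OF \<phi>']
      using gap_average_pairing[OF \<phi>' int[OF \<phi>'] int[OF gap_average_L2[OF \<phi>']] u'_const] by simp
  qed
  show thesis
  proof (rule that[of w])
    show "w \<in> W12_mu a b M" by (rule ex(1))
    show "w a = 0" "w b = 0"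
      using ex(2)[OF a_spt] ex(2)[OF b_spt] test_functions_zero_outside[OF \<phi>] by auto
    show "AE x in M. w x = \<phi> x" using AE_in_spt by eventually_elim (rule ex(2))
    have "(\<integral>x. ?u' x * conjg (sobolev_deriv a b w' x) \<partial>\<Lambda>) = (\<integral>x. ?u' x * conjg (?D x) \<partial>\<Lambda>)"
      if w': "w' \<in> sobolev_W12 a b" "\<And>x. x \<in> {a..b} \<Longrightarrow> w' x = w x" for w'
    proof -
      have wW: "w \<in> sobolev_W12 a b" "continuous_on {a..b} w"
        using ex(1) C_mu_continuous by (auto simp: W12_mu_def)
      have "(\<integral>x. ?u' x * conjg (sobolev_deriv a b w' x) \<partial>\<Lambda>)
          = (\<integral>x. ?u' x * conjg (gap_average (sobolev_deriv a b \<phi>) x) \<partial>\<Lambda>)"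
      proof (rule integral_cong_AE)
        have "AE x in \<Lambda>. sobolev_deriv a b w x = sobolev_deriv a b w' x"
          by (rule sobolev_deriv_cong[OF wW(1) w'(1) wW(2)]) (simp add: w'(2))
        then show "AE x in \<Lambda>. ?u' x * conjg (sobolev_deriv a b w' x)
            = ?u' x * conjg (gap_average (sobolev_deriv a b \<phi>) x)"
          using ex(3) by eventually_elim simp
      qed (use L2_mult_conjg_integrable[OF u' sobolev_deriv_props(2)[OF w'(1)]]
          L2_mult_conjg_integrable[OF u' gap_average_L2[OF \<phi>']] in auto)
      also have "\<dots> = (\<integral>x. ?u' x * conjg (sobolev_deriv a b \<phi> x) \<partial>\<Lambda>)" by (rule pair)
      also have "\<dots> = (\<integral>x. ?u' x * conjg (?D x) \<partial>\<Lambda>)"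
      proof (rule integral_cong_AE)
        show "AE x in \<Lambda>. ?u' x * conjg (sobolev_deriv a b \<phi> x) = ?u' x * conjg (?D x)"
          using \<phi>D by eventually_elim simp
      qed (use L2_mult_conjg_integrable[OF u' \<phi>'] L2_mult_conjg_integrable[OF u' D] in auto)
      finally show ?thesis .
    qed
    then show "\<forall>w'\<in>sobolev_W12 a b. (\<forall>x\<in>{a..b}. w' x = w x) \<longrightarrow>
        (\<integral>x. ?u' x * conjg (sobolev_deriv a b w' x) \<partial>\<Lambda>) = (\<integral>x. ?u' x * conjg (?D x) \<partial>\<Lambda>)" by blast
  qed
qed

text \<open>A function that is affine on the whole interval is affine on the gaps of every support. This
is what makes all boundary values available.\<close>

lemma affine_W12_mu:
  fixes s t :: "'a::real_or_complex"
  obtains w where "w \<in> W12_mu a b M" "w a = s" "w b = t"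
proof -
  define m where "m = (1 / (b - a)) *\<^sub>R (t - s)"
  define w where "w x = s + of_real (x - a) * m" for x
  have const: "(\<lambda>x. m) \<in> L2 \<Lambda>" by (simp add: L2_def)
  have "w \<in> sobolev_W12 a b"
  proof (rule primitive_sobolev(1)[OF const])
    fix x assume x: "x \<in> {a<..<b}"
    have "primitive \<Lambda> (\<lambda>x. m) x - primitive \<Lambda> (\<lambda>x. m) a = (x - a) *\<^sub>R m"
      using x by (subst \<Lambda>.primitive_diff) (auto simp: integral_const_Ico simp del: integral_scaleR_left integral_indicator)
    then show "w x = s + primitive \<Lambda> (\<lambda>x. m) x"
      by (simp add: \<Lambda>.primitive_left w_def scaleR_conv_of_real)
  qed
  moreover have "w \<in> C_mu a b M"
    unfolding C_mu_def
  proof (intro CollectI conjI ballI)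
    show "continuous_on {a..b} w" unfolding w_def by (intro continuous_intros)
    show "\<exists>c d. \<forall>x\<in>I. w x = c + of_real x * d" for I
      by (intro exI[of _ "s - of_real a * m"] exI[of _ m]) (auto simp: w_def algebra_simps)
  qed
  ultimately have "w \<in> W12_mu a b M" by (simp add: W12_mu_def)
  moreover have "w b = t"
  proof -
    have "of_real (b - a) * m = (b - a) *\<^sub>R m" by (simp only: scaleR_conv_of_real)
    also have "\<dots> = t - s" using ab by (simp add: m_def)
    finally show ?thesis by (simp add: w_def)
  qed
  moreover have "w a = s" by (simp add: w_def)
  ultimately show thesis using that by blast
qed

end

section \<open>The space of boundary values\<close>

lemma binner_add_left: "binner G (\<xi> + \<eta>) \<zeta> = binner G \<xi> \<zeta> + binner G \<eta> \<zeta>"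
  by (simp add: binner_def distrib_right sum.distrib)

lemma binner_diff_left: "binner G (\<xi> - \<eta>) \<zeta> = binner G \<xi> \<zeta> - binner G \<eta> \<zeta>"
  by (simp add: binner_def left_diff_distrib sum_subtractf)

lemma binner_add_right: "binner G \<xi> (\<eta> + \<zeta>) = binner G \<xi> \<eta> + binner G \<xi> \<zeta>"
  by (simp add: binner_def distrib_left distrib_right sum.distrib conjg_add)

lemma binner_diff_right: "binner G \<xi> (\<eta> - \<zeta>) = binner G \<xi> \<eta> - binner G \<xi> \<zeta>"
  by (simp add: binner_def right_diff_distrib left_diff_distrib sum_subtractf conjg_diff)

lemma binner_scale_left: "binner G (coord_scale c \<xi>) \<eta> = c * binner G \<xi> \<eta>"
  by (simp add: binner_def coord_scale_def sum_distrib_left distrib_left mult.assoc)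

lemma binner_scale_right: "binner G \<xi> (coord_scale c \<eta>) = conjg c * binner G \<xi> \<eta>"
  by (simp add: binner_def coord_scale_def sum_distrib_left distrib_left conjg_mult ac_simps)

lemma binner_zero_right: "binner G \<xi> 0 = 0"
  by (simp add: binner_def)

lemma sum_pointwise: "(\<Sum>i\<in>I. f i) x = (\<Sum>i\<in>I. f i x)"
  by (induction I rule: infinite_finite_induct) auto

lemma binner_sum_right: "binner G \<xi> (\<Sum>i\<in>I. \<eta> i) = (\<Sum>i\<in>I. binner G \<xi> (\<eta> i))"
  by (induction I rule: infinite_finite_induct)
     (simp_all only: binner_add_right binner_zero_right sum.infinite sum.empty sum.insert not_False_eq_True)

lemma V1_weight_pos:
  assumes "valid_graph G" "v \<in> V1 G"
  shows "0 < weight G v"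
  using assms by (auto simp: valid_graph_def V1_def V0_def less_le)

lemma finite_E1: "valid_graph G \<Longrightarrow> finite (E1 G)"
  by (simp add: valid_graph_def E1_def)

lemma finite_V1: "valid_graph G \<Longrightarrow> finite (V1 G)"
  by (simp add: valid_graph_def V1_def)

lemma finite_E1': "valid_graph G \<Longrightarrow> finite (E1' G)"
  by (simp add: E1'_def finite_E1)

lemma finite_bindex: "valid_graph G \<Longrightarrow> finite (bindex G)"
  by (simp add: bindex_def finite_E1' finite_V1)

lemma binner_self_eq_zero:
  fixes \<xi> :: "('v, 'e) bidx \<Rightarrow> 'a::real_or_complex"
  assumes G: "valid_graph G" and \<xi>: "\<xi> \<in> coord_space (bindex G)" and zero: "binner G \<xi> \<xi> = 0"
  shows "\<xi> = 0"
proof -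
  let ?A = "\<Sum>p\<in>E1' G. (norm (\<xi> (Inl p)))\<^sup>2" and ?B = "\<Sum>v\<in>V1 G. (norm (\<xi> (Inr v)))\<^sup>2 * weight G v"
  have "binner G \<xi> \<xi> = (of_real (?A + ?B) :: 'a)"
    by (simp add: binner_def conjg_mult_self)
  then have "(of_real (?A + ?B) :: 'a) = 0" using zero by simp
  then have "?A + ?B = 0" by (simp only: of_real_eq_0_iff)
  moreover have A: "0 \<le> ?A" by (intro sum_nonneg) simp
  moreover have B: "0 \<le> ?B" using V1_weight_pos[OF G] by (intro sum_nonneg) (simp add: less_imp_le)
  ultimately have "?A = 0" "?B = 0" by auto
  then have "\<forall>p\<in>E1' G. \<xi> (Inl p) = 0" "\<forall>v\<in>V1 G. \<xi> (Inr v) = 0"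
    using V1_weight_pos[OF G, THEN less_imp_le] V1_weight_pos[OF G, THEN less_imp_neq]
    by (auto simp: sum_nonneg_eq_0_iff finite_E1'[OF G] finite_V1[OF G])
  then have "\<xi> i = 0" for i
    using \<xi> by (cases "i \<in> bindex G") (auto simp: bindex_def coord_space_def)
  then show ?thesis by (auto simp: fun_eq_iff)
qed

lemma coord_space_finite_span:
  fixes S :: "'i set"
  assumes "finite S"
  obtains B :: "('i \<Rightarrow> 'a::real_or_complex) set" where "finite B" "coord_space S \<subseteq> coord.span B"
proof (rule that)
  let ?unit = "\<lambda>i j. if j = i then 1 else 0 :: 'a"
  show "finite (?unit ` S)" using assms by simp
  show "coord_space S \<subseteq> coord.span (?unit ` S)"
  proof
    fix \<xi> :: "'i \<Rightarrow> 'a" assume \<xi>: "\<xi> \<in> coord_space S"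
    have "(\<Sum>i\<in>S. coord_scale (\<xi> i) (?unit i)) \<in> coord.span (?unit ` S)"
      by (intro coord.span_sum coord.span_scale coord.span_base) auto
    moreover have "(\<Sum>i\<in>S. coord_scale (\<xi> i) (?unit i)) = \<xi>"
    proof
      fix j
      have "(\<Sum>i\<in>S. coord_scale (\<xi> i) (?unit i)) j = (\<Sum>i\<in>S. if j = i then \<xi> i else 0)"
        unfolding sum_pointwise by (intro sum.cong) (auto simp: coord_scale_def)
      also have "\<dots> = \<xi> j" using assms \<xi> by (auto simp: coord_space_def)
      finally show "(\<Sum>i\<in>S. coord_scale (\<xi> i) (?unit i)) j = \<xi> j" .
    qed
    ultimately show "\<xi> \<in> coord.span (?unit ` S)" by simp
  qed
qed

lemma coord_space_subspace: "coord.subspace (coord_space S)"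
  by (auto simp: coord.subspace_def coord_space_def coord_scale_def)

text \<open>Gram--Schmidt, one spanning vector at a time.\<close>

lemma exists_orthogonal_projection_onto_span:
  fixes B :: "(('v, 'e) bidx \<Rightarrow> 'a::real_or_complex) set"
  assumes G: "valid_graph G" and B: "finite B" "B \<subseteq> coord_space (bindex G)"
  shows "\<exists>\<eta>\<in>coord.span B. \<forall>\<zeta>\<in>coord.span B. binner G (\<xi> - \<eta>) \<zeta> = 0"
  using B
proof (induction B arbitrary: \<xi> rule: finite_induct)
  case empty
  have "0 \<in> coord.span {}" by (rule coord.span_zero)
  moreover have "\<zeta> = 0" if "\<zeta> \<in> coord.span {}" for \<zeta> :: "('v, 'e) bidx \<Rightarrow> 'a"
    using that unfolding coord.span_empty by blast
  ultimately show ?case by (metis binner_zero_right)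
next
  case (insert b B)
  then have IH: "\<exists>\<eta>\<in>coord.span B. \<forall>\<zeta>\<in>coord.span B. binner G (\<xi> - \<eta>) \<zeta> = 0" for \<xi> by blast
  obtain p where p: "p \<in> coord.span B" "\<forall>\<zeta>\<in>coord.span B. binner G (b - p) \<zeta> = 0" using IH by blast
  obtain q where q: "q \<in> coord.span B" "\<forall>\<zeta>\<in>coord.span B. binner G (\<xi> - q) \<zeta> = 0" using IH by blast
  have sub: "coord.span B \<subseteq> coord.span (insert b B)" by (rule coord.span_mono) auto
  have b: "b \<in> coord.span (insert b B)" by (rule coord.span_base) simp
  define c where "c = binner G (\<xi> - q) (b - p) / binner G (b - p) (b - p)"
  define \<eta> where "\<eta> = q + coord_scale c (b - p)"
  have perp: "binner G (\<xi> - \<eta>) (b - p) = 0"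
  proof (cases "binner G (b - p) (b - p) = 0")
    case True
    have "b - p \<in> coord_space (bindex G)"
      using insert.prems p(1) coord.span_minimal[OF _ coord_space_subspace, of B]
      by (intro coord.subspace_diff[OF coord_space_subspace]) auto
    then have "b - p = 0" using binner_self_eq_zero[OF G] True by blast
    then show ?thesis by (simp only: binner_zero_right)
  next
    case False
    then show ?thesis
      by (simp add: \<eta>_def c_def binner_diff_left binner_add_left binner_scale_left)
  qed
  have perp_B: "binner G (\<xi> - \<eta>) \<zeta> = 0" if "\<zeta> \<in> coord.span B" for \<zeta>
    using that p(2) q(2) by (simp add: \<eta>_def binner_diff_left binner_add_left binner_scale_left)
  show ?case
  proof (intro bexI ballI)
    show "\<eta> \<in> coord.span (insert b B)"
      unfolding \<eta>_def using p(1) q(1) sub b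
      by (intro coord.span_add coord.span_scale coord.span_diff) auto
    fix \<zeta> assume "\<zeta> \<in> coord.span (insert b B)"
    then obtain k where k: "\<zeta> - coord_scale k b \<in> coord.span B"
      using coord.span_breakdown_eq by blast
    have "\<zeta> = (\<zeta> - coord_scale k b + coord_scale k p) + coord_scale k (b - p)"
      by (auto simp: coord_scale_def fun_eq_iff algebra_simps)
    moreover have "\<zeta> - coord_scale k b + coord_scale k p \<in> coord.span B"
      using k p(1) by (intro coord.span_add coord.span_scale)
    ultimately show "binner G (\<xi> - \<eta>) \<zeta> = 0"
      using perp perp_B by (metis binner_add_right binner_scale_right add_0 mult_zero_right)
  qed
qed

text \<open>The projections exist because the subspace has finite dimension, and they are unique because the
scalar product is positive definite; the latter uses \<open>\<mu>\<^sub>v > 0\<close> at the vertices of \<open>V\<^sub>1\<close>.\<close>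

lemma orth_proj_eq_iff:
  fixes Y :: "(('v, 'e) bidx \<Rightarrow> 'a::real_or_complex) set"
  assumes G: "valid_graph G" and Y: "coord.subspace Y" "Y \<subseteq> coord_space (bindex G)"
  shows "orth_proj G Y \<xi> = orth_proj G Y \<eta> \<longleftrightarrow> (\<forall>\<zeta>\<in>Y. binner G (\<xi> - \<eta>) \<zeta> = 0)"
proof -
  obtain T :: "(('v, 'e) bidx \<Rightarrow> 'a) set" where T: "finite T" "coord_space (bindex G) \<subseteq> coord.span T"
    using coord_space_finite_span[OF finite_bindex[OF G]] by blast
  obtain B where B: "B \<subseteq> Y" "coord.independent B" "Y \<subseteq> coord.span B"
    using coord.maximal_independent_subset by blast
  have "finite B" using coord.independent_span_bound[OF T(1) B(2)] B(1) Y(2) T(2) by blast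
  have span: "coord.span B = Y" using B Y(1) coord.span_minimal[OF B(1) Y(1)] by blast
  have ex: "\<exists>\<theta>. \<theta> \<in> Y \<and> (\<forall>\<zeta>\<in>Y. binner G (\<xi> - \<theta>) \<zeta> = 0)" for \<xi>
    using exists_orthogonal_projection_onto_span[OF G \<open>finite B\<close>] B(1) Y(2) unfolding span by blast
  have unique: "\<theta> = \<theta>'"
    if "\<theta> \<in> Y" "\<forall>\<zeta>\<in>Y. binner G (\<xi> - \<theta>) \<zeta> = 0" "\<theta>' \<in> Y" "\<forall>\<zeta>\<in>Y. binner G (\<xi> - \<theta>') \<zeta> = 0"
    for \<xi> \<theta> \<theta>'
  proof -
    have d: "\<theta> - \<theta>' \<in> Y" using that by (intro coord.subspace_diff[OF Y(1)])
    have "binner G (\<theta> - \<theta>') (\<theta> - \<theta>') = binner G (\<xi> - \<theta>') (\<theta> - \<theta>') - binner G (\<xi> - \<theta>) (\<theta> - \<theta>')"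
      by (simp add: binner_diff_left)
    also have "\<dots> = 0" using that d by simp
    finally have "\<theta> - \<theta>' = 0" using binner_self_eq_zero[OF G] d Y(2) by blast
    then show ?thesis by simp
  qed
  have spec: "orth_proj G Y \<xi> \<in> Y \<and> (\<forall>\<zeta>\<in>Y. binner G (\<xi> - orth_proj G Y \<xi>) \<zeta> = 0)" for \<xi>
  proof -
    obtain \<theta> where "\<theta> \<in> Y \<and> (\<forall>\<zeta>\<in>Y. binner G (\<xi> - \<theta>) \<zeta> = 0)" using ex[of \<xi>] ..
    then have "\<exists>!\<theta>. \<theta> \<in> Y \<and> (\<forall>\<zeta>\<in>Y. binner G (\<xi> - \<theta>) \<zeta> = 0)"
      using unique[of _ \<xi> \<theta>] by (intro ex1I[of _ \<theta>]) blast+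
    from theI'[OF this] show ?thesis unfolding orth_proj_def .
  qed
  show ?thesis
  proof
    assume "orth_proj G Y \<xi> = orth_proj G Y \<eta>"
    then show "\<forall>\<zeta>\<in>Y. binner G (\<xi> - \<eta>) \<zeta> = 0"
      using spec[of \<xi>] spec[of \<eta>] by (simp add: binner_diff_left)
  next
    assume "\<forall>\<zeta>\<in>Y. binner G (\<xi> - \<eta>) \<zeta> = 0"
    then have "\<forall>\<zeta>\<in>Y. binner G (\<xi> - orth_proj G Y \<eta>) \<zeta> = 0"
      using spec[of \<eta>] by (simp add: binner_diff_left)
    then show "orth_proj G Y \<xi> = orth_proj G Y \<eta>"
      using spec[of \<xi>] spec[of \<eta>] unique by blast
  qed
qed

section \<open>Localization at the vertices\<close>

lemma bindex_eq_UN_S_at: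
  assumes "valid_graph G"
  shows "bindex G = (\<Union>v\<in>verts G. S_at G v)"
  using assms by (fastforce simp: bindex_def S_at_def E1_at_def E1'_def E1_def V1_def V0_def valid_graph_def split: if_splits)

lemma S_at_disjoint: "v \<noteq> w \<Longrightarrow> i \<in> S_at G v \<Longrightarrow> i \<notin> S_at G w"
  by (auto simp: S_at_def E1_at_def split: if_splits)

lemma S_at_subset: "valid_graph G \<Longrightarrow> v \<in> verts G \<Longrightarrow> S_at G v \<subseteq> bindex G"
  using bindex_eq_UN_S_at by blast

lemma coord_restrict_in_coord_space: "coord_restrict S \<xi> \<in> coord_space S"
  by (simp add: coord_restrict_def coord_space_def)

lemma sum_restrict_S_at:
  fixes \<xi> :: "('v, 'e) bidx \<Rightarrow> 'a::real_or_complex"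
  assumes G: "valid_graph G" and \<xi>: "\<xi> \<in> coord_space (bindex G)"
  shows "(\<Sum>v\<in>verts G. coord_restrict (S_at G v) \<xi>) = \<xi>"
proof
  fix i
  have fin: "finite (verts G)" using G by (simp add: valid_graph_def)
  show "(\<Sum>v\<in>verts G. coord_restrict (S_at G v) \<xi>) i = \<xi> i"
  proof (cases "i \<in> bindex G")
    case True
    then obtain v where v: "v \<in> verts G" "i \<in> S_at G v" using bindex_eq_UN_S_at[OF G] by blast
    have "(\<Sum>w\<in>verts G. coord_restrict (S_at G w) \<xi>) i = (\<Sum>w\<in>verts G. if w = v then \<xi> i else 0)"
      unfolding sum_pointwise using v S_at_disjoint by (intro sum.cong) (force simp: coord_restrict_def)+
    then show ?thesis using fin v by simp
  next
    case False
    then have "i \<notin> S_at G v" if "v \<in> verts G" for v using S_at_subset[OF G that] by blast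
    then have "(\<Sum>w\<in>verts G. coord_restrict (S_at G w) \<xi>) i = 0"
      unfolding sum_pointwise by (intro sum.neutral) (auto simp: coord_restrict_def)
    then show ?thesis using False \<xi> by (simp add: coord_space_def)
  qed
qed

lemma restrict_S_at_sum:
  fixes x :: "'v \<Rightarrow> ('v, 'e) bidx \<Rightarrow> 'a::real_or_complex"
  assumes G: "valid_graph G" and x: "\<And>v. v \<in> verts G \<Longrightarrow> x v \<in> coord_space (S_at G v)"
    and w: "w \<in> verts G"
  shows "coord_restrict (S_at G w) (\<Sum>v\<in>verts G. x v) = x w"
proof
  fix i
  have fin: "finite (verts G)" using G by (simp add: valid_graph_def)
  show "coord_restrict (S_at G w) (\<Sum>v\<in>verts G. x v) i = x w i"
  proof (cases "i \<in> S_at G w")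
    case True
    have "(\<Sum>v\<in>verts G. x v) i = (\<Sum>v\<in>verts G. if v = w then x w i else 0)"
      unfolding sum_pointwise using x S_at_disjoint[OF _ True]
      by (intro sum.cong) (auto simp: coord_space_def)
    then show ?thesis using True fin w by (simp add: coord_restrict_def)
  next
    case False
    then show ?thesis using x[OF w] by (simp add: coord_restrict_def coord_space_def)
  qed
qed

lemma binner_restrict_left:
  fixes \<xi> \<eta> :: "('v, 'e) bidx \<Rightarrow> 'a::real_or_complex"
  assumes "\<eta> \<in> coord_space S"
  shows "binner G (coord_restrict S \<xi>) \<eta> = binner G \<xi> \<eta>"
proof -
  have "coord_restrict S \<xi> i * conjg (\<eta> i) = \<xi> i * conjg (\<eta> i)" for i
    using assms by (auto simp: coord_restrict_def coord_space_def)
  then show ?thesis unfolding binner_def by (simp only:)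
qed

locale local_boundary_conditions =
  fixes G :: "('v, 'e) measure_graph"
    and X :: "(('v, 'e) bidx \<Rightarrow> 'a::real_or_complex) set"
    and L :: "(('v, 'e) bidx \<Rightarrow> 'a) \<Rightarrow> (('v, 'e) bidx \<Rightarrow> 'a)"
    and Xv :: "'v \<Rightarrow> (('v, 'e) bidx \<Rightarrow> 'a) set"
    and Lv :: "'v \<Rightarrow> (('v, 'e) bidx \<Rightarrow> 'a) \<Rightarrow> (('v, 'e) bidx \<Rightarrow> 'a)"
    and \<xi> :: "'v \<Rightarrow> ('v, 'e) bidx \<Rightarrow> 'a"
  assumes G: "valid_graph G"
    and decomp: "local_decomp G X L Xv Lv"
    and \<xi>: "v \<in> V1 G \<Longrightarrow> \<xi> v \<in> Xv v" "v \<in> V1 G \<Longrightarrow> \<xi> v (Inr v) = 1"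
begin

abbreviation "vertex_term k \<eta> v \<equiv> k v * conjg (\<eta> (Inr v)) * of_real (weight G v)"

lemma bc_at: "v \<in> verts G \<Longrightarrow> bc_in G (S_at G v) (Xv v) (Lv v)"
  using decomp by (auto simp: local_decomp_def)

lemma Xv_coord_space: "v \<in> verts G \<Longrightarrow> \<eta> \<in> Xv v \<Longrightarrow> \<eta> \<in> coord_space (S_at G v)"
  using bc_at by (auto simp: bc_in_def)

lemma Xv_subspace: "v \<in> verts G \<Longrightarrow> coord.subspace (Xv v)"
  using bc_at by (auto simp: bc_in_def)

lemma Lv_in_Xv: "v \<in> verts G \<Longrightarrow> \<eta> \<in> Xv v \<Longrightarrow> Lv v \<eta> \<in> Xv v"
  using bc_at by (auto simp: bc_in_def selfadjoint_in_def)

lemma mem_X_iff: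
  "\<eta> \<in> X \<longleftrightarrow> \<eta> \<in> coord_space (bindex G) \<and> (\<forall>v\<in>verts G. coord_restrict (S_at G v) \<eta> \<in> Xv v)"
proof
  assume "\<eta> \<in> X"
  then obtain x where x: "\<eta> = (\<Sum>v\<in>verts G. x v)" "\<forall>v\<in>verts G. x v \<in> Xv v"
    using decomp by (auto simp: local_decomp_def)
  have xs: "x v \<in> coord_space (S_at G v)" if "v \<in> verts G" for v
    using x(2) Xv_coord_space that by blast
  have "x v \<in> coord_space (bindex G)" if "v \<in> verts G" for v
    using xs[OF that] S_at_subset[OF G that] by (auto simp: coord_space_def)
  then have "\<eta> \<in> coord_space (bindex G)"
    unfolding x(1) by (intro coord.subspace_sum[OF coord_space_subspace])
  then show "\<eta> \<in> coord_space (bindex G) \<and> (\<forall>v\<in>verts G. coord_restrict (S_at G v) \<eta> \<in> Xv v)"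
    using x(2) restrict_S_at_sum[OF G xs] x(1) by auto
next
  assume r: "\<eta> \<in> coord_space (bindex G) \<and> (\<forall>v\<in>verts G. coord_restrict (S_at G v) \<eta> \<in> Xv v)"
  then have "\<eta> = (\<Sum>v\<in>verts G. coord_restrict (S_at G v) \<eta>)" using sum_restrict_S_at[OF G] by metis
  moreover have "X = {(\<Sum>v\<in>verts G. x v) | x. \<forall>v\<in>verts G. x v \<in> Xv v}"
    using decomp by (simp add: local_decomp_def)
  ultimately show "\<eta> \<in> X" using r by blast
qed

lemma Xv_subset_X:
  assumes v: "v \<in> verts G" and \<eta>: "\<eta> \<in> Xv v"
  shows "\<eta> \<in> X"
  unfolding mem_X_iff
proof (intro conjI ballI)
  have c: "\<eta> \<in> coord_space (S_at G v)" by (rule Xv_coord_space[OF v \<eta>])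
  then show "\<eta> \<in> coord_space (bindex G)" using S_at_subset[OF G v] by (auto simp: coord_space_def)
  fix w assume w: "w \<in> verts G"
  show "coord_restrict (S_at G w) \<eta> \<in> Xv w"
  proof (cases "w = v")
    case True
    have "coord_restrict (S_at G v) \<eta> = \<eta>" using c by (auto simp: coord_restrict_def coord_space_def)
    then show ?thesis using True \<eta> by simp
  next
    case False
    have "coord_restrict (S_at G w) \<eta> = 0"
      using c S_at_disjoint[OF False] by (auto simp: coord_restrict_def coord_space_def fun_eq_iff)
    then show ?thesis using coord.subspace_0[OF Xv_subspace[OF w]] by simp
  qed
qed

lemma restrict_L:
  assumes \<eta>: "\<eta> \<in> X" and v: "v \<in> verts G"
  shows "coord_restrict (S_at G v) (L \<eta>) = Lv v (coord_restrict (S_at G v) \<eta>)"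
proof -
  have r: "\<eta> \<in> coord_space (bindex G)" "\<And>w. w \<in> verts G \<Longrightarrow> coord_restrict (S_at G w) \<eta> \<in> Xv w"
    using \<eta> mem_X_iff by auto
  have "L (\<Sum>w\<in>verts G. coord_restrict (S_at G w) \<eta>) = (\<Sum>w\<in>verts G. Lv w (coord_restrict (S_at G w) \<eta>))"
    using decomp[unfolded local_decomp_def, THEN conjunct2, THEN conjunct2, THEN spec,
        of "\<lambda>w. coord_restrict (S_at G w) \<eta>"] r(2) by blast
  then have "L \<eta> = (\<Sum>w\<in>verts G. Lv w (coord_restrict (S_at G w) \<eta>))"
    using sum_restrict_S_at[OF G r(1)] by simp
  moreover have "Lv w (coord_restrict (S_at G w) \<eta>) \<in> coord_space (S_at G w)" if "w \<in> verts G" for w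
    using that r(2) by (intro Xv_coord_space Lv_in_Xv)
  ultimately show ?thesis
    using restrict_S_at_sum[OF G _ v, of "\<lambda>w. Lv w (coord_restrict (S_at G w) \<eta>)"] by simp
qed

lemma V1_verts: "v \<in> V1 G \<Longrightarrow> v \<in> verts G" "v \<in> V1 G \<Longrightarrow> v \<notin> V0 G"
  by (auto simp: V1_def)

lemma X0_at_subspace: "v \<in> verts G \<Longrightarrow> coord.subspace (X0_at G Xv v)"
  using Xv_subspace[of v] by (auto simp: X0_at_def coord.subspace_def coord_scale_def)

lemma X0_at_subset: "X0_at G Xv v \<subseteq> Xv v"
  by (auto simp: X0_at_def)

text \<open>Testing against \<open>X\<^sub>v\<close> amounts to testing against \<open>X\<^sub>v\<^sub>,\<^sub>0\<close> and against \<open>\<xi>\<^sup>v\<close>,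
  because \<open>\<eta> - \<eta>(v) \<xi>\<^sup>v\<close> lies in \<open>X\<^sub>v\<^sub>,\<^sub>0\<close>.\<close>

lemma vertex_condition_iff:
  assumes v: "v \<in> verts G"
  shows "(\<forall>\<eta>\<in>Xv v. binner G \<rho> \<eta> = (if v \<in> V1 G then vertex_term k \<eta> v else 0))
    \<longleftrightarrow> (\<forall>\<zeta>\<in>X0_at G Xv v. binner G \<rho> \<zeta> = 0) \<and>
      (v \<in> V1 G \<longrightarrow> k v = 1 / of_real (weight G v) * binner G \<rho> (\<xi> v))" (is "?L \<longleftrightarrow> ?R")
proof (cases "v \<in> V1 G")
  case False
  then have "v \<in> V0 G" using v by (simp add: V1_def)
  then show ?thesis using False by (simp add: X0_at_def)
next
  case True
  then have X0: "X0_at G Xv v = {\<zeta> \<in> Xv v. \<zeta> (Inr v) = 0}" using V1_verts by (simp add: X0_at_def)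
  have wt: "weight G v \<noteq> 0" using V1_weight_pos[OF G True] by simp
  show ?thesis
  proof
    assume l: ?L
    have "binner G \<rho> (\<xi> v) = k v * of_real (weight G v)" using l True \<xi>[OF True] by simp
    then show ?R using l True wt by (auto simp: X0)
  next
    assume r: ?R
    show ?L
    proof
      fix \<eta> assume \<eta>: "\<eta> \<in> Xv v"
      let ?\<zeta> = "\<eta> - coord_scale (\<eta> (Inr v)) (\<xi> v)"
      have "?\<zeta> \<in> X0_at G Xv v"
        unfolding X0 using \<eta> \<xi>[OF True]
        using coord.subspace_diff[OF Xv_subspace[OF v] \<eta>
            coord.subspace_scale[OF Xv_subspace[OF v] \<xi>(1)[OF True], of "\<eta> (Inr v)"]]
        by (simp add: coord_scale_def)
      then have "binner G \<rho> ?\<zeta> = 0" using r by blast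
      then have "binner G \<rho> \<eta> = conjg (\<eta> (Inr v)) * binner G \<rho> (\<xi> v)"
        by (simp add: binner_diff_right binner_scale_right)
      also have "binner G \<rho> (\<xi> v) = k v * of_real (weight G v)" using r True wt by simp
      finally show "binner G \<rho> \<eta> = (if v \<in> V1 G then vertex_term k \<eta> v else 0)"
        using True by (simp add: ac_simps)
    qed
  qed
qed

text \<open>Both the vectors in \<open>X\<close> and the scalar product decompose along the disjoint index sets \<open>S\<^sub>v\<close>; testing
with a vector of \<open>X\<^sub>v\<close>, extended by zero, isolates the contribution of the vertex \<open>v\<close>.\<close>

lemma boundary_condition_localize:
  "(\<forall>\<eta>\<in>X. binner G \<rho> \<eta> = (\<Sum>v\<in>V1 G. vertex_term k \<eta> v))
    \<longleftrightarrow> (\<forall>v\<in>verts G. \<forall>\<eta>\<in>Xv v. binner G (coord_restrict (S_at G v) \<rho>) \<eta>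
      = (if v \<in> V1 G then vertex_term k \<eta> v else 0))" (is "?L \<longleftrightarrow> ?R")
proof -
  have fin: "finite (verts G)" using G by (simp add: valid_graph_def)
  have at: "(\<Sum>w\<in>V1 G. vertex_term k \<eta> w)
      = (if v \<in> V1 G then vertex_term k \<eta> v else 0)"
    if "v \<in> verts G" "\<eta> \<in> Xv v" for v \<eta>
  proof -
    have "\<eta> (Inr w) = 0" if "w \<noteq> v" for w
      using Xv_coord_space[OF \<open>v \<in> verts G\<close> \<open>\<eta> \<in> Xv v\<close>] that
      by (auto simp: coord_space_def S_at_def split: if_splits)
    then have "(\<Sum>w\<in>V1 G. vertex_term k \<eta> w)
      = (\<Sum>w\<in>V1 G. if w = v then vertex_term k \<eta> v else 0)"
      by (intro sum.cong) auto
    then show ?thesis using finite_V1[OF G] by simp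
  qed
  show ?thesis
  proof
    assume l: ?L
    show ?R
    proof (intro ballI)
      fix v \<eta> assume v: "v \<in> verts G" "\<eta> \<in> Xv v"
      have "binner G (coord_restrict (S_at G v) \<rho>) \<eta> = binner G \<rho> \<eta>"
        by (rule binner_restrict_left[OF Xv_coord_space[OF v]])
      also have "\<dots> = (\<Sum>w\<in>V1 G. vertex_term k \<eta> w)"
        using l Xv_subset_X[OF v] by blast
      finally show "binner G (coord_restrict (S_at G v) \<rho>) \<eta>
          = (if v \<in> V1 G then vertex_term k \<eta> v else 0)"
        unfolding at[OF v] .
    qed
  next
    assume r: ?R
    show ?L
    proof
      fix \<eta> assume "\<eta> \<in> X"
      then have \<eta>: "\<eta> \<in> coord_space (bindex G)" "\<And>v. v \<in> verts G \<Longrightarrow> coord_restrict (S_at G v) \<eta> \<in> Xv v"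
        using mem_X_iff by auto
      have "binner G \<rho> \<eta> = (\<Sum>v\<in>verts G. binner G \<rho> (coord_restrict (S_at G v) \<eta>))"
        by (subst sum_restrict_S_at[OF G \<eta>(1), symmetric]) (rule binner_sum_right)
      also have "\<dots> = (\<Sum>v\<in>verts G. if v \<in> V1 G then vertex_term k \<eta> v else 0)"
      proof (rule sum.cong[OF refl])
        fix v assume v: "v \<in> verts G"
        have "binner G \<rho> (coord_restrict (S_at G v) \<eta>)
            = binner G (coord_restrict (S_at G v) \<rho>) (coord_restrict (S_at G v) \<eta>)"
          by (rule binner_restrict_left[OF coord_restrict_in_coord_space, symmetric])
        also have "\<dots> = (if v \<in> V1 G then vertex_term k (coord_restrict (S_at G v) \<eta>) v else 0)"
          using r v \<eta>(2)[OF v] by blast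
        also have "\<dots> = (if v \<in> V1 G then vertex_term k \<eta> v else 0)"
          using V1_verts(2) by (auto simp: coord_restrict_def S_at_def)
        finally show "binner G \<rho> (coord_restrict (S_at G v) \<eta>)
            = (if v \<in> V1 G then vertex_term k \<eta> v else 0)" .
      qed
      also have "\<dots> = (\<Sum>v\<in>V1 G. vertex_term k \<eta> v)"
        using fin V1_verts(1) by (intro sum.mono_neutral_cong_right) auto
      finally show "binner G \<rho> \<eta> = (\<Sum>v\<in>V1 G. vertex_term k \<eta> v)" .
    qed
  qed
qed

end

section \<open>The associated operator\<close>

lemma edge_measureI:
  assumes G: "valid_graph G" and e: "e \<in> E1 G"
  shows "edge_measure (emeas G e) (lend G e) (rend G e)"
proof -
  have e': "e \<in> edges G" "emeasure (emeas G e) {lend G e..rend G e} \<noteq> 0"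
    using e by (auto simp: E1_def)
  then show ?thesis
    using G unfolding valid_graph_def
    by (intro edge_measure.intro edge_measure_axioms.intro) auto
qed

text \<open>The conjugate of \<open>w\<close> is the primitive of the conjugate of \<open>w'\<close>, and the constants \<open>C\<close> and
\<open>C + \<integral> k d\<mu>\<close> of the integration by parts are the boundary limits of \<open>u'\<close>.\<close>

lemma (in edge_measure) form_by_parts:
  fixes u w k :: "real \<Rightarrow> 'a::real_or_complex"
  assumes k: "mu_weak_deriv a b M (sobolev_deriv a b u) k" "k \<in> L2 M"
    and w: "w \<in> sobolev_W12 a b" "continuous_on {a..b} w"
  shows "(\<integral>x. sobolev_deriv a b u x * conjg (sobolev_deriv a b w x) \<partial>\<Lambda>)
    = Lim (at_left b) (bv_rep a b (sobolev_deriv a b u)) * conjg (w b)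
      - Lim (at_right a) (bv_rep a b (sobolev_deriv a b u)) * conjg (w a) - L2_inner M k w"
proof -
  let ?u' = "sobolev_deriv a b u" and ?w' = "\<lambda>x. conjg (sobolev_deriv a b w x)"
  obtain C where C: "AE x in \<Lambda>. ?u' x = C + primitive M k x" using mu_weak_deriv_imp_primitive[OF k(1)] by blast
  have ik: "integrable M k" by (rule L2_integrable[OF k(2)])
  note lim = bv_rep_Lim[OF ab ik C]
  note iw = sobolev_deriv_integrable[OF w(1)]
  have iw': "integrable \<Lambda> ?w'" by (rule integrable_conjg[OF iw])
  have prim: "conjg (w x) = conjg (w a) + primitive \<Lambda> ?w' x" if "x \<in> {a..b}" for x
  proof -
    have "primitive \<Lambda> ?w' x = conjg (primitive \<Lambda> (sobolev_deriv a b w) x)"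
      unfolding primitive_def
      by (subst integral_conjg[symmetric]) (auto intro: \<Lambda>.integrable_indicator_scaleR[OF iw])
    then show ?thesis using sobolev_eq_primitive[OF ab w that] by (simp add: conjg_add)
  qed
  have L1: "integrable M (\<lambda>x. k x * conjg (w x))"
    by (rule L2_mult_conjg_integrable[OF k(2) continuous_L2[OF w(2)]])
  have "(\<integral>x. ?u' x * ?w' x \<partial>\<Lambda>) = (\<integral>x. (C + primitive M k x) * ?w' x \<partial>\<Lambda>)"
  proof (rule integral_cong_AE)
    have "?u' \<in> borel_measurable \<Lambda>"
      using k(1) by (intro L1_loc_measurable) (simp add: mu_weak_deriv_def)
    then show "(\<lambda>x. ?u' x * ?w' x) \<in> borel_measurable \<Lambda>" using iw' by measurable
    have "(\<lambda>x. C + primitive M k x) \<in> borel_measurable \<Lambda>" using primitive_integrable[OF ik] by auto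
    then show "(\<lambda>x. (C + primitive M k x) * ?w' x) \<in> borel_measurable \<Lambda>" using iw' by measurable
    show "AE x in \<Lambda>. ?u' x * ?w' x = (C + primitive M k x) * ?w' x" using C by eventually_elim simp
  qed
  also have "\<dots> = (C + (\<integral>y. k y \<partial>M)) * conjg (w b) - C * conjg (w a) - (\<integral>y. k y * conjg (w y) \<partial>M)"
    by (rule integration_by_parts[OF _ ik iw' prim L1]) (use ab in auto)
  finally show ?thesis by (simp add: lim L2_inner_def)
qed

lemma L2_inner_cong:
  fixes f g f' g' :: "'x \<Rightarrow> 'a::real_or_complex"
  assumes "f \<in> L2 M" "g \<in> L2 M" "f' \<in> L2 M" "g' \<in> L2 M"
    and "AE x in M. f x = f' x" "AE x in M. g x = g' x"
  shows "L2_inner M f g = L2_inner M f' g'"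
  unfolding L2_inner_def
proof (rule integral_cong_AE)
  show "AE x in M. f x * conjg (g x) = f' x * conjg (g' x)"
    using assms(5,6) by eventually_elim simp
qed (intro borel_measurable_integrable L2_mult_conjg_integrable assms)+

context local_boundary_conditions
begin

abbreviation "lebesgue_edge e \<equiv> lebesgue_on {lend G e<..<rend G e}"
abbreviation "test_edge e \<equiv> test_functions (lend G e) (rend G e)"
abbreviation "W12_edge e \<equiv> sobolev_W12 (lend G e) (rend G e)"
abbreviation "W12_mu_edge e \<equiv> W12_mu (lend G e) (rend G e) (emeas G e)"
abbreviation "weak_deriv_edge e \<equiv> sobolev_deriv (lend G e) (rend G e)"
abbreviation "mu_deriv_edge e \<equiv> mu_deriv (lend G e) (rend G e) (emeas G e)"
abbreviation "is_mu_deriv e \<equiv> mu_weak_deriv (lend G e) (rend G e) (emeas G e)"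
abbreviation "slope f \<equiv> iota_deriv G (fst f)"
abbreviation "start_limit e u \<equiv> Lim (at_right (lend G e)) (bv_rep (lend G e) (rend G e) u)"
abbreviation "end_limit e u \<equiv> Lim (at_left (rend G e)) (bv_rep (lend G e) (rend G e) u)"

lemma iota_e_W12_mu:
  assumes "f \<in> dom_iota_e G e" "e \<in> E1 G"
  shows "iota_e G e f \<in> W12_mu_edge e"
    and "AE x in emeas G e. iota_e G e f x = f x"
  using edge_measure.iota_edge_props[OF edge_measureI[OF G assms(2)] assms(1)] by auto

lemma iota_e_sobolev:
  assumes "f \<in> dom_iota_e G e" "e \<in> E1 G"
  shows "iota_e G e f \<in> W12_edge e"
    and "continuous_on {lend G e..rend G e} (iota_e G e f)"
  using iota_e_W12_mu[OF assms] by (auto simp: W12_mu_def C_mu_def)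

lemma W12_mu_iota_e:
  assumes "w \<in> W12_mu_edge e" "e \<in> E1 G"
  shows "w \<in> dom_iota_e G e" and "x \<in> {lend G e..rend G e} \<Longrightarrow> iota_e G e w x = w x"
  using edge_measure.W12_mu_imp_dom_iota[OF edge_measureI[OF G assms(2)] assms(1)]
    edge_measure.iota_edge_W12_mu[OF edge_measureI[OF G assms(2)] assms(1)] by auto

lemma dom_form_D:
  assumes "f \<in> dom_form G X" "e \<in> E1 G"
  shows "fst f e \<in> dom_iota_e G e" and "fst f e \<in> L2 (emeas G e)"
  using assms by (auto simp: dom_form_def dom_iota_def hilb_def)

lemma btrace_coord_space: "btrace G f \<in> coord_space (bindex G)"
  unfolding btrace_def by (rule coord_restrict_in_coord_space)

lemma btrace_eq:
  "e \<in> E1 G \<Longrightarrow> btrace G f (Inl (e, 0)) = fst f e (lend G e)"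
  "e \<in> E1 G \<Longrightarrow> btrace G f (Inl (e, 1)) = fst f e (rend G e)"
  "v \<in> V1 G \<Longrightarrow> btrace G f (Inr v) = snd f v"
  by (auto simp: btrace_def coord_restrict_def bindex_def E1'_def)

lemma signed_trace_eq:
  "e \<in> E1 G \<Longrightarrow> signed_trace G u (Inl (e, 0)) = start_limit e ((u e))"
  "e \<in> E1 G \<Longrightarrow> signed_trace G u (Inl (e, 1)) = - end_limit e ((u e))"
  "signed_trace G u (Inr v) = 0"
  by (auto simp: signed_trace_def coord_restrict_def E1'_def)

lemma sum_E1': "(\<Sum>p\<in>E1' G. F p) = (\<Sum>e\<in>E1 G. F (e, 0) + F (e, 1 :: nat))"
proof -
  have "(\<Sum>p\<in>E1' G. F p) = (\<Sum>e\<in>E1 G. \<Sum>j\<in>{0, 1}. F (e, j))"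
    unfolding E1'_def sum.cartesian_product by (intro sum.cong) auto
  then show ?thesis by simp
qed

text \<open>The sign in the signed trace is the sign of the boundary terms of an integration by parts.\<close>

lemma binner_signed_trace:
  "binner G (signed_trace G u) (btrace G g)
    = (\<Sum>e\<in>E1 G. start_limit e ((u e)) * conjg (fst g e (lend G e))
        - end_limit e ((u e)) * conjg (fst g e (rend G e)))"
  unfolding binner_def sum_E1' by (simp add: btrace_eq signed_trace_eq del: One_nat_def cong: sum.cong)

lemma max_op_spec:
  assumes f: "fst f \<in> dom_max G" and e: "e \<in> E1 G"
  shows "is_mu_deriv e (slope f e) (\<lambda>x. - max_op G (fst f) e x)"
    and "max_op G (fst f) e \<in> L2 (emeas G e)"
proof -
  obtain g where "is_mu_deriv e (slope f e) g"
    and L2: "mu_deriv_edge e (slope f e) \<in> L2 (emeas G e)"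
    using f e by (auto simp: dom_max_def)
  then show "is_mu_deriv e (slope f e) (\<lambda>x. - max_op G (fst f) e x)"
    using someI[of "is_mu_deriv e (slope f e)" g]
    by (simp add: max_op_def mu_deriv_def)
  show "max_op G (fst f) e \<in> L2 (emeas G e)" using L2 by (simp add: max_op_def L2_def)
qed

text \<open>Integrating by parts on every edge turns the form into the pairing with \<open>\<hat>H\<close> plus
  boundary terms.\<close>

lemma form_eq:
  assumes f: "f \<in> dom_form G X" "fst f \<in> dom_max G" and g: "g \<in> dom_form G X"
  shows "form G L f g = (\<Sum>e\<in>E1 G. L2_inner (emeas G e) (max_op G (fst f) e) (fst g e))
    + binner G (L (btrace G (iota G f)) - signed_trace G (slope f)) (btrace G (iota G g))"
proof -
  let ?l = "\<lambda>e. start_limit e ((slope f e))"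
  let ?r = "\<lambda>e. end_limit e ((slope f e))"
  have edge: "(\<integral>x. slope f e x * conjg (slope g e x) \<partial>lebesgue_edge e)
      = L2_inner (emeas G e) (max_op G (fst f) e) (fst g e)
        - (?l e * conjg (fst (iota G g) e (lend G e)) - ?r e * conjg (fst (iota G g) e (rend G e)))"
    if e: "e \<in> E1 G" for e
  proof -
    interpret edge_measure "emeas G e" "lend G e" "rend G e" by (rule edge_measureI[OF G e])
    let ?w = "iota_e G e (fst g e)"
    note gd = dom_form_D[OF g e]
    note w = iota_e_sobolev[OF gd(1) e]
    note m = max_op_spec[OF f(2) e]
    have "(\<lambda>x. - max_op G (fst f) e x) \<in> L2 (emeas G e)" using m(2) by (simp add: L2_def)
    from form_by_parts[OF m(1)[unfolded iota_deriv_def] this w]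
    have "(\<integral>x. slope f e x * conjg (slope g e x) \<partial>lebesgue_edge e)
        = ?r e * conjg (?w (rend G e)) - ?l e * conjg (?w (lend G e))
          - L2_inner (emeas G e) (\<lambda>x. - max_op G (fst f) e x) ?w"
      by (simp add: iota_deriv_def)
    moreover have "L2_inner (emeas G e) (\<lambda>x. - max_op G (fst f) e x) ?w = - L2_inner (emeas G e) (max_op G (fst f) e) ?w"
      by (simp add: L2_inner_def)
    moreover have "L2_inner (emeas G e) (max_op G (fst f) e) ?w = L2_inner (emeas G e) (max_op G (fst f) e) (fst g e)"
      using iota_e_W12_mu(2)[OF gd(1) e] by (intro L2_inner_cong m(2) continuous_L2[OF w(2)] gd(2)) auto
    ultimately show ?thesis by (simp add: iota_def)
  qed
  have "form G L f g = (\<Sum>e\<in>E1 G. L2_inner (emeas G e) (max_op G (fst f) e) (fst g e))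
      - (\<Sum>e\<in>E1 G. ?l e * conjg (fst (iota G g) e (lend G e)) - ?r e * conjg (fst (iota G g) e (rend G e)))
      + binner G (L (btrace G (iota G f))) (btrace G (iota G g))"
    unfolding form_def sum_subtractf[symmetric] by (simp only: edge cong: sum.cong)
  then show ?thesis
    unfolding binner_diff_left binner_signed_trace by simp
qed

text \<open>Testing with \<open>\<iota>\<phi>\<close> on a single edge identifies the action of the operator there.\<close>

lemma assoc_op_mu_weak_deriv:
  assumes fh: "assoc_op G X L f h" and e: "e \<in> E1 G"
  shows "is_mu_deriv e (slope f e) (\<lambda>x. - fst h e x)"
proof -
  interpret edge_measure "emeas G e" "lend G e" "rend G e" by (rule edge_measureI[OF G e])
  have f: "f \<in> dom_form G X" and h: "h \<in> hilb G"
    and eq: "\<And>g. g \<in> dom_form G X \<Longrightarrow> form G L f g = hilb_inner G h g"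
    using fh by (auto simp: assoc_op_def)
  let ?u = "iota_e G e (fst f e)"
  have u: "?u \<in> W12_mu_edge e"
    by (rule iota_e_W12_mu(1)[OF dom_form_D(1)[OF f e] e])
  have uS: "?u \<in> W12_edge e" using u by (simp add: W12_mu_def)
  have he: "fst h e \<in> L2 (emeas G e)" using h e by (simp add: hilb_def)
  have main: "(\<integral>x. slope f e x * vector_derivative \<phi> (at x) \<partial>lebesgue_edge e) = - (\<integral>x. - fst h e x * \<phi> x \<partial>emeas G e)"
    if \<phi>: "\<phi> \<in> test_edge e" for \<phi> :: "real \<Rightarrow> 'a"
  proof -
    \<comment> \<open>The form is conjugate linear in its second argument, distributions are tested linearly.\<close>
    let ?\<psi> = "\<lambda>x. conjg (\<phi> x)"
    have \<psi>: "?\<psi> \<in> test_edge e"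
      by (rule test_functions_bounded_linear[OF bounded_linear_conjg \<phi>])
    have \<psi>': "conjg (vector_derivative ?\<psi> (at x)) = vector_derivative \<phi> (at x)" for x
    proof -
      have "(?\<psi> has_vector_derivative conjg (vector_derivative \<phi> (at x))) (at x)"
        by (intro bounded_linear.has_vector_derivative[OF bounded_linear_conjg]
            smooth_vector_derivative(1) test_functions_smooth[OF \<phi>])
      then show ?thesis by (simp add: vector_derivative_at)
    qed
    obtain w where w: "w \<in> W12_mu_edge e" "w (lend G e) = 0" "w (rend G e) = 0"
      "AE x in emeas G e. w x = ?\<psi> x"
      and w_int: "\<forall>w'\<in>W12_edge e. (\<forall>x\<in>{lend G e..rend G e}. w' x = w x) \<longrightarrow>
        (\<integral>x. weak_deriv_edge e ?u x * conjg (weak_deriv_edge e w' x) \<partial>lebesgue_edge e)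
        = (\<integral>x. weak_deriv_edge e ?u x * conjg (vector_derivative ?\<psi> (at x)) \<partial>lebesgue_edge e)"
      by (rule test_function_iota[OF \<psi> u])
    define g :: "('v, 'e, 'a) gfun" where "g = ((\<lambda>e' x. if e' = e then w x else 0), \<lambda>v. 0)"
    have zero_W12: "(\<lambda>x. 0::'a) \<in> W12_mu_edge e'"
      and zero_deriv: "e' \<in> E1 G \<Longrightarrow> AE x in lebesgue_edge e'. weak_deriv_edge e' (iota_e G e' (\<lambda>x. 0::'a)) x = 0"
      if e': "e' \<in> E1 G" for e'
    proof -
      interpret E: edge_measure "emeas G e'" "lend G e'" "rend G e'" by (rule edge_measureI[OF G e'])
      have z: "(\<lambda>x. 0::'a) \<in> L2 E.\<Lambda>" by (simp add: L2_def)
      show zw: "(\<lambda>x. 0::'a) \<in> W12_mu_edge e'"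
        using primitive_sobolev(1)[OF z, of "\<lambda>x. 0" 0]
        by (auto simp: W12_mu_def C_mu_def primitive_def intro!: exI[of _ "0::'a"])
      show "AE x in lebesgue_edge e'. weak_deriv_edge e' (iota_e G e' (\<lambda>x. 0::'a)) x = 0"
        by (rule primitive_sobolev(2)[OF z, of _ 0])
           (auto simp: primitive_def E.iota_edge_W12_mu[OF zw])
    qed
    have g_W12: "fst g e' \<in> W12_mu_edge e'" if "e' \<in> E1 G" for e'
      using w(1) zero_W12[OF that] by (cases "e' = e") (auto simp: g_def)
    have "g \<in> hilb G"
      using W12_mu_iota_e(1)[OF g_W12] by (auto simp: hilb_def dom_iota_edge_def)
    then have g_iota: "g \<in> dom_iota G"
      using W12_mu_iota_e(1)[OF g_W12] by (auto simp: dom_iota_def)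
    have g_tr: "btrace G (iota G g) = 0"
    proof
      fix i
      have vals: "iota_e G e' (fst g e') (lend G e') = 0" "iota_e G e' (fst g e') (rend G e') = 0" if e': "e' \<in> E1 G" for e'
      proof -
        have "lend G e' < rend G e'" using edge_measure.ab[OF edge_measureI[OF G e']] .
        then show "iota_e G e' (fst g e') (lend G e') = 0" "iota_e G e' (fst g e') (rend G e') = 0"
          using W12_mu_iota_e(2)[OF g_W12[OF e'] e'] w(2,3) by (auto simp: g_def)
      qed
      show "btrace G (iota G g) i = 0 i"
        using vals by (auto simp: btrace_def coord_restrict_def bindex_def E1'_def iota_def g_def split: sum.splits prod.splits)
    qed
    have "0 \<in> X"
      unfolding mem_X_iff
      using coord.subspace_0[OF coord_space_subspace] coord.subspace_0[OF Xv_subspace]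
      by (auto simp: coord_restrict_def zero_fun_def)
    then have g: "g \<in> dom_form G X" using g_iota g_tr by (simp add: dom_form_def)
    have others: "(\<integral>x. slope f e' x * conjg (slope g e' x) \<partial>lebesgue_edge e') = 0"
      if e': "e' \<in> E1 G" "e' \<noteq> e" for e'
    proof (rule integral_eq_zero_AE)
      show "AE x in lebesgue_edge e'. slope f e' x * conjg (slope g e' x) = 0"
        using zero_deriv[OF e'(1,1)] by eventually_elim (use e' in \<open>simp add: iota_deriv_def g_def\<close>)
    qed
    have "form G L f g = (\<Sum>e'\<in>E1 G. \<integral>x. slope f e' x * conjg (slope g e' x) \<partial>lebesgue_edge e')"
      unfolding form_def g_tr by (simp only: binner_zero_right add_0_right)
    also have "\<dots> = (\<Sum>e'\<in>E1 G. if e' = e then \<integral>x. slope f e x * conjg (slope g e x) \<partial>lebesgue_edge e else 0)"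
      by (intro sum.cong refl) (use others in auto)
    also have "\<dots> = (\<integral>x. slope f e x * conjg (slope g e x) \<partial>lebesgue_edge e)"
      using e finite_E1[OF G] by simp
    also have "\<dots> = (\<integral>x. slope f e x * vector_derivative \<phi> (at x) \<partial>lebesgue_edge e)"
    proof -
      have "fst g e = w" by (simp add: g_def)
      then have "iota_e G e (fst g e) \<in> W12_edge e"
        using iota_e_sobolev(1)[OF W12_mu_iota_e(1)[OF w(1) e] e] by simp
      moreover have "iota_e G e (fst g e) x = w x" if "x \<in> {lend G e..rend G e}" for x
        using W12_mu_iota_e(2)[OF w(1) e that] \<open>fst g e = w\<close> by simp
      ultimately show ?thesis using w_int by (simp add: iota_deriv_def \<psi>')
    qed
    finally have lhs: "form G L f g = (\<integral>x. slope f e x * vector_derivative \<phi> (at x) \<partial>lebesgue_edge e)" .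
    have "hilb_inner G h g = (\<Sum>e'\<in>E1 G. if e' = e then L2_inner (emeas G e) (fst h e) w else 0)"
      unfolding hilb_inner_def by (auto simp: g_def L2_inner_def intro!: sum.cong)
    also have "\<dots> = L2_inner (emeas G e) (fst h e) w" using e finite_E1[OF G] by simp
    also have "\<dots> = L2_inner (emeas G e) (fst h e) ?\<psi>"
    proof (rule L2_inner_cong[OF he _ he _ _ w(4)])
      show "w \<in> L2 (emeas G e)" using w(1) by (intro continuous_L2) (simp add: W12_mu_def C_mu_def)
      show "?\<psi> \<in> L2 (emeas G e)" by (intro continuous_L2 test_functions_continuous[OF \<psi>])
    qed simp
    finally have "hilb_inner G h g = (\<integral>x. fst h e x * \<phi> x \<partial>emeas G e)" by (simp add: L2_inner_def)
    with lhs eq[OF g] show ?thesis by simp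
  qed
  have "slope f e \<in> L1_loc (lend G e) (rend G e)"
    using sobolev_deriv_props(1)[OF uS] by (simp add: weak_deriv_def iota_deriv_def)
  moreover have "integrable (emeas G e) (\<lambda>x. - fst h e x)" using L2_integrable[OF he] by simp
  ultimately show ?thesis unfolding mu_weak_deriv_def using main by blast
qed

text \<open>Uniqueness of \<open>\<partial>\<^sub>\<mu>\<close> identifies \<open>-h\<^sub>e\<close> with the chosen derivative, which thereby inherits square
integrability.\<close>

lemma assoc_op_imp_max:
  assumes fh: "assoc_op G X L f h"
  shows "fst f \<in> dom_max G" and "e \<in> E1 G \<Longrightarrow> AE x in emeas G e. fst h e x = max_op G (fst f) e x"
proof -
  have f: "f \<in> dom_form G X" and h: "h \<in> hilb G" using fh by (auto simp: assoc_op_def)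
  have *: "mu_deriv_edge e (slope f e) \<in> L2 (emeas G e) \<and>
      (AE x in emeas G e. - fst h e x = mu_deriv_edge e (slope f e) x)"
    if e: "e \<in> E1 G" for e
  proof -
    interpret edge_measure "emeas G e" "lend G e" "rend G e" by (rule edge_measureI[OF G e])
    let ?P = "is_mu_deriv e (slope f e)"
    have P: "?P (\<lambda>x. - fst h e x)" by (rule assoc_op_mu_weak_deriv[OF fh e])
    have Q: "?P (mu_deriv_edge e (slope f e))"
      unfolding mu_deriv_def using someI[of ?P, OF P] .
    have ae: "AE x in emeas G e. - fst h e x = mu_deriv_edge e (slope f e) x"
      by (rule mu_weak_deriv_unique[OF P Q])
    have "(\<lambda>x. - fst h e x) \<in> L2 (emeas G e)" using h e by (simp add: hilb_def L2_def)
    then have "mu_deriv_edge e (slope f e) \<in> L2 (emeas G e)"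
      by (rule L2_AE_cong[OF _ _ ae]) (use Q in \<open>auto simp: mu_weak_deriv_def\<close>)
    with ae show ?thesis by simp
  qed
  show "fst f \<in> dom_max G"
    unfolding dom_max_def
  proof (intro CollectI ballI conjI)
    fix e assume e: "e \<in> E1 G"
    show "fst f e \<in> dom_iota_e G e" by (rule dom_form_D(1)[OF f e])
    then show "integrable (lebesgue_edge e) (slope f e)"
      unfolding iota_deriv_def by (intro sobolev_deriv_integrable iota_e_sobolev e)
    show "\<exists>g. is_mu_deriv e (slope f e) g"
      using assoc_op_mu_weak_deriv[OF fh e] by blast
    show "mu_deriv_edge e (slope f e) \<in> L2 (emeas G e)"
      using *[OF e] by blast
  qed
  show "AE x in emeas G e. fst h e x = max_op G (fst f) e x" if "e \<in> E1 G"
    using *[OF that, THEN conjunct2] by eventually_elim (metis max_op_def minus_minus)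
qed

text \<open>Boundary values in \<open>X\<close> are attained by functions that are affine on every edge.\<close>

lemma trace_surjective:
  assumes \<eta>: "\<eta> \<in> X"
  obtains g where "g \<in> dom_form G X" "btrace G (iota G g) = \<eta>"
proof -
  have "\<exists>w. e \<in> E1 G \<longrightarrow> w \<in> W12_mu_edge e \<and>
      w (lend G e) = \<eta> (Inl (e, 0)) \<and> w (rend G e) = \<eta> (Inl (e, 1))" for e
  proof (cases "e \<in> E1 G")
    case True
    then show ?thesis
      using edge_measure.affine_W12_mu[OF edge_measureI[OF G True], of "\<eta> (Inl (e, 0))" "\<eta> (Inl (e, 1))"] by metis
  qed simp
  then obtain w where w: "\<And>e. e \<in> E1 G \<Longrightarrow> w e \<in> W12_mu_edge e \<and>
      w e (lend G e) = \<eta> (Inl (e, 0)) \<and> w e (rend G e) = \<eta> (Inl (e, 1))"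
    by metis
  define g :: "('v, 'e, 'a) gfun" where "g = (w, \<lambda>v. \<eta> (Inr v))"
  have dom: "w e \<in> dom_iota_e G e" if "e \<in> E1 G" for e using W12_mu_iota_e(1) w that by blast
  have g: "g \<in> dom_iota G" using dom by (auto simp: dom_iota_def hilb_def dom_iota_edge_def g_def)
  have vals: "iota_e G e (w e) (lend G e) = \<eta> (Inl (e, 0))" "iota_e G e (w e) (rend G e) = \<eta> (Inl (e, 1))"
    if e: "e \<in> E1 G" for e
    using W12_mu_iota_e(2)[of "w e" e] w[OF e] e edge_measure.ab[OF edge_measureI[OF G e]] by auto
  have "btrace G (iota G g) = \<eta>"
  proof
    fix i
    have \<eta>0: "\<eta> i = 0" if "i \<notin> bindex G" using that \<eta> by (auto simp: mem_X_iff coord_space_def)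
    show "btrace G (iota G g) i = \<eta> i"
    proof (cases "i \<in> bindex G")
      case True
      then show ?thesis
        using vals by (auto simp: bindex_def E1'_def btrace_def coord_restrict_def iota_def g_def)
    next
      case False
      then show ?thesis using \<eta>0 by (simp add: btrace_def coord_restrict_def)
    qed
  qed
  then show thesis using that[of g] g \<eta> by (simp add: dom_form_def)
qed

text \<open>Once the action on the edges is known, only the boundary terms of the form remain, and the
  trace maps the form domain onto \<open>X\<close>.\<close>

lemma assoc_op_iff:
  assumes f: "f \<in> dom_form G X" and h: "h \<in> hilb G"
  shows "assoc_op G X L f h \<longleftrightarrow> fst f \<in> dom_max G \<and>
    (\<forall>e\<in>E1 G. AE x in emeas G e. fst h e x = max_op G (fst f) e x) \<and>
    (\<forall>\<eta>\<in>X. binner G (L (btrace G (iota G f)) - signed_trace G (slope f)) \<eta>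
      = (\<Sum>v\<in>V1 G. snd h v * conjg (\<eta> (Inr v)) * of_real (weight G v)))"
proof -
  let ?\<rho> = "L (btrace G (iota G f)) - signed_trace G (slope f)"
  have test: "form G L f g = hilb_inner G h g \<longleftrightarrow>
      binner G ?\<rho> (btrace G (iota G g))
        = (\<Sum>v\<in>V1 G. snd h v * conjg (btrace G (iota G g) (Inr v)) * of_real (weight G v))"
    if m: "fst f \<in> dom_max G" and ae: "\<forall>e\<in>E1 G. AE x in emeas G e. fst h e x = max_op G (fst f) e x"
      and g: "g \<in> dom_form G X" for g
  proof -
    have "L2_inner (emeas G e) (fst h e) (fst g e) = L2_inner (emeas G e) (max_op G (fst f) e) (fst g e)"
      if e: "e \<in> E1 G" for e
      using h e ae by (intro L2_inner_cong max_op_spec(2)[OF m e] dom_form_D(2)[OF g e]) (auto simp: hilb_def)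
    then have "(\<Sum>e\<in>E1 G. L2_inner (emeas G e) (fst h e) (fst g e))
        = (\<Sum>e\<in>E1 G. L2_inner (emeas G e) (max_op G (fst f) e) (fst g e))"
      by (intro sum.cong) auto
    moreover have "(\<Sum>v\<in>V1 G. snd h v * conjg (btrace G (iota G g) (Inr v)) * of_real (weight G v))
        = (\<Sum>v\<in>V1 G. snd h v * conjg (snd g v) * of_real (weight G v))"
      by (intro sum.cong) (auto simp: btrace_eq iota_def)
    ultimately show ?thesis unfolding form_eq[OF f m g] hilb_inner_def by simp
  qed
  show ?thesis
  proof
    assume fh: "assoc_op G X L f h"
    have m: "fst f \<in> dom_max G" and ae: "\<forall>e\<in>E1 G. AE x in emeas G e. fst h e x = max_op G (fst f) e x"
      using assoc_op_imp_max[OF fh] by auto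
    moreover have "binner G ?\<rho> \<eta> = (\<Sum>v\<in>V1 G. snd h v * conjg (\<eta> (Inr v)) * of_real (weight G v))"
      if \<eta>: "\<eta> \<in> X" for \<eta>
    proof -
      obtain g where g: "g \<in> dom_form G X" "btrace G (iota G g) = \<eta>" using trace_surjective[OF \<eta>] .
      have "form G L f g = hilb_inner G h g" using fh g(1) by (simp add: assoc_op_def)
      then show ?thesis using test[OF m ae g(1)] g(2) by simp
    qed
    ultimately show "fst f \<in> dom_max G \<and>
        (\<forall>e\<in>E1 G. AE x in emeas G e. fst h e x = max_op G (fst f) e x) \<and>
        (\<forall>\<eta>\<in>X. binner G ?\<rho> \<eta> = (\<Sum>v\<in>V1 G. snd h v * conjg (\<eta> (Inr v)) * of_real (weight G v)))"
      by blast
  next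
    assume r: "fst f \<in> dom_max G \<and>
        (\<forall>e\<in>E1 G. AE x in emeas G e. fst h e x = max_op G (fst f) e x) \<and>
        (\<forall>\<eta>\<in>X. binner G ?\<rho> \<eta> = (\<Sum>v\<in>V1 G. snd h v * conjg (\<eta> (Inr v)) * of_real (weight G v)))"
    show "assoc_op G X L f h"
      unfolding assoc_op_def
    proof (intro conjI ballI f h)
      fix g assume g: "g \<in> dom_form G X"
      then have "btrace G (iota G g) \<in> X" by (simp add: dom_form_def)
      then show "form G L f g = hilb_inner G h g" using r test[OF _ _ g] by blast
    qed
  qed
qed

text \<open>The signed trace vanishes at the vertices, so restricting it to \<open>E\<^sub>1\<^sub>,\<^sub>v\<close> or to \<open>S\<^sub>v\<close> gives the
same vector.\<close>

lemma signed_trace_at_eq: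
  "signed_trace_at G v u = coord_restrict (S_at G v) (signed_trace G u)"
  by (auto simp: signed_trace_at_def coord_restrict_def S_at_def fun_eq_iff signed_trace_def)

lemma dom_form_iff:
  "f \<in> dom_form G X \<longleftrightarrow> f \<in> dom_iota G \<and> (\<forall>v\<in>verts G. trace_at G v (iota G f) \<in> Xv v)"
  by (simp add: dom_form_def mem_X_iff btrace_coord_space trace_at_def)

lemma assoc_op_iff_local:
  assumes f: "f \<in> dom_form G X" and h: "h \<in> hilb G"
  shows "assoc_op G X L f h \<longleftrightarrow> fst f \<in> dom_max G \<and>
    (\<forall>e\<in>E1 G. AE x in emeas G e. fst h e x = max_op G (fst f) e x) \<and>
    (\<forall>v\<in>verts G. orth_proj G (X0_at G Xv v) (signed_trace_at G v (slope f)) =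
        orth_proj G (X0_at G Xv v) (Lv v (trace_at G v (iota G f)))) \<and>
    (\<forall>v\<in>V1 G. snd h v = 1 / of_real (weight G v) *
        binner G (Lv v (trace_at G v (iota G f)) - signed_trace_at G v (slope f)) (\<xi> v))"
proof -
  let ?\<rho> = "L (btrace G (iota G f)) - signed_trace G (slope f)"
  let ?s = "\<lambda>v. signed_trace_at G v (slope f)" and ?l = "\<lambda>v. Lv v (trace_at G v (iota G f))"
  have tr: "btrace G (iota G f) \<in> X" using f by (simp add: dom_form_def)
  have \<rho>: "coord_restrict (S_at G v) ?\<rho> = ?l v - ?s v" if v: "v \<in> verts G" for v
  proof -
    have "coord_restrict (S_at G v) ?\<rho> = coord_restrict (S_at G v) (L (btrace G (iota G f)))
        - coord_restrict (S_at G v) (signed_trace G (slope f))"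
      by (auto simp: coord_restrict_def fun_eq_iff)
    then show ?thesis by (simp only: restrict_L[OF tr v] trace_at_def signed_trace_at_eq)
  qed
  have proj: "orth_proj G (X0_at G Xv v) (?s v) = orth_proj G (X0_at G Xv v) (?l v)
      \<longleftrightarrow> (\<forall>\<zeta>\<in>X0_at G Xv v. binner G (?l v - ?s v) \<zeta> = 0)" if v: "v \<in> verts G" for v
  proof -
    have "X0_at G Xv v \<subseteq> coord_space (bindex G)"
      using X0_at_subset Xv_subset_X[OF v] by (fastforce simp: mem_X_iff)
    from orth_proj_eq_iff[OF G X0_at_subspace[OF v] this]
    show ?thesis by (simp add: binner_diff_left) (metis)
  qed
  have "(\<forall>\<eta>\<in>X. binner G ?\<rho> \<eta> = (\<Sum>v\<in>V1 G. snd h v * conjg (\<eta> (Inr v)) * of_real (weight G v)))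
    \<longleftrightarrow> (\<forall>v\<in>verts G. (\<forall>\<zeta>\<in>X0_at G Xv v. binner G (?l v - ?s v) \<zeta> = 0) \<and>
      (v \<in> V1 G \<longrightarrow> snd h v = 1 / of_real (weight G v) * binner G (?l v - ?s v) (\<xi> v)))"
    unfolding boundary_condition_localize by (intro ball_cong refl) (simp only: \<rho> vertex_condition_iff)
  then show ?thesis
    unfolding assoc_op_iff[OF f h] using proj V1_verts(1) by blast
qed

end

theorem corollary5p1:
  fixes G :: "('v, 'e) measure_graph"
    and X :: "(('v, 'e) bidx \<Rightarrow> 'a::real_or_complex) set"
    and L :: "(('v, 'e) bidx \<Rightarrow> 'a) \<Rightarrow> (('v, 'e) bidx \<Rightarrow> 'a)"
    and Xv :: "'v \<Rightarrow> (('v, 'e) bidx \<Rightarrow> 'a) set"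
    and Lv :: "'v \<Rightarrow> (('v, 'e) bidx \<Rightarrow> 'a) \<Rightarrow> (('v, 'e) bidx \<Rightarrow> 'a)"
    and \<xi> :: "'v \<Rightarrow> ('v, 'e) bidx \<Rightarrow> 'a"
  assumes "valid_graph G"
    and "bc_in G (bindex G) X L"
    and "local_decomp G X L Xv Lv"
    and "\<forall>v\<in>V1 G. \<xi> v \<in> Xv v \<and> \<xi> v (Inr v) = 1"
  shows "dom_op G X L =
      {f \<in> hilb G. fst f \<in> dom_max G \<and>
        (\<forall>v\<in>verts G.
          trace_at G v (iota G f) \<in> Xv v \<and>
          orth_proj G (X0_at G Xv v) (signed_trace_at G v (iota_deriv G (fst f))) =
          orth_proj G (X0_at G Xv v) (Lv v (trace_at G v (iota G f))))}
    \<and> (\<forall>f\<in>dom_op G X L. \<forall>h\<in>hilb G. assoc_op G X L f h \<longleftrightarrow>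
      (\<forall>e\<in>E1 G. AE x in emeas G e. fst h e x = max_op G (fst f) e x) \<and>
      (\<forall>v\<in>V1 G. snd h v = 1 / of_real (weight G v) *
        binner G (Lv v (trace_at G v (iota G f)) - signed_trace_at G v (iota_deriv G (fst f))) (\<xi> v)))"
proof -
  interpret local_boundary_conditions G X L Xv Lv \<xi>
    using assms by unfold_locales auto
  let ?R = "{f \<in> hilb G. fst f \<in> dom_max G \<and>
        (\<forall>v\<in>verts G.
          trace_at G v (iota G f) \<in> Xv v \<and>
          orth_proj G (X0_at G Xv v) (signed_trace_at G v (iota_deriv G (fst f))) =
          orth_proj G (X0_at G Xv v) (Lv v (trace_at G v (iota G f))))}"
  have sub: "f \<in> ?R \<and> f \<in> dom_form G X" if "f \<in> dom_op G X L" for f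
  proof -
    obtain h where fh: "assoc_op G X L f h" using \<open>f \<in> dom_op G X L\<close> by (auto simp: dom_op_def)
    then have f: "f \<in> dom_form G X" and h: "h \<in> hilb G" by (auto simp: assoc_op_def)
    from fh f h show ?thesis
      unfolding assoc_op_iff_local[OF f h] by (auto simp: dom_form_iff dom_iota_def)
  qed
  have sup: "f \<in> dom_op G X L" if f: "f \<in> ?R" for f
  proof -
    have fd: "f \<in> dom_form G X"
      using f by (auto simp: dom_form_iff dom_iota_def dom_max_def)
    define h where "h = (max_op G (fst f), \<lambda>v. 1 / of_real (weight G v) *
        binner G (Lv v (trace_at G v (iota G f)) - signed_trace_at G v (iota_deriv G (fst f))) (\<xi> v))"
    have "h \<in> hilb G" using f max_op_spec(2) by (auto simp: hilb_def h_def)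
    then have "assoc_op G X L f h"
      using assoc_op_iff_local[OF fd] f by (auto simp: h_def)
    then show ?thesis unfolding dom_op_def by blast
  qed
  have "dom_op G X L = ?R" using sub sup by blast
  moreover have "assoc_op G X L f h \<longleftrightarrow>
      (\<forall>e\<in>E1 G. AE x in emeas G e. fst h e x = max_op G (fst f) e x) \<and>
      (\<forall>v\<in>V1 G. snd h v = 1 / of_real (weight G v) *
        binner G (Lv v (trace_at G v (iota G f)) - signed_trace_at G v (iota_deriv G (fst f))) (\<xi> v))"
    if f: "f \<in> dom_op G X L" and h: "h \<in> hilb G" for f h
    using assoc_op_iff_local[OF conjunct2[OF sub[OF f]] h] sub[OF f] by blast
  ultimately show ?thesis by blast
qed

end
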